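(* Let $\mathbf G$ be a module over a commutative ring $\mathbf A$ with unit and let $(X_1,X_2),(Y_1,Y_2)$ be pairs in $\mathcal D_\wp$, neither equal to $(\{\wp\},\emptyset)$. Then, as $\mathbf A$-modules, $$\mathbf H_q((X_1,X_2)\times(Y_1,Y_2);\mathbf G)\cong\begin{cases}\mathbf H_{q+1}(X_1*Y_1;\mathbf G)\oplus\mathbf H_q(X_1;\mathbf G)\oplus\mathbf H_q(Y_1;\mathbf G)&\text{if }C_1\\ \mathbf H_{q+1}((X_1,\emptyset)*(Y_1,Y_2);\mathbf G)\oplus\mathbf H_q(Y_1,Y_2;\mathbf G)&\text{if }C_2\\ \mathbf H_{q+1}((X_1,X_2)*(Y_1,\emptyset);\mathbf G)\oplus\mathbf H_q(X_1,X_2;\mathbf G)&\text{if }C_3\\ \mathbf H_{q+1}((X_1,X_2)*(Y_1,Y_2);\mathbf G)&\text{if }C_4\end{cases}$$ where $C_1$: $X_1\times Y_1\ne\emptyset,\{\wp\}$ and $X_2=\emptyset=Y_2$; $C_2$: $X_1\times Y_1\ne\emptyset,\{\wp\}$ and $X_2=\emptyset\ne Y_2$; $C_3$: $X_1\times Y_1\ne\emptyset,\{\wp\}$ and $X_2\neq\emptyset=Y_2$; $C_4$: $X_1\times Y_1=\emptyset$ or $\{\wp\}$, or $X_2\ne\emptyset\ne Y_2$. The same holds with $\hat*$ in place of $*$.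
   Context: Category $\mathcal D_\wp$: objects are the empty space $\emptyset$ and spaces $X_\wp=X\sqcup\{\wp\}$ ($X$ classical, possibly empty; $\wp$ an added isolated point); $\mathcal F(X_\wp)=X$. Augmental homology of a pair $X_2\subset X_1$: $\mathbf H_i(X_1,X_2;\mathbf G)=H_i(\mathcal F X_1,\mathcal F X_2;\mathbf G)$ (classical relative singular) if $X_2\ne\emptyset$; $=\tilde H_i(\mathcal FX_1;\mathbf G)$ (reduced) if $X_2=\emptyset$, $X_1\neq\emptyset,\{\wp\}$; $=\mathbf G$ in degree $-1$ and $0$ otherwise if $X_1=\{\wp\}$, $X_2=\emptyset$; $=0$ if both are empty; $\mathbf H_i(X):=\mathbf H_i(X,\emptyset)$. Product and joins: $X_\wp\times Y_\wp:=(\mathcal FX\times\mathcal FY)\sqcup\{\wp\}$, $X_\wp* Y_\wp:=(\mathcal FX*\mathcal FY)\sqcup\{\wp\}$ with the classical convention $X*\emptyset=X$; any product or join with the object $\emptyset$ is $\emptyset$. For nonempty classical $X,Y$ the join is the quotient of $X\sqcup(X\times Y\times[0,1])\sqcup Y$ by $(x,y,1)\sim x$, $(x,y,0)\sim y$; $*$ has the quotient topology and $\hat*$ the coarsest topology making the coordinate functions continuous. Pairs: $(X_1,X_2)\nabla(Y_1,Y_2):=(X_1\nabla Y_1,(X_1\nabla Y_2)\cup(X_2\nabla Y_1))$. *)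

theory Defs
  imports "HOL-Homology.Homology" "HOL-Library.Function_Algebras"
begin

record ('r, 'm) amod =
  mcar :: "'m set"
  madd :: "'m \<Rightarrow> 'm \<Rightarrow> 'm"
  msmul :: "'r \<Rightarrow> 'm \<Rightarrow> 'm"

definition mod_iso :: "('r, 'm) amod \<Rightarrow> ('r, 'n) amod \<Rightarrow> bool" where
  "mod_iso M N \<longleftrightarrow> (\<exists>f. bij_betw f (mcar M) (mcar N)
      \<and> (\<forall>x\<in>mcar M. \<forall>y\<in>mcar M. f (madd M x y) = madd N (f x) (f y))
      \<and> (\<forall>r. \<forall>x\<in>mcar M. f (msmul M r x) = msmul N r (f x)))"

definition dsum :: "('r, 'm) amod \<Rightarrow> ('r, 'n) amod \<Rightarrow> ('r, 'm \<times> 'n) amod" where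
  "dsum M N = \<lparr>mcar = mcar M \<times> mcar N,
      madd = (\<lambda>(x,y) (x',y'). (madd M x x', madd N y y')),
      msmul = (\<lambda>r (x,y). (msmul M r x, msmul N r y))\<rparr>"

definition coset :: "'m::ab_group_add \<Rightarrow> 'm set \<Rightarrow> 'm set" where
  "coset z B = (\<lambda>b. z + b) ` B"

definition quot_mod :: "('r \<Rightarrow> 'm::ab_group_add \<Rightarrow> 'm) \<Rightarrow> 'm set \<Rightarrow> 'm set \<Rightarrow> ('r, 'm set) amod" where
  "quot_mod sc Z B = \<lparr>mcar = (\<lambda>z. coset z B) ` Z,
      madd = (\<lambda>C D. coset ((SOME c. c \<in> C) + (SOME d. d \<in> D)) B),
      msmul = (\<lambda>r C. coset (sc r (SOME c. c \<in> C)) B)\<rparr>"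

type_synonym ('a, 'g) gchain = "(((nat \<Rightarrow> real) \<Rightarrow> 'a) \<Rightarrow> 'g)"

definition gchains :: "nat \<Rightarrow> 'a topology \<Rightarrow> ('a, 'g::zero) gchain set" where
  "gchains n X = {c. finite {\<sigma>. c \<sigma> \<noteq> 0} \<and> (\<forall>\<sigma>. c \<sigma> \<noteq> 0 \<longrightarrow> singular_simplex n X \<sigma>)}"

definition gbd :: "nat \<Rightarrow> ('a, 'g::ab_group_add) gchain \<Rightarrow> ('a, 'g) gchain" where
  "gbd n c = (if n = 0 then 0 else
     (\<lambda>\<tau>. \<Sum>(\<sigma>,k) \<in> {(\<sigma>,k). c \<sigma> \<noteq> 0 \<and> k \<le> n \<and> singular_face n k \<sigma> = \<tau>}.
            (if even k then c \<sigma> else - c \<sigma>)))"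

definition gscale :: "('r \<Rightarrow> 'g \<Rightarrow> 'g) \<Rightarrow> 'r \<Rightarrow> ('a, 'g) gchain \<Rightarrow> ('a, 'g) gchain" where
  "gscale sc r c = (\<lambda>\<sigma>. sc r (c \<sigma>))"

definition gaug :: "('a, 'g::ab_group_add) gchain \<Rightarrow> 'g" where
  "gaug c = (\<Sum>\<sigma>\<in>{\<sigma>. c \<sigma> \<noteq> 0}. c \<sigma>)"

definition zero_mod :: "('r \<Rightarrow> 'g::ab_group_add \<Rightarrow> 'g) \<Rightarrow> ('r, ('a,'g) gchain set) amod" where
  "zero_mod sc = quot_mod (gscale sc) {0} {0}"

definition rel_hom :: "('r \<Rightarrow> 'g::ab_group_add \<Rightarrow> 'g) \<Rightarrow> int \<Rightarrow> 'a topology \<Rightarrow> 'a set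
                       \<Rightarrow> ('r, ('a,'g) gchain set) amod" where
  "rel_hom sc q X S = (if q < 0 then zero_mod sc else
     (let n = nat q in
      quot_mod (gscale sc)
        {c \<in> gchains n X. gbd n c \<in> gchains (n - 1) (subtopology X S)}
        {gbd (Suc n) d + e | d e. d \<in> gchains (Suc n) X \<and> e \<in> gchains n (subtopology X S)}))"

text \<open>Homology of the augmented singular complex of X (chain module G in degree -1,
  augmentation as boundary from degree 0). For X nonempty this is reduced homology;
  for X empty it is G in degree -1 and 0 otherwise. Degree -1 chains (elements of G)
  are encoded as constant functions.\<close>
definition aug_hom :: "('r \<Rightarrow> 'g::ab_group_add \<Rightarrow> 'g) \<Rightarrow> int \<Rightarrow> 'a topology
                       \<Rightarrow> ('r, ('a,'g) gchain set) amod" where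
  "aug_hom sc q X = (if q < -1 then zero_mod sc
     else if q = -1 then
       quot_mod (gscale sc) (range (\<lambda>g. \<lambda>\<sigma>. g)) {(\<lambda>\<sigma>. gaug c) | c. c \<in> gchains 0 X}
     else if q = 0 then
       quot_mod (gscale sc) {c \<in> gchains 0 X. gaug c = 0} {gbd 1 d | d. d \<in> gchains 1 X}
     else rel_hom sc q X {})"

text \<open>An object of D_wp is represented by an option: None is the empty space, Some X is
  X_wp = X + {wp}, so F(Some X) = X.  A pair (X1, X2) with X2 a subobject of X1 is
  represented by X1 :: 'a topology option and X2 :: 'a set option (the F-part of X2 as a
  subset of F X1, carrying the subspace topology).\<close>

definition pair_ok :: "'a topology option \<Rightarrow> 'a set option \<Rightarrow> bool" where
  "pair_ok X1 X2 \<longleftrightarrow> (X1 = None \<longrightarrow> X2 = None) \<and>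
     (\<forall>X S. X1 = Some X \<and> X2 = Some S \<longrightarrow> S \<subseteq> topspace X)"

definition aH :: "('r \<Rightarrow> 'g::ab_group_add \<Rightarrow> 'g) \<Rightarrow> int \<Rightarrow> 'a topology option \<Rightarrow> 'a set option
                  \<Rightarrow> ('r, ('a,'g) gchain set) amod" where
  "aH sc q X1 X2 = (case X1 of None \<Rightarrow> zero_mod sc
     | Some X \<Rightarrow> (case X2 of None \<Rightarrow> aug_hom sc q X | Some S \<Rightarrow> rel_hom sc q X S))"

definition ounion :: "'a set option \<Rightarrow> 'a set option \<Rightarrow> 'a set option" where
  "ounion A B = (case A of None \<Rightarrow> B | Some A' \<Rightarrow> (case B of None \<Rightarrow> Some A' | Some B' \<Rightarrow> Some (A' \<union> B')))"

definition oprod_top :: "'a topology option \<Rightarrow> 'b topology option \<Rightarrow> ('a \<times> 'b) topology option" where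
  "oprod_top X Y = (case (X, Y) of (Some X', Some Y') \<Rightarrow> Some (prod_topology X' Y') | _ \<Rightarrow> None)"

definition oprod_set :: "'a set option \<Rightarrow> 'b set option \<Rightarrow> ('a \<times> 'b) set option" where
  "oprod_set A B = (case (A, B) of (Some A', Some B') \<Rightarrow> Some (A' \<times> B') | _ \<Rightarrow> None)"

definition prod_pair_snd :: "'a topology option \<Rightarrow> 'a set option \<Rightarrow> 'b topology option \<Rightarrow> 'b set option
                            \<Rightarrow> ('a \<times> 'b) set option" where
  "prod_pair_snd X1 X2 Y1 Y2 =
     ounion (oprod_set (map_option topspace X1) Y2) (oprod_set X2 (map_option topspace Y1))"

text \<open>Points of the join X*Y: JX x (the class of (x,y,1)), JY y (the class of (x,y,0)),
  and JM x y t for 0 < t < 1.\<close>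
datatype ('a, 'b) joinpt = JX 'a | JY 'b | JM 'a 'b real

definition jset :: "'a set \<Rightarrow> 'b set \<Rightarrow> ('a, 'b) joinpt set" where
  "jset A B = JX ` A \<union> JY ` B \<union> {JM x y t | x y t. x \<in> A \<and> y \<in> B \<and> 0 < t \<and> t < 1}"

definition jproj :: "'a \<times> 'b \<times> real \<Rightarrow> ('a, 'b) joinpt" where
  "jproj = (\<lambda>(x, y, t). if t = 1 then JX x else if t = 0 then JY y else JM x y t)"

text \<open>Join with the quotient topology of X + (X x Y x [0,1]) + Y (so X * empty = X).\<close>
definition qjoin :: "'a topology \<Rightarrow> 'b topology \<Rightarrow> ('a, 'b) joinpt topology" where
  "qjoin X Y = topology_generated_by
     {U. U \<subseteq> jset (topspace X) (topspace Y)
       \<and> openin X {x \<in> topspace X. JX x \<in> U}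
       \<and> openin Y {y \<in> topspace Y. JY y \<in> U}
       \<and> openin (prod_topology X (prod_topology Y (top_of_set {0..1::real})))
           {p \<in> topspace X \<times> topspace Y \<times> {0..1}. jproj p \<in> U}}"

fun jt :: "('a, 'b) joinpt \<Rightarrow> real" where
  "jt (JX x) = 1" | "jt (JY y) = 0" | "jt (JM x y t) = t"

fun jx :: "('a, 'b) joinpt \<Rightarrow> 'a" where
  "jx (JX x) = x" | "jx (JY y) = undefined" | "jx (JM x y t) = x"

fun jy :: "('a, 'b) joinpt \<Rightarrow> 'b" where
  "jy (JX x) = undefined" | "jy (JY y) = y" | "jy (JM x y t) = y"

definition hjoin :: "'a topology \<Rightarrow> 'b topology \<Rightarrow> ('a, 'b) joinpt topology" where
  "hjoin X Y = topology_generated_by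
     ({{p \<in> jset (topspace X) (topspace Y). jt p \<in> V} | V. openin (top_of_set {0..1::real}) V}
    \<union> {{p \<in> jset (topspace X) (topspace Y). 0 < jt p \<and> jx p \<in> U} | U. openin X U}
    \<union> {{p \<in> jset (topspace X) (topspace Y). jt p < 1 \<and> jy p \<in> U} | U. openin Y U})"

definition ojoin_top :: "('a topology \<Rightarrow> 'b topology \<Rightarrow> ('a, 'b) joinpt topology)
     \<Rightarrow> 'a topology option \<Rightarrow> 'b topology option \<Rightarrow> ('a, 'b) joinpt topology option" where
  "ojoin_top J X Y = (case (X, Y) of (Some X', Some Y') \<Rightarrow> Some (J X' Y') | _ \<Rightarrow> None)"

definition ojset :: "'a set option \<Rightarrow> 'b set option \<Rightarrow> ('a, 'b) joinpt set option" where
  "ojset A B = (case (A, B) of (Some A', Some B') \<Rightarrow> Some (jset A' B') | _ \<Rightarrow> None)"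

definition join_pair_snd :: "'a topology option \<Rightarrow> 'a set option \<Rightarrow> 'b topology option \<Rightarrow> 'b set option
                            \<Rightarrow> ('a, 'b) joinpt set option" where
  "join_pair_snd X1 X2 Y1 Y2 =
     ounion (ojset (map_option topspace X1) Y2) (ojset X2 (map_option topspace Y1))"

definition prod_nontriv :: "'a topology option \<Rightarrow> 'b topology option \<Rightarrow> bool" where
  "prod_nontriv X1 Y1 \<longleftrightarrow> (\<exists>P. oprod_top X1 Y1 = Some P \<and> topspace P \<noteq> {})"

definition is_wp_empty :: "'a topology option \<Rightarrow> 'a set option \<Rightarrow> bool" where
  "is_wp_empty X1 X2 \<longleftrightarrow> (\<exists>X. X1 = Some X \<and> topspace X = {} \<and> X2 = None)"

end

theory Submission
  imports Defs "HOL-Analysis.Abstract_Topological_Spaces"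
begin

text \<open>
  All cases with nonempty \<open>X\<close>, \<open>Y\<close> are instances of one statement about \<open>A \<subseteq> X\<close>, \<open>B \<subseteq> Y\<close>, \<open>Q \<subseteq> A \<times> B\<close>
  and the part \<open>V\<close> of the join \<open>W = X * Y\<close> over \<open>A\<close>, \<open>B\<close>, \<open>Q\<close>:
  \<open>H\<^sub>q(X \<times> Y, Q) = H\<^bsub>q+1\<^esub>(W, V) \<oplus> H\<^sub>q(X, A) \<oplus> H\<^sub>q(Y, B)\<close>.
  It comes from the Mayer--Vietoris sequence of the cover of \<open>W\<close> by the two open ends, which deform onto
  \<open>X\<close> and \<open>Y\<close> and meet in \<open>X \<times> Y \<times> (1/3, 2/3)\<close>, because the projections of the pair \<open>(X \<times> Y, Q)\<close> to
  \<open>(X, A)\<close> and \<open>(Y, B)\<close> have sections, or a target with vanishing homology. For the absolute case, take base points for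
  \<open>A\<close> and \<open>B\<close>; then \<open>V\<close> is a segment, and reduced homology is homology relative to a contractible subspace.
  Only three properties of the topology of \<open>W\<close> are used: continuity of the map from \<open>X \<times> Y \<times> [0,1]\<close>, of the
  coordinates where they are defined, and of reparametrisations of the join parameter.

  Chains with coefficients are handled by extending the natural operators on integral singular chains
  linearly.
\<close>

section \<open>Modules as carrier records\<close>

text \<open>On chains the isomorphism is
  \<open>z \<mapsto> (K n (S n z), gmap n fst z, gmap n snd z)\<close>. The chain
  \<open>K n z\<close> spans \<open>z\<close> across the join, so its boundary consists of the two
  projections of \<open>z\<close>, placed at the ends, and of \<open>K\<close> applied to the
  boundary of \<open>z\<close>. For it to be a relative cycle the projections must lie in
  \<open>A\<close> and \<open>B\<close> as chains, not only up to homology. The operator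
  \<open>S\<close> arranges this by subtracting from \<open>z\<close> what the sections rebuild from
  its projections. The four nontrivial cases are the choices
  \<open>({x0}, {y0}, {(x0, y0)})\<close>, \<open>(X, B, X \<times> B)\<close>,
  \<open>(A, Y, A \<times> Y)\<close> and \<open>(X, Y, X \<times> B \<union> A \<times> Y)\<close>
  of \<open>(A, B, Q)\<close>; a summand disappears when \<open>A\<close> or \<open>B\<close> is the
  whole space. The obstacle is that \<open>V\<close> is an arbitrary subspace, in general neither
  open nor a neighbourhood retract. The argument therefore cuts a chain of \<open>W\<close> and its
  part in \<open>V\<close> along the same two open ends, with one common subdivision. Working with
  explicit chains instead of exact sequences also shows directly that the maps respect
  scalars.\<close>

definition mod_closed :: "('r, 'm) amod \<Rightarrow> bool" where
  "mod_closed M \<longleftrightarrow> (\<forall>x\<in>mcar M. \<forall>y\<in>mcar M. madd M x y \<in> mcar M) \<and>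
     (\<forall>r. \<forall>x\<in>mcar M. msmul M r x \<in> mcar M)"

definition mod_trivial :: "('r, 'm) amod \<Rightarrow> bool" where
  "mod_trivial M \<longleftrightarrow> mod_closed M \<and> (\<exists>e. mcar M = {e})"

lemma mod_isoI:
  assumes "bij_betw f (mcar M) (mcar N)"
    and "\<And>x y. x \<in> mcar M \<Longrightarrow> y \<in> mcar M \<Longrightarrow> f (madd M x y) = madd N (f x) (f y)"
    and "\<And>r x. x \<in> mcar M \<Longrightarrow> f (msmul M r x) = msmul N r (f x)"
  shows "mod_iso M N"
  using assms unfolding mod_iso_def by blast

lemma mod_iso_refl: "mod_iso M M"
  by (rule mod_isoI[where f = id]) auto

lemma mod_iso_trans:
  assumes "mod_iso M N" "mod_iso N P"
  shows "mod_iso M P"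
proof -
  obtain f where f: "bij_betw f (mcar M) (mcar N)"
    "\<And>x y. x \<in> mcar M \<Longrightarrow> y \<in> mcar M \<Longrightarrow> f (madd M x y) = madd N (f x) (f y)"
    "\<And>r x. x \<in> mcar M \<Longrightarrow> f (msmul M r x) = msmul N r (f x)"
    using assms(1) unfolding mod_iso_def by blast
  obtain g where g: "bij_betw g (mcar N) (mcar P)"
    "\<And>x y. x \<in> mcar N \<Longrightarrow> y \<in> mcar N \<Longrightarrow> g (madd N x y) = madd P (g x) (g y)"
    "\<And>r x. x \<in> mcar N \<Longrightarrow> g (msmul N r x) = msmul P r (g x)"
    using assms(2) unfolding mod_iso_def by blast
  have "\<And>x. x \<in> mcar M \<Longrightarrow> f x \<in> mcar N"
    using f(1) by (auto simp: bij_betw_def)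
  then show ?thesis
    by (intro mod_isoI[where f = "g \<circ> f"] bij_betw_trans[OF f(1) g(1)]) (auto simp: f g)
qed

text \<open>The operations of a record are unconstrained functions. Closedness of \<open>M\<close>
  puts \<open>madd M x y\<close> and \<open>msmul M r x\<close> into the domain on which
  \<open>f\<close> can be inverted.\<close>

lemma mod_iso_sym:
  assumes "mod_iso M N" "mod_closed M"
  shows "mod_iso N M"
proof -
  obtain f where f: "bij_betw f (mcar M) (mcar N)"
    "\<And>x y. x \<in> mcar M \<Longrightarrow> y \<in> mcar M \<Longrightarrow> f (madd M x y) = madd N (f x) (f y)"
    "\<And>r x. x \<in> mcar M \<Longrightarrow> f (msmul M r x) = msmul N r (f x)"
    using assms(1) unfolding mod_iso_def by blast
  let ?g = "inv_into (mcar M) f"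
  have g: "?g (f x) = x" if "x \<in> mcar M" for x
    using f(1) that by (simp add: bij_betw_inv_into_left)
  have im: "mcar N = f ` mcar M"
    using f(1) by (simp add: bij_betw_def)
  show ?thesis
  proof (rule mod_isoI[where f = ?g])
    show "bij_betw ?g (mcar N) (mcar M)"
      using f(1) by (rule bij_betw_inv_into)
    show "?g (madd N u v) = madd M (?g u) (?g v)" if uv: "u \<in> mcar N" "v \<in> mcar N" for u v
    proof -
      obtain x y where xy: "x \<in> mcar M" "y \<in> mcar M" "u = f x" "v = f y"
        using uv im by blast
      then show ?thesis
        using f(2)[of x y] assms(2) by (metis g mod_closed_def)
    qed
    show "?g (msmul N r u) = msmul M r (?g u)" if u: "u \<in> mcar N" for r u
    proof -
      obtain x where "x \<in> mcar M" "u = f x"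
        using u im by blast
      then show ?thesis
        using f(3)[of x r] assms(2) by (metis g mod_closed_def)
    qed
  qed
qed

lemma mod_closed_dsum: "mod_closed M \<Longrightarrow> mod_closed N \<Longrightarrow> mod_closed (dsum M N)"
  by (auto simp: mod_closed_def dsum_def)

lemma dsum_cong:
  assumes "mod_iso M M'" "mod_iso N N'"
  shows "mod_iso (dsum M N) (dsum M' N')"
proof -
  obtain f where f: "bij_betw f (mcar M) (mcar M')"
    "\<And>x y. x \<in> mcar M \<Longrightarrow> y \<in> mcar M \<Longrightarrow> f (madd M x y) = madd M' (f x) (f y)"
    "\<And>r x. x \<in> mcar M \<Longrightarrow> f (msmul M r x) = msmul M' r (f x)"
    using assms(1) unfolding mod_iso_def by blast
  obtain g where g: "bij_betw g (mcar N) (mcar N')"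
    "\<And>x y. x \<in> mcar N \<Longrightarrow> y \<in> mcar N \<Longrightarrow> g (madd N x y) = madd N' (g x) (g y)"
    "\<And>r x. x \<in> mcar N \<Longrightarrow> g (msmul N r x) = msmul N' r (g x)"
    using assms(2) unfolding mod_iso_def by blast
  show ?thesis
    by (rule mod_isoI[where f = "map_prod f g"])
      (use bij_betw_map_prod[OF f(1) g(1)] f g in \<open>auto simp: dsum_def\<close>)
qed

lemma mod_iso_trivial:
  assumes "mod_trivial M" "mod_trivial N"
  shows "mod_iso M N"
proof -
  obtain e e' where e: "mcar M = {e}" "mcar N = {e'}"
    using assms unfolding mod_trivial_def by blast
  then show ?thesis
    using assms by (intro mod_isoI[where f = "\<lambda>_. e'"])
      (auto simp: mod_trivial_def mod_closed_def bij_betw_def)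
qed

lemma mod_trivial_dsum: "mod_trivial M \<Longrightarrow> mod_trivial N \<Longrightarrow> mod_trivial (dsum M N)"
  by (auto simp: mod_trivial_def mod_closed_def dsum_def)

lemma dsum_trivial_right:
  assumes "mod_trivial N"
  shows "mod_iso (dsum M N) M"
proof -
  obtain e where "mcar N = {e}"
    using assms unfolding mod_trivial_def by blast
  then show ?thesis
    by (intro mod_isoI[where f = fst]) (auto simp: dsum_def bij_betw_def inj_on_def)
qed

section \<open>Submodules and their quotients\<close>

definition submod :: "('r \<Rightarrow> 'm::ab_group_add \<Rightarrow> 'm) \<Rightarrow> 'm set \<Rightarrow> bool" where
  "submod s Z \<longleftrightarrow> 0 \<in> Z \<and> (\<forall>x\<in>Z. \<forall>y\<in>Z. x + y \<in> Z) \<and> (\<forall>x\<in>Z. - x \<in> Z) \<and> (\<forall>r. \<forall>x\<in>Z. s r x \<in> Z)"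

lemma submodD:
  assumes "submod s Z"
  shows "0 \<in> Z" "x \<in> Z \<Longrightarrow> y \<in> Z \<Longrightarrow> x + y \<in> Z" "x \<in> Z \<Longrightarrow> - x \<in> Z" "x \<in> Z \<Longrightarrow> s r x \<in> Z"
    "x \<in> Z \<Longrightarrow> y \<in> Z \<Longrightarrow> x - y \<in> Z"
  using assms unfolding submod_def by (metis, metis, metis, metis, metis diff_conv_add_uminus)

locale quotient_data =
  fixes s :: "'r \<Rightarrow> 'm::ab_group_add \<Rightarrow> 'm" and Z B :: "'m set"
  assumes additive_s: "s r (x + y) = s r x + s r y"
    and subZ: "submod s Z" and subB: "submod s B"
begin

lemma coset_eq_iff: "coset x B = coset y B \<longleftrightarrow> x - y \<in> B"
proof
  assume "coset x B = coset y B"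
  moreover have "x \<in> coset x B"
    using submodD(1)[OF subB] by (force simp: coset_def)
  ultimately obtain b where "b \<in> B" "x = y + b"
    by (auto simp: coset_def)
  then show "x - y \<in> B" by simp
next
  assume xy: "x - y \<in> B"
  have "\<exists>b'\<in>B. x + b = y + b'" if "b \<in> B" for b
    using submodD(2)[OF subB xy that] by (intro bexI[of _ "(x - y) + b"]) auto
  moreover have "\<exists>b'\<in>B. y + b = x + b'" if "b \<in> B" for b
    using submodD(5)[OF subB that xy] by (intro bexI[of _ "b - (x - y)"]) auto
  ultimately show "coset x B = coset y B"
    unfolding coset_def by blast
qed

text \<open>\<open>quot_mod\<close> computes with representatives picked by \<open>SOME\<close>. Any
  representative differs from \<open>x\<close> by an element of \<open>B\<close>, which makes the
  operations independent of the choice.\<close>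

lemma some_coset: "(SOME c. c \<in> coset x B) - x \<in> B"
proof -
  have "x + 0 \<in> coset x B"
    unfolding coset_def using submodD(1)[OF subB] by (rule imageI)
  then have "(SOME c. c \<in> coset x B) \<in> coset x B"
    by (rule someI)
  then show ?thesis by (auto simp: coset_def)
qed

lemma quot_add: "madd (quot_mod s Z B) (coset x B) (coset y B) = coset (x + y) B"
  unfolding quot_mod_def amod.simps coset_eq_iff
  using submodD(2)[OF subB some_coset[of x] some_coset[of y]] by (simp add: algebra_simps)

lemma quot_smul: "msmul (quot_mod s Z B) r (coset x B) = coset (s r x) B"
proof -
  have "s r (SOME c. c \<in> coset x B) = s r x + s r ((SOME c. c \<in> coset x B) - x)"
    by (simp flip: additive_s)
  then show ?thesis
    unfolding quot_mod_def amod.simps coset_eq_iff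
    using submodD(4)[OF subB some_coset[of x], of r] by simp
qed

lemma quot_car: "mcar (quot_mod s Z B) = (\<lambda>z. coset z B) ` Z"
  by (simp add: quot_mod_def)

lemma quot_closed: "mod_closed (quot_mod s Z B)"
  unfolding mod_closed_def quot_car using submodD[OF subZ] by (auto simp: quot_add quot_smul)

lemma quot_trivial:
  assumes "Z \<subseteq> B"
  shows "mod_trivial (quot_mod s Z B)"
proof -
  have "coset z B = coset 0 B" if "z \<in> Z" for z
    using that assms by (auto simp: coset_eq_iff)
  moreover have "Z \<noteq> {}"
    using submodD(1)[OF subZ] by blast
  ultimately have "mcar (quot_mod s Z B) = {coset 0 B}"
    unfolding quot_car by (metis (no_types, lifting) image_constant_conv image_cong)
  then show ?thesis
    using quot_closed unfolding mod_trivial_def by blast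
qed

text \<open>The first isomorphism theorem with \<open>f\<close> given on \<open>Z\<close> only:
  \<open>f\<close> induces a map on cosets, and the second premise is both well-definedness and
  injectivity.\<close>

lemma quot_isoI:
  assumes "f ` Z = mcar N"
    and "\<And>x y. x \<in> Z \<Longrightarrow> y \<in> Z \<Longrightarrow> f x = f y \<longleftrightarrow> x - y \<in> B"
    and "\<And>x y. x \<in> Z \<Longrightarrow> y \<in> Z \<Longrightarrow> f (x + y) = madd N (f x) (f y)"
    and "\<And>r x. x \<in> Z \<Longrightarrow> f (s r x) = msmul N r (f x)"
  shows "mod_iso (quot_mod s Z B) N"
proof -
  define g where "g C = f (SOME z. z \<in> Z \<and> coset z B = C)" for C
  have g: "g (coset z B) = f z" if "z \<in> Z" for z
  proof -
    define z' where "z' = (SOME z'. z' \<in> Z \<and> coset z' B = coset z B)"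
    have "z' \<in> Z \<and> coset z' B = coset z B"
      unfolding z'_def using that by (intro someI) auto
    then show ?thesis
      unfolding g_def z'_def[symmetric] using assms(2) that coset_eq_iff by blast
  qed
  show ?thesis
  proof (rule mod_isoI[where f = g])
    show "bij_betw g (mcar (quot_mod s Z B)) (mcar N)"
      unfolding bij_betw_def quot_car assms(1)[symmetric]
      using g assms(2) by (auto simp: inj_on_def coset_eq_iff image_image)
  qed (auto simp: quot_car quot_add quot_smul g assms submodD[OF subZ])
qed

end

lemma quot_iso_quot:
  assumes Q: "quotient_data s Z B" and Q': "quotient_data s' Z' B'"
    and f: "\<And>x y. x \<in> Z \<Longrightarrow> y \<in> Z \<Longrightarrow> f (x + y) = f x + f y"
      "\<And>r x. x \<in> Z \<Longrightarrow> f (s r x) = s' r (f x)"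
      "\<And>x. x \<in> Z \<Longrightarrow> f x \<in> Z'"
    and inj: "\<And>x. x \<in> Z \<Longrightarrow> f x \<in> B' \<longleftrightarrow> x \<in> B"
    and surj: "\<And>y. y \<in> Z' \<Longrightarrow> \<exists>x\<in>Z. f x - y \<in> B'"
  shows "mod_iso (quot_mod s Z B) (quot_mod s' Z' B')"
proof -
  interpret quotient_data s Z B by fact
  interpret R: quotient_data s' Z' B' by fact
  have diff: "f (x - y) = f x - f y" if "x \<in> Z" "y \<in> Z" for x y
    using f(1)[of "x - y" y] that submodD(5)[OF subZ] by simp
  show ?thesis
  proof (rule quot_isoI[where f = "\<lambda>x. coset (f x) B'"])
    show "(\<lambda>x. coset (f x) B') ` Z = mcar (quot_mod s' Z' B')"
    proof
      show "(\<lambda>x. coset (f x) B') ` Z \<subseteq> mcar (quot_mod s' Z' B')"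
        using f(3) by (auto simp: R.quot_car)
      show "mcar (quot_mod s' Z' B') \<subseteq> (\<lambda>x. coset (f x) B') ` Z"
      proof
        fix C assume "C \<in> mcar (quot_mod s' Z' B')"
        then obtain y where "y \<in> Z'" "C = coset y B'"
          by (auto simp: R.quot_car)
        moreover from surj[OF this(1)] obtain x where "x \<in> Z" "f x - y \<in> B'" by blast
        ultimately show "C \<in> (\<lambda>x. coset (f x) B') ` Z"
          by (auto simp: R.coset_eq_iff[symmetric])
      qed
    qed
    show "coset (f x) B' = coset (f y) B' \<longleftrightarrow> x - y \<in> B" if "x \<in> Z" "y \<in> Z" for x y
      using inj[of "x - y"] that submodD(5)[OF subZ] by (simp add: R.coset_eq_iff diff)
  qed (auto simp: R.quot_add R.quot_smul f)
qed

text \<open>Injectivity and surjectivity are required of the three maps jointly. This fits the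
  splitting below, where a preimage is built for a whole triple and a class is killed only by all
  three conditions together.\<close>

lemma quot_iso_dsum3:
  assumes Q: "quotient_data s Z B" and Q1: "quotient_data s1 Z1 B1"
    and Q2: "quotient_data s2 Z2 B2" and Q3: "quotient_data s3 Z3 B3"
    and f1: "\<And>x y. x \<in> Z \<Longrightarrow> y \<in> Z \<Longrightarrow> f1 (x + y) = f1 x + f1 y"
      "\<And>r x. x \<in> Z \<Longrightarrow> f1 (s r x) = s1 r (f1 x)" "\<And>x. x \<in> Z \<Longrightarrow> f1 x \<in> Z1"
    and f2: "\<And>x y. x \<in> Z \<Longrightarrow> y \<in> Z \<Longrightarrow> f2 (x + y) = f2 x + f2 y"
      "\<And>r x. x \<in> Z \<Longrightarrow> f2 (s r x) = s2 r (f2 x)" "\<And>x. x \<in> Z \<Longrightarrow> f2 x \<in> Z2"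
    and f3: "\<And>x y. x \<in> Z \<Longrightarrow> y \<in> Z \<Longrightarrow> f3 (x + y) = f3 x + f3 y"
      "\<And>r x. x \<in> Z \<Longrightarrow> f3 (s r x) = s3 r (f3 x)" "\<And>x. x \<in> Z \<Longrightarrow> f3 x \<in> Z3"
    and bd: "\<And>x. x \<in> B \<Longrightarrow> f1 x \<in> B1 \<and> f2 x \<in> B2 \<and> f3 x \<in> B3"
    and inj: "\<And>x. x \<in> Z \<Longrightarrow> f1 x \<in> B1 \<Longrightarrow> f2 x \<in> B2 \<Longrightarrow> f3 x \<in> B3 \<Longrightarrow> x \<in> B"
    and surj: "\<And>y1 y2 y3. y1 \<in> Z1 \<Longrightarrow> y2 \<in> Z2 \<Longrightarrow> y3 \<in> Z3 \<Longrightarrow>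
       \<exists>x\<in>Z. f1 x - y1 \<in> B1 \<and> f2 x - y2 \<in> B2 \<and> f3 x - y3 \<in> B3"
  shows "mod_iso (quot_mod s Z B)
    (dsum (dsum (quot_mod s1 Z1 B1) (quot_mod s2 Z2 B2)) (quot_mod s3 Z3 B3))"
proof -
  interpret quotient_data s Z B by fact
  interpret R1: quotient_data s1 Z1 B1 by fact
  interpret R2: quotient_data s2 Z2 B2 by fact
  interpret R3: quotient_data s3 Z3 B3 by fact
  let ?f = "\<lambda>x. ((coset (f1 x) B1, coset (f2 x) B2), coset (f3 x) B3)"
  let ?N = "dsum (dsum (quot_mod s1 Z1 B1) (quot_mod s2 Z2 B2)) (quot_mod s3 Z3 B3)"
  have diff: "f1 (x - y) = f1 x - f1 y" "f2 (x - y) = f2 x - f2 y" "f3 (x - y) = f3 x - f3 y"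
    if "x \<in> Z" "y \<in> Z" for x y
    using f1(1)[of "x - y" y] f2(1)[of "x - y" y] f3(1)[of "x - y" y] that submodD(5)[OF subZ]
    by simp_all
  show ?thesis
  proof (rule quot_isoI[where f = ?f])
    show "?f ` Z = mcar ?N"
    proof
      show "?f ` Z \<subseteq> mcar ?N"
        using f1(3) f2(3) f3(3) by (auto simp: dsum_def R1.quot_car R2.quot_car R3.quot_car)
      show "mcar ?N \<subseteq> ?f ` Z"
      proof
        fix C assume "C \<in> mcar ?N"
        then obtain y1 y2 y3 where y: "y1 \<in> Z1" "y2 \<in> Z2" "y3 \<in> Z3"
          and C: "C = ((coset y1 B1, coset y2 B2), coset y3 B3)"
          by (auto simp: dsum_def R1.quot_car R2.quot_car R3.quot_car)
        from surj[OF y] obtain x where "x \<in> Z" "f1 x - y1 \<in> B1" "f2 x - y2 \<in> B2" "f3 x - y3 \<in> B3"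
          by blast
        then show "C \<in> ?f ` Z"
          by (intro image_eqI[of _ _ x])
            (auto simp: C R1.coset_eq_iff[symmetric] R2.coset_eq_iff[symmetric] R3.coset_eq_iff[symmetric])
      qed
    qed
    show "?f x = ?f y \<longleftrightarrow> x - y \<in> B" if "x \<in> Z" "y \<in> Z" for x y
      using inj[of "x - y"] bd[of "x - y"] that submodD(5)[OF subZ, of x y]
      by (auto simp: R1.coset_eq_iff R2.coset_eq_iff R3.coset_eq_iff diff)
  qed (auto simp: dsum_def R1.quot_add R1.quot_smul R2.quot_add R2.quot_smul R3.quot_add R3.quot_smul f1 f2 f3)
qed

section \<open>Singular chains with coefficients\<close>

text \<open>One of the two sums is always empty. The form as a difference of sums lets additive maps
  pass through by \<open>additive.sum\<close> and \<open>additive.diff\<close>.\<close>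

definition zmul :: "int \<Rightarrow> 'g::ab_group_add \<Rightarrow> 'g" where
  "zmul k g = (\<Sum>i<nat k. g) - (\<Sum>i<nat (- k). g)"

lemma zmul_0 [simp]: "zmul 0 g = 0" and zmul_1 [simp]: "zmul 1 g = g"
  and zmul_zero [simp]: "zmul k 0 = 0"
  by (simp_all add: zmul_def)

lemma zmul_minus: "zmul (- k) g = - zmul k g"
  by (simp add: zmul_def)

lemma zmul_add_right: "zmul k (g + h) = zmul k g + zmul k h"
  by (simp add: zmul_def sum.distrib)

lemma zmul_Suc: "zmul (k + 1) g = zmul k g + g"
proof (cases "k \<ge> 0")
  case True
  then have "nat (k + 1) = Suc (nat k)" "nat (- (k + 1)) = 0" "nat (- k) = 0"
    by auto
  then show ?thesis by (simp add: zmul_def)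
next
  case False
  then have "nat (- k) = Suc (nat (- (k + 1)))" "nat (k + 1) = 0" "nat k = 0"
    by auto
  then show ?thesis by (simp add: zmul_def)
qed

lemma zmul_add: "zmul (k + l) g = zmul k g + zmul l g"
proof (induction l rule: int_induct[where k = 0])
  case (step1 i)
  then show ?case
    using zmul_Suc[of "k + i" g] zmul_Suc[of i g] by (simp add: algebra_simps)
next
  case (step2 i)
  then show ?case
    using zmul_Suc[of "k + (i - 1)" g] zmul_Suc[of "i - 1" g] by (simp add: algebra_simps)
qed simp

lemma zmul_diff: "zmul (k - l) g = zmul k g - zmul l g"
  using zmul_add[of k "- l" g] by (simp add: zmul_minus)

lemma additive_zmul:
  assumes "additive f"
  shows "f (zmul k g) = zmul k (f g)"
  unfolding zmul_def additive.diff[OF assms] additive.sum[OF assms] ..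

text \<open>The elementary tensor \<open>a \<otimes> g\<close> of an integral chain with a coefficient, as a function.\<close>
definition gtensor :: "('t \<Rightarrow>\<^sub>0 int) \<Rightarrow> 'g::ab_group_add \<Rightarrow> 't \<Rightarrow> 'g" where
  "gtensor a g = (\<lambda>\<tau>. zmul (poly_mapping.lookup a \<tau>) g)"

definition fsupp :: "('s \<Rightarrow> 'g::zero) set" where
  "fsupp = {c. finite {\<sigma>. c \<sigma> \<noteq> 0}}"

text \<open>The counterpart of \<open>frag_extend\<close> for coefficients: on elementary tensors it
  acts as \<open>frag_extend f\<close> on the integral factor, see
  \<open>gext_gtensor\<close>.\<close>

definition gext :: "('s \<Rightarrow> 't \<Rightarrow>\<^sub>0 int) \<Rightarrow> ('s \<Rightarrow> 'g::ab_group_add) \<Rightarrow> 't \<Rightarrow> 'g" where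
  "gext f c = (\<Sum>\<sigma> | c \<sigma> \<noteq> 0. gtensor (f \<sigma>) (c \<sigma>))"

lemma gtensor_0 [simp]: "gtensor 0 g = 0" and gtensor_zero [simp]: "gtensor a 0 = 0"
  by (simp_all add: gtensor_def zero_fun_def)

lemma gtensor_diff: "gtensor (a - b) g = gtensor a g - gtensor b g"
  by (simp add: gtensor_def fun_eq_iff lookup_minus zmul_diff)

lemma gtensor_add: "gtensor (a + b) g = gtensor a g + gtensor b g"
  by (simp add: gtensor_def fun_eq_iff lookup_add zmul_add)

lemma gtensor_add_right: "gtensor a (g + h) = gtensor a g + gtensor a h"
  by (simp add: gtensor_def fun_eq_iff zmul_add_right)

lemma gtensor_frag_of: "gtensor (frag_of \<tau>) g = (\<lambda>\<rho>. if \<rho> = \<tau> then g else 0)"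
  by (auto simp: gtensor_def)

lemma fsupp_0 [simp]: "0 \<in> fsupp"
  by (simp add: fsupp_def)

lemma fsupp_add: "c \<in> fsupp \<Longrightarrow> d \<in> fsupp \<Longrightarrow> c + d \<in> fsupp" for c d :: "'s \<Rightarrow> 'g::ab_group_add"
proof -
  assume "c \<in> fsupp" "d \<in> fsupp"
  then have "finite ({\<sigma>. c \<sigma> \<noteq> 0} \<union> {\<sigma>. d \<sigma> \<noteq> 0})"
    by (simp add: fsupp_def)
  moreover have "{\<sigma>. (c + d) \<sigma> \<noteq> 0} \<subseteq> {\<sigma>. c \<sigma> \<noteq> 0} \<union> {\<sigma>. d \<sigma> \<noteq> 0}"
    by auto
  ultimately show "c + d \<in> fsupp"
    unfolding fsupp_def using finite_subset by blast
qed

lemma fsupp_minus: "c \<in> fsupp \<Longrightarrow> - c \<in> fsupp" for c :: "'s \<Rightarrow> 'g::ab_group_add"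
  by (simp add: fsupp_def)

lemma fsupp_diff: "c \<in> fsupp \<Longrightarrow> d \<in> fsupp \<Longrightarrow> c - d \<in> fsupp" for c d :: "'s \<Rightarrow> 'g::ab_group_add"
  using fsupp_add[of c "- d"] fsupp_minus[of d] by simp

lemma fsupp_sum: "(\<And>i. i \<in> I \<Longrightarrow> f i \<in> fsupp) \<Longrightarrow> sum f I \<in> fsupp" for f :: "'i \<Rightarrow> 's \<Rightarrow> 'g::ab_group_add"
  by (induction I rule: infinite_finite_induct) (auto intro: fsupp_add)

lemma fsupp_gtensor: "gtensor a g \<in> fsupp"
proof -
  have "{\<tau>. gtensor a g \<tau> \<noteq> 0} \<subseteq> Poly_Mapping.keys a"
    by (auto simp: gtensor_def in_keys_iff)
  then show ?thesis
    unfolding fsupp_def by (simp add: finite_subset[OF _ finite_keys])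
qed

lemma fsupp_gext: "gext f c \<in> fsupp"
  unfolding gext_def by (intro fsupp_sum fsupp_gtensor)

lemma gext_superset:
  assumes "finite S" "{\<sigma>. c \<sigma> \<noteq> 0} \<subseteq> S"
  shows "gext f c = (\<Sum>\<sigma>\<in>S. gtensor (f \<sigma>) (c \<sigma>))"
  unfolding gext_def by (rule sum.mono_neutral_left) (use assms in auto)

lemma gext_0 [simp]: "gext f 0 = 0"
  by (simp add: gext_def)

lemma gext_add:
  assumes "c \<in> fsupp" "d \<in> fsupp"
  shows "gext f (c + d) = gext f c + gext f d"
proof -
  let ?S = "{\<sigma>. c \<sigma> \<noteq> 0} \<union> {\<sigma>. d \<sigma> \<noteq> 0}"
  have S: "finite ?S" "{\<sigma>. (c + d) \<sigma> \<noteq> 0} \<subseteq> ?S" "{\<sigma>. c \<sigma> \<noteq> 0} \<subseteq> ?S" "{\<sigma>. d \<sigma> \<noteq> 0} \<subseteq> ?S"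
    using assms by (auto simp: fsupp_def)
  show ?thesis
    unfolding gext_superset[OF S(1,2)] gext_superset[OF S(1,3)] gext_superset[OF S(1,4)]
    by (simp add: gtensor_add_right sum.distrib)
qed

lemma gext_minus:
  assumes "c \<in> fsupp"
  shows "gext f (- c) = - gext f c"
  using gext_add[OF assms fsupp_minus[OF assms], of f] by (simp add: eq_neg_iff_add_eq_0 add.commute)

lemma gext_diff:
  assumes "c \<in> fsupp" "d \<in> fsupp"
  shows "gext f (c - d) = gext f c - gext f d"
  using gext_add[OF assms(1) fsupp_minus[OF assms(2)], of f] by (simp add: gext_minus assms)

lemma gext_sum:
  assumes "\<And>i. i \<in> I \<Longrightarrow> c i \<in> fsupp"
  shows "gext f (sum c I) = (\<Sum>i\<in>I. gext f (c i))"
  using assms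
  by (induction I rule: infinite_finite_induct) (auto simp: gext_add fsupp_sum)

lemma gext_single: "gext f (gtensor (frag_of \<sigma>) g) = gtensor (f \<sigma>) g"
proof -
  have "gext f (gtensor (frag_of \<sigma>) g) = (\<Sum>\<rho>\<in>{\<sigma>}. gtensor (f \<rho>) (gtensor (frag_of \<sigma>) g \<rho>))"
    by (rule gext_superset) (auto simp: gtensor_frag_of)
  then show ?thesis by (simp add: gtensor_frag_of)
qed

lemma gext_gtensor: "gext f (gtensor a g) = gtensor (frag_extend f a) g"
  using subset_UNIV
proof (induction a rule: frag_induction)
  case zero
  show ?case
    by (simp only: gtensor_0 gext_0 frag_extend_0)
next
  case (diff a b)
  then show ?case
    by (simp only: gtensor_diff gext_diff fsupp_gtensor frag_extend_diff)
qed (simp_all add: gext_single)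

lemma gext_gext: "gext f (gext h c) = gext (\<lambda>\<sigma>. frag_extend f (h \<sigma>)) c"
  unfolding gext_def[of h] gext_def[of "\<lambda>\<sigma>. frag_extend f (h \<sigma>)"]
  by (simp add: gext_sum fsupp_gtensor gext_gtensor)

lemma gext_cong: "(\<And>\<sigma>. c \<sigma> \<noteq> 0 \<Longrightarrow> f \<sigma> = h \<sigma>) \<Longrightarrow> gext f c = gext h c"
  unfolding gext_def by (rule sum.cong) auto

lemma gext_fun_add: "gext (\<lambda>\<sigma>. f \<sigma> + h \<sigma>) c = gext f c + gext h c"
  by (simp add: gext_def gtensor_add sum.distrib)

lemma gext_fun_diff: "gext (\<lambda>\<sigma>. f \<sigma> - h \<sigma>) c = gext f c - gext h c"
  by (simp add: gext_def gtensor_diff sum_subtractf)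

lemma sum_fun_apply: "(\<Sum>i\<in>I. f i) x = (\<Sum>i\<in>I. f i x)"
  for f :: "'i \<Rightarrow> 's \<Rightarrow> 'g::ab_group_add"
  by (induction I rule: infinite_finite_induct) auto

lemma gext_apply: "gext f c \<tau> = (\<Sum>\<sigma> | c \<sigma> \<noteq> 0. zmul (poly_mapping.lookup (f \<sigma>) \<tau>) (c \<sigma>))"
  by (simp add: gext_def sum_fun_apply gtensor_def)

lemma gext_frag_of:
  assumes "c \<in> fsupp"
  shows "gext frag_of c = c"
proof
  fix \<tau>
  have "gext frag_of c \<tau> = (\<Sum>\<sigma> | c \<sigma> \<noteq> 0. if \<sigma> = \<tau> then c \<sigma> else 0)"
    unfolding gext_apply by (rule sum.cong) auto
  then show "gext frag_of c \<tau> = c \<tau>"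
    using assms by (simp add: fsupp_def sum.delta)
qed

text \<open>A constant map on generators sees only the sum of the coefficients. Both the
  augmentation and the chain map of a constant map arise in this way.\<close>

lemma gext_const: "gext (\<lambda>_. a) c = gtensor a (\<Sum>\<sigma> | c \<sigma> \<noteq> 0. c \<sigma>)"
proof -
  have "additive (gtensor a)"
    by (simp add: additive_def gtensor_add_right)
  from additive.sum[OF this, of c "{\<sigma>. c \<sigma> \<noteq> 0}"] show ?thesis
    by (simp only: gext_def)
qed

text \<open>Scaling may kill coefficients, so both sums are compared over the support of
  \<open>c\<close>. With \<open>sc r\<close> for \<open>s\<close> this makes every extended operator
  commute with scalars.\<close>

lemma gext_scale:
  assumes s: "additive s" and c: "c \<in> fsupp"
  shows "gext f (\<lambda>\<sigma>. s (c \<sigma>)) = (\<lambda>\<tau>. s (gext f c \<tau>))"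
proof
  fix \<tau>
  have "s 0 = 0"
    by (rule additive.zero[OF s])
  then have "{\<sigma>. s (c \<sigma>) \<noteq> 0} \<subseteq> {\<sigma>. c \<sigma> \<noteq> 0}" by auto
  then have "gext f (\<lambda>\<sigma>. s (c \<sigma>)) \<tau> = (\<Sum>\<sigma> | c \<sigma> \<noteq> 0. zmul (poly_mapping.lookup (f \<sigma>) \<tau>) (s (c \<sigma>)))"
    using c by (subst gext_superset[of "{\<sigma>. c \<sigma> \<noteq> 0}"])
      (auto simp: fsupp_def sum_fun_apply gtensor_def)
  also have "\<dots> = s (gext f c \<tau>)"
    by (simp add: gext_apply additive.sum[OF s] additive_zmul[OF s])
  finally show "gext f (\<lambda>\<sigma>. s (c \<sigma>)) \<tau> = s (gext f c \<tau>)" .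
qed

text \<open>For additive \<open>T\<close> this is \<open>T\<close> tensored with the identity of the
  coefficient group; only the values of \<open>T\<close> on generators enter.\<close>

definition glift :: "(('s \<Rightarrow>\<^sub>0 int) \<Rightarrow> 't \<Rightarrow>\<^sub>0 int) \<Rightarrow> ('s \<Rightarrow> 'g::ab_group_add) \<Rightarrow> 't \<Rightarrow> 'g" where
  "glift T = gext (\<lambda>\<sigma>. T (frag_of \<sigma>))"

lemma additive_frag_extend:
  assumes "additive T"
  shows "frag_extend (\<lambda>\<sigma>. T (frag_of \<sigma>)) a = T a"
  using subset_UNIV
  by (induction a rule: frag_induction)
    (simp_all add: additive.zero[OF assms] additive.diff[OF assms] frag_extend_diff)

text \<open>Additivity of the outer operator determines its value on the chain
  \<open>U (frag_of \<sigma>)\<close> from its values on generators. Together with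
  \<open>glift_add\<close>, \<open>glift_diff\<close> and \<open>glift_cong\<close> this transfers
  identities between integral operators to arbitrary coefficients.\<close>

lemma glift_glift: "additive T \<Longrightarrow> glift T (glift U c) = glift (\<lambda>a. T (U a)) c"
  by (simp add: glift_def gext_gext additive_frag_extend)

lemma glift_add: "glift (\<lambda>a. T a + U a) c = glift T c + glift U c"
  by (simp add: glift_def gext_fun_add)

lemma glift_diff: "glift (\<lambda>a. T a - U a) c = glift T c - glift U c"
  by (simp add: glift_def gext_fun_diff)

section \<open>Groups of singular chains\<close>

lemma gchains_fsupp: "c \<in> gchains n X \<Longrightarrow> c \<in> fsupp"
  by (simp add: gchains_def fsupp_def)

lemma gchains_0 [simp]: "0 \<in> gchains n X"
  by (simp add: gchains_def)

lemma gchains_add: "c \<in> gchains n X \<Longrightarrow> d \<in> gchains n X \<Longrightarrow> c + d \<in> gchains n X"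
  for c d :: "('a, 'g::ab_group_add) gchain"
  using fsupp_add[of c d] unfolding gchains_def fsupp_def by (auto, metis add_0)

lemma gchains_minus: "c \<in> gchains n X \<Longrightarrow> - c \<in> gchains n X"
  for c :: "('a, 'g::ab_group_add) gchain"
  by (simp add: gchains_def)

lemma gchains_minus_iff [simp]: "- c \<in> gchains n X \<longleftrightarrow> c \<in> gchains n X"
  for c :: "('a, 'g::ab_group_add) gchain"
  by (simp add: gchains_def)

lemma gchains_diff: "c \<in> gchains n X \<Longrightarrow> d \<in> gchains n X \<Longrightarrow> c - d \<in> gchains n X"
  for c d :: "('a, 'g::ab_group_add) gchain"
  using gchains_add[of c n X "- d"] by simp

lemma gchains_sum: "(\<And>i. i \<in> I \<Longrightarrow> f i \<in> gchains n X) \<Longrightarrow> sum f I \<in> gchains n X"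
  for f :: "'i \<Rightarrow> ('a, 'g::ab_group_add) gchain"
  by (induction I rule: infinite_finite_induct) (auto intro: gchains_add)

lemma gchains_subtopology_iff:
  "c \<in> gchains n (subtopology X S) \<longleftrightarrow>
     c \<in> gchains n X \<and> (\<forall>\<sigma>. c \<sigma> \<noteq> 0 \<longrightarrow> \<sigma> ` standard_simplex n \<subseteq> S)"
  by (auto simp: gchains_def singular_simplex_subtopology)

lemma gchains_subtopology_Int:
  "c \<in> gchains n (subtopology X S) \<Longrightarrow> c \<in> gchains n (subtopology X T) \<Longrightarrow>
   c \<in> gchains n (subtopology X (S \<inter> T))"
  by (auto simp: gchains_subtopology_iff)

lemma gchains_subtopology_mono:
  "c \<in> gchains n (subtopology X S) \<Longrightarrow> S \<subseteq> T \<Longrightarrow> c \<in> gchains n (subtopology X T)"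
  unfolding gchains_subtopology_iff by blast

lemma gchains_gtensor: "singular_chain n X a \<Longrightarrow> gtensor a g \<in> gchains n X"
  using fsupp_gtensor[of a g]
  by (auto simp: gchains_def fsupp_def gtensor_def singular_chain_def in_keys_iff subset_iff)
     (metis zmul_0)

lemma gchains_scale:
  assumes "additive s" "c \<in> gchains n X"
  shows "(\<lambda>\<sigma>. s (c \<sigma>)) \<in> gchains n X"
proof -
  have "{\<sigma>. s (c \<sigma>) \<noteq> 0} \<subseteq> {\<sigma>. c \<sigma> \<noteq> 0}"
    by (auto simp: additive.zero[OF assms(1)])
  then show ?thesis
    using assms(2) unfolding gchains_def by (auto intro: finite_subset)
qed

lemma glift_gchains:
  assumes "\<And>a. singular_chain n X a \<Longrightarrow> singular_chain m Y (T a)" "c \<in> gchains n X"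
  shows "glift T c \<in> gchains m Y"
  unfolding glift_def gext_def using assms
  by (intro gchains_sum gchains_gtensor) (auto simp: gchains_def singular_chain_of)

text \<open>The simplices occurring in \<open>c\<close> are singular simplices of \<open>X\<close>,
  so an operator identity valid for integral chains of \<open>X\<close> is enough.\<close>

lemma glift_cong:
  assumes "\<And>a. singular_chain n X a \<Longrightarrow> T a = U a" "c \<in> gchains n X"
  shows "glift T c = glift U c"
  unfolding glift_def using assms
  by (intro gext_cong) (auto simp: gchains_def singular_chain_of)

lemma glift_ident: "c \<in> gchains n X \<Longrightarrow> glift (\<lambda>a. a) c = c"
  by (simp add: glift_def gext_frag_of gchains_fsupp)

lemma zmul_minus_one_power: "zmul ((- 1) ^ k) g = (if even k then g else - g)"
  using zmul_minus[of 1 g] by (cases "even k") auto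

text \<open>The bridge from the explicit boundary to the extension of \<open>chain_boundary\<close>:
  both are the same double sum over a simplex and a face index, once the terms whose face is not
  \<open>\<tau>\<close> are dropped.\<close>

lemma gbd_eq_glift:
  assumes "c \<in> fsupp"
  shows "gbd n c = glift (chain_boundary n) c"
proof (cases "n = 0")
  case True
  then show ?thesis
    by (simp add: gbd_def glift_def chain_boundary_def gext_def)
next
  case False
  have fin: "finite {\<sigma>. c \<sigma> \<noteq> 0}"
    using assms by (simp add: fsupp_def)
  show ?thesis
  proof
    fix \<tau>
    have "glift (chain_boundary n) c \<tau> =
        (\<Sum>\<sigma> | c \<sigma> \<noteq> 0. \<Sum>k\<le>n. if singular_face n k \<sigma> = \<tau> then (if even k then c \<sigma> else - c \<sigma>) else 0)"
      unfolding glift_def gext_def sum_fun_apply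
    proof (rule sum.cong[OF refl])
      fix \<sigma>
      have add: "additive (\<lambda>a. gtensor a (c \<sigma>) \<tau>)"
        by (simp add: additive_def gtensor_add)
      have eq: "chain_boundary n (frag_of \<sigma>) = (\<Sum>k\<le>n. frag_cmul ((- 1) ^ k) (frag_of (singular_face n k \<sigma>)))"
        using False by (simp add: chain_boundary_of)
      have "gtensor (chain_boundary n (frag_of \<sigma>)) (c \<sigma>) \<tau> =
          (\<Sum>k\<le>n. gtensor (frag_cmul ((- 1) ^ k) (frag_of (singular_face n k \<sigma>))) (c \<sigma>) \<tau>)"
        unfolding eq by (rule additive.sum[OF add])
      also have "\<dots> = (\<Sum>k\<le>n. if singular_face n k \<sigma> = \<tau> then (if even k then c \<sigma> else - c \<sigma>) else 0)"
        by (rule sum.cong) (auto simp: gtensor_def zmul_minus_one_power zmul_minus)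
      finally show "gtensor (chain_boundary n (frag_of \<sigma>)) (c \<sigma>) \<tau> = \<dots>" .
    qed
    also have "\<dots> = (\<Sum>(\<sigma>, k)\<in>{\<sigma>. c \<sigma> \<noteq> 0} \<times> {..n}.
        if singular_face n k \<sigma> = \<tau> then (if even k then c \<sigma> else - c \<sigma>) else 0)"
      by (rule sum.cartesian_product)
    also have "\<dots> = (\<Sum>(\<sigma>, k)\<in>{(\<sigma>, k). c \<sigma> \<noteq> 0 \<and> k \<le> n \<and> singular_face n k \<sigma> = \<tau>}.
        if even k then c \<sigma> else - c \<sigma>)"
      by (rule sum.mono_neutral_cong_right) (use fin in \<open>auto split: if_splits\<close>)
    finally show "gbd n c \<tau> = glift (chain_boundary n) c \<tau>"
      using False by (simp add: gbd_def)
  qed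
qed

lemma additive_chain_boundary: "additive (chain_boundary n)"
  by (simp add: additive_def chain_boundary_add)

lemma additive_chain_map: "additive (chain_map n f)"
  by (simp add: additive_def chain_map_add)

lemma gbd_0 [simp]: "gbd 0 c = 0" and gbd_zero [simp]: "gbd n 0 = 0"
  by (simp_all add: gbd_def zero_fun_def)

lemma gbd_gchains: "c \<in> gchains n X \<Longrightarrow> gbd n c \<in> gchains (n - 1) X"
  by (simp add: gbd_eq_glift gchains_fsupp) (rule glift_gchains, auto intro: singular_chain_boundary)

lemma gbd_gchains_Suc: "c \<in> gchains (Suc n) X \<Longrightarrow> gbd (Suc n) c \<in> gchains n X"
  using gbd_gchains[of c "Suc n" X] by simp

lemma gbd_gbd:
  assumes "c \<in> gchains (Suc n) X"
  shows "gbd n (gbd (Suc n) c) = 0"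
proof -
  have "gbd n (gbd (Suc n) c) = glift (\<lambda>a. chain_boundary n (chain_boundary (Suc n) a)) c"
    using assms gbd_gchains_Suc[OF assms]
    by (simp add: gbd_eq_glift gchains_fsupp glift_glift additive_chain_boundary)
  also have "\<dots> = glift (\<lambda>a. 0) c"
    using assms chain_boundary_boundary[of "Suc n"] by (intro glift_cong) auto
  finally show ?thesis
    by (simp add: glift_def gext_def)
qed

lemma gbd_add: "c \<in> fsupp \<Longrightarrow> d \<in> fsupp \<Longrightarrow> gbd n (c + d) = gbd n c + gbd n d"
  by (simp add: gbd_eq_glift fsupp_add glift_def gext_add)

lemma gbd_minus: "c \<in> fsupp \<Longrightarrow> gbd n (- c) = - gbd n c"
  by (simp add: gbd_eq_glift fsupp_minus glift_def gext_minus)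

lemma gbd_diff: "c \<in> fsupp \<Longrightarrow> d \<in> fsupp \<Longrightarrow> gbd n (c - d) = gbd n c - gbd n d"
  by (simp add: gbd_eq_glift fsupp_diff glift_def gext_diff)

lemma fsupp_gbd: "c \<in> fsupp \<Longrightarrow> gbd n c \<in> fsupp"
  by (simp add: gbd_eq_glift glift_def fsupp_gext)

lemma gscale_add: "additive (sc r) \<Longrightarrow> gscale sc r (c + d) = gscale sc r c + gscale sc r d"
  by (simp add: gscale_def fun_eq_iff additive.add)

lemma gscale_glift: "additive (sc r) \<Longrightarrow> c \<in> fsupp \<Longrightarrow> glift T (gscale sc r c) = gscale sc r (glift T c)"
  by (simp add: gscale_def glift_def gext_scale)

lemma gscale_gchains: "additive (sc r) \<Longrightarrow> c \<in> gchains n X \<Longrightarrow> gscale sc r c \<in> gchains n X"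
  unfolding gscale_def by (rule gchains_scale)

lemma gscale_gbd: "additive (sc r) \<Longrightarrow> c \<in> gchains m X \<Longrightarrow> gbd n (gscale sc r c) = gscale sc r (gbd n c)"
  using gscale_gchains[of sc r c m X] by (simp add: gbd_eq_glift gscale_glift gchains_fsupp)

definition gmap :: "nat \<Rightarrow> ('a \<Rightarrow> 'b) \<Rightarrow> ('a, 'g::ab_group_add) gchain \<Rightarrow> ('b, 'g) gchain" where
  "gmap n f = glift (chain_map n f)"

lemma fsupp_glift: "glift T c \<in> fsupp"
  by (simp add: glift_def fsupp_gext)

lemma glift_arg_add: "c \<in> fsupp \<Longrightarrow> d \<in> fsupp \<Longrightarrow> glift T (c + d) = glift T c + glift T d"
  by (simp add: glift_def gext_add)

lemma glift_arg_diff: "c \<in> fsupp \<Longrightarrow> d \<in> fsupp \<Longrightarrow> glift T (c - d) = glift T c - glift T d"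
  by (simp add: glift_def gext_diff)

lemma glift_arg_minus: "c \<in> fsupp \<Longrightarrow> glift T (- c) = - glift T c"
  by (simp add: glift_def gext_minus)

lemma glift_0 [simp]: "glift T 0 = 0"
  by (simp add: glift_def)

lemma gmap_gchains: "continuous_map X Y f \<Longrightarrow> c \<in> gchains n X \<Longrightarrow> gmap n f c \<in> gchains n Y"
  unfolding gmap_def by (rule glift_gchains) (auto intro: singular_chain_chain_map)

lemma gmap_gmap: "gmap n f (gmap n g c) = gmap n (\<lambda>x. f (g x)) c"
  unfolding gmap_def glift_glift[OF additive_chain_map]
  using chain_map_compose[of n f g] by (simp add: comp_def)

lemma gmap_cong: "c \<in> gchains n X \<Longrightarrow> (\<And>x. x \<in> topspace X \<Longrightarrow> f x = g x) \<Longrightarrow> gmap n f c = gmap n g c"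
  unfolding gmap_def by (rule glift_cong) (auto intro: chain_map_eq)

lemma gmap_ident: "c \<in> gchains n X \<Longrightarrow> (\<And>x. x \<in> topspace X \<Longrightarrow> f x = x) \<Longrightarrow> gmap n f c = c"
  using gmap_cong[of c n X f "\<lambda>x. x"] glift_cong[of n X "chain_map n (\<lambda>x. x)" "\<lambda>a. a" c]
  by (simp add: gmap_def glift_ident chain_map_id_gen)

lemma gbd_gmap: "c \<in> gchains n X \<Longrightarrow> gbd n (gmap n f c) = gmap (n - 1) f (gbd n c)"
  by (simp add: gmap_def gbd_eq_glift fsupp_glift gchains_fsupp glift_glift additive_chain_map
      additive_chain_boundary)
    (rule glift_cong, auto intro: chain_boundary_chain_map)

section \<open>Prism operators and subdivision\<close>

definition simplex_cyl :: "nat \<Rightarrow> ((nat \<Rightarrow> real) \<times> real) topology" where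
  "simplex_cyl n = prod_topology (subtopology (powertop_real UNIV) (standard_simplex n)) (top_of_set {0..1})"

lemma topspace_simplex_cyl: "topspace (simplex_cyl n) = standard_simplex n \<times> {0..1}"
  by (simp add: simplex_cyl_def)

lemma contractible_standard_simplex:
  "contractible_space (subtopology (powertop_real UNIV) (standard_simplex n))" (is "contractible_space ?D")
proof -
  obtain v where v: "v \<in> standard_simplex n"
    using nonempty_standard_simplex by blast
  let ?h = "\<lambda>(t, x) i. (1 - t) * x i + t * v i :: real"
  have "continuous_map (prod_topology (top_of_set {0..1}) ?D) (powertop_real UNIV) ?h"
    unfolding continuous_map_componentwise_UNIV
  proof
    fix i
    have [continuous_intros]: "continuous_map (prod_topology (top_of_set {0..1}) ?D) euclideanreal (\<lambda>p. snd p i)"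
      using continuous_map_compose[OF continuous_map_snd
          continuous_map_from_subtopology[OF continuous_map_product_projection[of i UNIV "\<lambda>_. euclideanreal"]]]
      by (simp add: comp_def)
    have [continuous_intros]: "continuous_map (prod_topology (top_of_set {0..1}) ?D) euclideanreal fst"
      by (rule continuous_map_into_fulltopology[OF continuous_map_fst])
    have "continuous_map (prod_topology (top_of_set {0..1}) ?D) euclideanreal
        (\<lambda>p. (1 - fst p) * snd p i + fst p * v i)"
      by (intro continuous_intros)
    then show "continuous_map (prod_topology (top_of_set {0..1}) ?D) euclideanreal (\<lambda>p. ?h p i)"
      by (simp add: case_prod_beta')
  qed
  moreover have "?h (t, x) \<in> standard_simplex n" if "t \<in> {0..1}" "x \<in> standard_simplex n" for t x
    using convex_standard_simplex[of x n v t] v that by (simp add: algebra_simps)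
  ultimately have "continuous_map (prod_topology (top_of_set {0..1}) ?D) ?D ?h"
    unfolding continuous_map_in_subtopology by auto
  then show ?thesis
    unfolding contractible_space_def homotopic_with_def
    by (intro exI[of _ v] exI[of _ ?h]) auto
qed

lemma contractible_simplex_cyl: "contractible_space (simplex_cyl n)"
  unfolding simplex_cyl_def contractible_space_prod_topology
  using contractible_standard_simplex convex_imp_contractible[of "{0..1::real}"] by simp

lemma contractible_homologous_const:
  assumes "contractible_space X" "singular_relcycle n X {} z"
  obtains a where "a \<in> topspace X \<or> topspace X = {}" "homologous_rel n X {} z (chain_map n (\<lambda>_. a) z)"
proof -
  obtain a where a: "homotopic_with (\<lambda>_. True) X X id (\<lambda>_. a)"
    using assms(1) unfolding contractible_space_def by blast
  then have "homologous_rel n X {} (chain_map n id z) (chain_map n (\<lambda>_. a) z)"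
    using assms(2) by (intro homotopic_imp_homologous_rel_chain_maps[where T = "{}"]) simp_all
  moreover have "chain_map n id z = z"
    using assms(2) by (auto simp: singular_cycle intro: chain_map_ident)
  moreover have "a \<in> topspace X \<or> topspace X = {}"
    using homotopic_with_imp_continuous_maps[OF a] by (auto simp: continuous_map_def)
  ultimately show thesis
    using that by simp
qed

text \<open>A cycle is homologous to its image under a constant map, which lies in a one-point
  space, and there cycles of positive degree bound. Degree 0 is excluded because a point is a cycle
  that does not bound.\<close>

lemma contractible_cycle_boundary:
  assumes X: "contractible_space X" and n: "1 \<le> n" and z: "singular_chain n X z" "chain_boundary n z = 0"
  shows "\<exists>d. singular_chain (Suc n) X d \<and> chain_boundary (Suc n) d = z"
proof (cases "topspace X = {}")
  case True
  then show ?thesis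
    using z by (auto simp: singular_chain_empty)
next
  case False
  obtain a where a: "a \<in> topspace X" "homologous_rel n X {} z (chain_map n (\<lambda>_. a) z)"
    using contractible_homologous_const[OF X] z False by (metis singular_cycle)
  let ?A = "subtopology X {a}"
  have "continuous_map X ?A (\<lambda>_. a)"
    using a(1) by (simp add: continuous_map_in_subtopology)
  then have "singular_chain n ?A (chain_map n (\<lambda>_. a) z)"
    using z(1) singular_chain_chain_map by blast
  moreover have "chain_boundary n (chain_map n (\<lambda>_. a) z) = 0"
    using z by (simp add: chain_boundary_chain_map)
  ultimately have "singular_relboundary n ?A {} (chain_map n (\<lambda>_. a) z)"
    using singular_boundary_eq_cycle_singleton[of ?A a n] n a(1) by (simp add: singular_cycle)
  then have "singular_relboundary n X {} (chain_map n (\<lambda>_. a) z)"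
    unfolding singular_boundary using singular_chain_subtopology by blast
  then have "singular_relboundary n X {} (z - chain_map n (\<lambda>_. a) z + chain_map n (\<lambda>_. a) z)"
    using a(2) unfolding homologous_rel_def by (rule singular_relboundary_add[rotated])
  then show ?thesis
    by (simp add: singular_boundary)
qed

text \<open>Prism operators are built by acyclic models: a chain on the cylinder over each standard simplex
  determines a natural operator on singular chains.\<close>
definition cyl_op :: "((nat \<Rightarrow> real) \<times> real) chain \<Rightarrow> nat \<Rightarrow> ('a \<times> real \<Rightarrow> 'b) \<Rightarrow> 'a chain \<Rightarrow> 'b chain" where
  "cyl_op d n H = frag_extend (\<lambda>\<sigma>. chain_map (Suc n) (\<lambda>(x, t). H (\<sigma> x, t)) d)"

abbreviation simplex_id :: "nat \<Rightarrow> (nat \<Rightarrow> real) chain" where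
  "simplex_id n \<equiv> frag_of (restrict id (standard_simplex n))"

text \<open>The boundary of the solid prism \<open>\<Delta>\<times>[0,1]\<close>: top minus bottom
  minus the walls, where the walls are prisms over the faces made from the model \<open>e\<close>
  one dimension lower.\<close>

definition cyl_spec :: "nat \<Rightarrow> ((nat \<Rightarrow> real) \<times> real) chain \<Rightarrow> ((nat \<Rightarrow> real) \<times> real) chain \<Rightarrow> bool" where
  "cyl_spec n e d \<longleftrightarrow> singular_chain (Suc n) (simplex_cyl n) d \<and>
     chain_boundary (Suc n) d = chain_map n (\<lambda>x. (x, 1)) (simplex_id n) - chain_map n (\<lambda>x. (x, 0)) (simplex_id n)
       - cyl_op e (n - 1) id (chain_boundary n (simplex_id n))"

primrec cyl_chain :: "nat \<Rightarrow> ((nat \<Rightarrow> real) \<times> real) chain" where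
  "cyl_chain 0 = (SOME d. cyl_spec 0 0 d)"
| "cyl_chain (Suc n) = (SOME d. cyl_spec (Suc n) (cyl_chain n) d)"

lemma cyl_op_0 [simp]: "cyl_op d n H 0 = 0"
  by (simp add: cyl_op_def)

lemma cyl_op_diff: "cyl_op d n H (a - b) = cyl_op d n H a - cyl_op d n H b"
  by (simp add: cyl_op_def frag_extend_diff)

lemma additive_cyl_op: "additive (cyl_op d n H)"
  by (simp add: additive_def cyl_op_def frag_extend_add)

lemma singular_chain_cyl_op:
  assumes d: "singular_chain (Suc n) (simplex_cyl n) d"
    and H: "continuous_map (prod_topology X (top_of_set {0..1})) Y H"
    and c: "singular_chain n X c"
  shows "singular_chain (Suc n) Y (cyl_op d n H c)"
  unfolding cyl_op_def
proof (rule singular_chain_extend)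
  fix \<sigma> assume "\<sigma> \<in> Poly_Mapping.keys c"
  then have "singular_simplex n X \<sigma>"
    using c by (auto simp: singular_chain_def)
  then have "continuous_map (simplex_cyl n) (prod_topology X (top_of_set {0..1})) (\<lambda>p. (\<sigma> (fst p), snd p))"
    unfolding simplex_cyl_def singular_simplex_def continuous_map_pairwise
    by (auto simp: comp_def intro: continuous_map_fst continuous_map_snd
        continuous_map_compose[OF continuous_map_fst, unfolded comp_def])
  from continuous_map_compose[OF this H]
  have "continuous_map (simplex_cyl n) Y (\<lambda>(x, t). H (\<sigma> x, t))"
    by (simp add: comp_def case_prod_beta')
  then show "singular_chain (Suc n) Y (chain_map (Suc n) (\<lambda>(x, t). H (\<sigma> x, t)) d)"
    using d singular_chain_chain_map by blast
qed

text \<open>Naturality: the prism over a simplex is defined by pushing the model forward, so pushing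
  it further along \<open>\<sigma>\<close> only changes the simplex over which it is taken.\<close>

lemma chain_map_cyl_op:
  assumes e: "singular_chain (Suc m) (simplex_cyl m) e"
  shows "chain_map (Suc m) (\<lambda>(x, t). H (\<sigma> x, t)) (cyl_op e m id a) = cyl_op e m H (chain_map m \<sigma> a)"
  using subset_UNIV
proof (induction a rule: frag_induction)
  case (one \<tau>)
  have "chain_map (Suc m) (\<lambda>(x, t). H (\<sigma> x, t)) (cyl_op e m id (frag_of \<tau>)) =
      chain_map (Suc m) ((\<lambda>(x, t). H (\<sigma> x, t)) \<circ> (\<lambda>(x, t). (\<tau> x, t))) e"
    by (simp add: cyl_op_def chain_map_compose)
  also have "\<dots> = chain_map (Suc m) (\<lambda>(x, t). H (simplex_map m \<sigma> \<tau> x, t)) e"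
    by (rule chain_map_eq[OF e]) (auto simp: topspace_simplex_cyl simplex_map_def)
  finally show ?case
    by (simp add: cyl_op_def)
qed (simp_all add: cyl_op_diff chain_map_diff)

text \<open>Every simplex is the image of the identity simplex, so the boundary formula prescribed
  for the model chain carries over to all chains by naturality.\<close>

lemma chain_boundary_cyl_op:
  assumes d: "cyl_spec n e d"
    and e: "n \<ge> 1 \<Longrightarrow> singular_chain n (simplex_cyl (n - 1)) e"
    and c: "singular_chain n X c"
  shows "chain_boundary (Suc n) (cyl_op d n H c) =
    chain_map n (\<lambda>x. H (x, 1)) c - chain_map n (\<lambda>x. H (x, 0)) c - cyl_op e (n - 1) H (chain_boundary n c)"
  using c[unfolded singular_chain_def]
proof (induction c rule: frag_induction)
  case (one \<sigma>)
  then have \<sigma>: "singular_simplex n X \<sigma>" by simp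
  let ?g = "\<lambda>(x, t). H (\<sigma> x, t)"
  have id\<sigma>: "chain_map n \<sigma> (simplex_id n) = frag_of \<sigma>"
    by (rule singular_simplex_chain_map_id[OF \<sigma>])
  have ends: "chain_map n ?g (chain_map n (\<lambda>x. (x, t)) (simplex_id n)) = chain_map n (\<lambda>x. H (x, t)) (frag_of \<sigma>)" for t
  proof -
    have "chain_map n ?g (chain_map n (\<lambda>x. (x, t)) (simplex_id n)) = chain_map n (?g \<circ> (\<lambda>x. (x, t))) (simplex_id n)"
      unfolding chain_map_compose by simp
    also have "?g \<circ> (\<lambda>x. (x, t)) = (\<lambda>x. H (x, t)) \<circ> \<sigma>"
      by auto
    also have "chain_map n \<dots> (simplex_id n) = chain_map n (\<lambda>x. H (x, t)) (chain_map n \<sigma> (simplex_id n))"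
      unfolding chain_map_compose by simp
    finally show ?thesis
      unfolding id\<sigma> .
  qed
  have side: "chain_map n ?g (cyl_op e (n - 1) id (chain_boundary n (simplex_id n))) =
      cyl_op e (n - 1) H (chain_boundary n (frag_of \<sigma>))"
  proof (cases n)
    case 0
    then show ?thesis by (simp add: chain_boundary_def)
  next
    case (Suc m)
    have "singular_chain n (subtopology (powertop_real UNIV) (standard_simplex n)) (simplex_id n)"
      unfolding singular_chain_of using simplicial_simplex_id[of n "standard_simplex n"]
      by (simp add: simplicial_imp_singular_simplex)
    from chain_boundary_chain_map[OF this, of \<sigma>] show ?thesis
      using chain_map_cyl_op[of m e H \<sigma>] e Suc unfolding id\<sigma> by simp
  qed
  have "chain_boundary (Suc n) (cyl_op d n H (frag_of \<sigma>)) = chain_map n ?g (chain_boundary (Suc n) d)"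
    using d chain_boundary_chain_map[of "Suc n" "simplex_cyl n" d ?g] by (simp add: cyl_op_def cyl_spec_def)
  also have "\<dots> = chain_map n (\<lambda>x. H (x, 1)) (frag_of \<sigma>) - chain_map n (\<lambda>x. H (x, 0)) (frag_of \<sigma>)
      - cyl_op e (n - 1) H (chain_boundary n (frag_of \<sigma>))"
    using d unfolding cyl_spec_def by (simp only: chain_map_diff ends side)
  finally show ?case .
qed (simp_all add: cyl_op_diff chain_map_diff chain_boundary_diff)

text \<open>The prescribed boundary is a cycle in the contractible cylinder, hence bounds. The model
  \<open>e'\<close>, two dimensions lower, enters through the boundary formula for the walls, which
  is needed to see that it is a cycle.\<close>

lemma cyl_spec_exists:
  assumes e: "n \<ge> 1 \<Longrightarrow> cyl_spec (n - 1) e' e"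
    and e': "n \<ge> 2 \<Longrightarrow> singular_chain (n - 1) (simplex_cyl (n - 2)) e'"
  shows "\<exists>d. cyl_spec n e d"
proof -
  let ?D = "subtopology (powertop_real UNIV) (standard_simplex n)"
  let ?b = "chain_boundary n (simplex_id n)"
  let ?i = "\<lambda>t. chain_map n (\<lambda>x. (x, t)) (simplex_id n)"
  let ?z = "?i 1 - ?i 0 - cyl_op e (n - 1) id ?b"
  have id: "singular_chain n ?D (simplex_id n)"
    unfolding singular_chain_of using simplicial_simplex_id[of n "standard_simplex n"]
    by (simp add: simplicial_imp_singular_simplex)
  have b: "singular_chain (n - 1) ?D ?b"
    using singular_chain_boundary[OF id] by simp
  have i_cont: "continuous_map ?D (simplex_cyl n) (\<lambda>x. (x, t))" if "t \<in> {0..1}" for t :: real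
    using that by (simp add: simplex_cyl_def continuous_map_pairwise comp_def)
  have op: "singular_chain n (simplex_cyl n) (cyl_op e (n - 1) id ?b)"
  proof (cases n)
    case 0
    then show ?thesis by (simp add: chain_boundary_def)
  next
    case (Suc m)
    have "singular_chain (Suc (n - 1)) (simplex_cyl n) (cyl_op e (n - 1) id ?b)"
      by (rule singular_chain_cyl_op[OF _ _ b]) (use e Suc in \<open>auto simp: cyl_spec_def simplex_cyl_def\<close>)
    then show ?thesis using Suc by simp
  qed
  have z: "singular_chain n (simplex_cyl n) ?z"
    using i_cont[of 0] i_cont[of 1] by (intro singular_chain_diff op singular_chain_chain_map[OF id]) auto
  have "\<exists>d. singular_chain (Suc n) (simplex_cyl n) d \<and> chain_boundary (Suc n) d = ?z"
  proof (cases n)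
    case 0
    have "singular_relcycle n (simplex_cyl n) {} ?z"
      using z by (simp add: singular_cycle 0 chain_boundary_def)
    then obtain a where "homologous_rel n (simplex_cyl n) {} ?z (chain_map n (\<lambda>_. a) ?z)"
      using contractible_homologous_const[OF contractible_simplex_cyl] by metis
    \<comment> \<open>In degree 0 being a cycle does not suffice. What helps is that a constant map
      identifies the two ends of the cylinder, so their difference becomes 0.\<close>
    moreover have "chain_map n (\<lambda>_. a) ?z = 0"
    proof -
      have eq: "chain_map n (\<lambda>_. a) (?i t) = chain_map n (\<lambda>_. a) (simplex_id n)" for t :: real
        using fun_cong[OF chain_map_compose[of n "\<lambda>_. a" "\<lambda>x. (x, t)"], of "simplex_id n"]
        unfolding comp_def by metis
      then show ?thesis
        unfolding chain_map_diff eq by (simp add: 0 chain_boundary_def)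
    qed
    ultimately show ?thesis
      by (simp add: homologous_rel_def singular_boundary)
  next
    case (Suc m)
    have nn: "chain_boundary (n - 1) ?b = 0"
      using chain_boundary_boundary[OF id] by simp
    have "chain_boundary n (?i t) = chain_map (n - 1) (\<lambda>x. (x, t)) ?b" for t :: real
      using chain_boundary_chain_map[OF id] by simp
    moreover have "chain_boundary (Suc (n - 1)) (cyl_op e (n - 1) id ?b) =
        chain_map (n - 1) (\<lambda>x. id (x, 1)) ?b - chain_map (n - 1) (\<lambda>x. id (x, 0)) ?b
        - cyl_op e' (n - 1 - 1) id (chain_boundary (n - 1) ?b)"
      by (rule chain_boundary_cyl_op[OF _ _ b]) (use e e' Suc in \<open>auto simp: numeral_2_eq_2\<close>)
    ultimately have "chain_boundary n ?z = 0"
      unfolding nn using Suc by (simp add: chain_boundary_diff)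
    then show ?thesis
      using contractible_cycle_boundary[OF contractible_simplex_cyl _ z] Suc by simp
  qed
  then show ?thesis
    by (simp add: cyl_spec_def)
qed

declare cyl_chain.simps [simp del]

text \<open>The value 0 stands for the missing model below degree 0; the boundary of a 0-chain is 0,
  so the wall term vanishes there.\<close>

lemma cyl_spec_cyl_chain: "cyl_spec n (if n = 0 then 0 else cyl_chain (n - 1)) (cyl_chain n)"
proof (induction n rule: less_induct)
  case (less n)
  let ?e = "\<lambda>n. if n = 0 then 0 else cyl_chain (n - 1)"
  have "\<exists>d. cyl_spec n (?e n) d"
  proof (rule cyl_spec_exists)
    show "cyl_spec (n - 1) (?e (n - 1)) (?e n)" if "n \<ge> 1"
      using less[of "n - 1"] that by (simp)
    show "singular_chain (n - 1) (simplex_cyl (n - 2)) (?e (n - 1))" if "n \<ge> 2"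
    proof -
      define k where "k = n - 2"
      have "n = Suc (Suc k)"
        using that by (simp add: k_def)
      moreover from this have "cyl_spec k (?e k) (cyl_chain k)"
        by (intro less) simp
      ultimately show ?thesis
        by (simp add: cyl_spec_def)
    qed
  qed
  then have "cyl_spec n (?e n) (SOME d. cyl_spec n (?e n) d)"
    by (rule someI_ex)
  moreover have "cyl_chain n = (SOME d. cyl_spec n (?e n) d)"
    by (cases n) (simp_all add: cyl_chain.simps)
  ultimately show ?case
    by (simp only:)
qed

section \<open>Prism operators with coefficients\<close>

definition prism :: "nat \<Rightarrow> ('a \<times> real \<Rightarrow> 'b) \<Rightarrow> 'a chain \<Rightarrow> 'b chain" where
  "prism n = cyl_op (cyl_chain n) n"

lemma singular_chain_prism:
  assumes "continuous_map (prod_topology X (top_of_set {0..1})) Y H" "singular_chain n X c"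
  shows "singular_chain (Suc n) Y (prism n H c)"
  using singular_chain_cyl_op[OF _ assms] cyl_spec_cyl_chain[of n] by (simp add: prism_def cyl_spec_def)

lemma chain_boundary_prism:
  assumes "singular_chain n X c"
  shows "chain_boundary (Suc n) (prism n H c) =
    chain_map n (\<lambda>x. H (x, 1)) c - chain_map n (\<lambda>x. H (x, 0)) c - prism (n - 1) H (chain_boundary n c)"
proof (cases n)
  case 0
  then show ?thesis
    using chain_boundary_cyl_op[OF cyl_spec_cyl_chain[of n] _ assms, of H]
    by (simp add: prism_def chain_boundary_def)
next
  case (Suc m)
  then show ?thesis
    using chain_boundary_cyl_op[OF cyl_spec_cyl_chain[of n] _ assms, of H] cyl_spec_cyl_chain[of m]
    by (simp add: prism_def cyl_spec_def)
qed

definition gprism :: "nat \<Rightarrow> ('a \<times> real \<Rightarrow> 'b) \<Rightarrow> ('a, 'g::ab_group_add) gchain \<Rightarrow> ('b, 'g) gchain" where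
  "gprism n H = glift (prism n H)"

lemma gprism_gchains:
  assumes "continuous_map (prod_topology X (top_of_set {0..1})) Y H" "c \<in> gchains n X"
  shows "gprism n H c \<in> gchains (Suc n) Y"
  unfolding gprism_def by (rule glift_gchains[OF _ assms(2)]) (rule singular_chain_prism[OF assms(1)])

lemma gbd_gprism:
  assumes "c \<in> gchains n X"
  shows "gbd (Suc n) (gprism n H c) =
    gmap n (\<lambda>x. H (x, 1)) c - gmap n (\<lambda>x. H (x, 0)) c - gprism (n - 1) H (gbd n c)"
proof -
  have "gbd (Suc n) (gprism n H c) = glift (\<lambda>a. chain_boundary (Suc n) (prism n H a)) c"
    by (simp add: gprism_def gbd_eq_glift fsupp_glift glift_glift additive_chain_boundary)
  also have "\<dots> = glift (\<lambda>a. chain_map n (\<lambda>x. H (x, 1)) a - chain_map n (\<lambda>x. H (x, 0)) a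
      - prism (n - 1) H (chain_boundary n a)) c"
    by (rule glift_cong[OF _ assms]) (rule chain_boundary_prism)
  also have "\<dots> = gmap n (\<lambda>x. H (x, 1)) c - gmap n (\<lambda>x. H (x, 0)) c - gprism (n - 1) H (gbd n c)"
    unfolding glift_diff using assms
    by (simp add: gprism_def gmap_def gbd_eq_glift gchains_fsupp glift_glift prism_def additive_cyl_op)
  finally show ?thesis .
qed

section \<open>Iterated subdivision\<close>

definition gsd :: "nat \<Rightarrow> nat \<Rightarrow> ('a, 'g::ab_group_add) gchain \<Rightarrow> ('a, 'g) gchain" where
  "gsd N n = glift (singular_subdivision n ^^ N)"

lemma singular_chain_subdivision_power:
  "singular_chain n X c \<Longrightarrow> singular_chain n X ((singular_subdivision n ^^ N) c)"
  by (induction N) (auto intro: singular_chain_singular_subdivision)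

lemma chain_boundary_subdivision_power:
  "singular_chain n X c \<Longrightarrow>
    chain_boundary n ((singular_subdivision n ^^ N) c) = (singular_subdivision (n - 1) ^^ N) (chain_boundary n c)"
  by (induction N)
    (auto simp: chain_boundary_singular_subdivision[OF singular_chain_subdivision_power])

lemma additive_subdivision_power: "additive (singular_subdivision n ^^ N)"
  by (induction N) (auto simp: additive_def singular_subdivision_add)

lemma gsd_gchains: "c \<in> gchains n X \<Longrightarrow> gsd N n c \<in> gchains n X"
  unfolding gsd_def by (rule glift_gchains) (auto intro: singular_chain_subdivision_power)

lemma gbd_gsd: "c \<in> gchains n X \<Longrightarrow> gbd n (gsd N n c) = gsd N (n - 1) (gbd n c)"
  by (simp add: gsd_def gbd_eq_glift fsupp_glift gchains_fsupp glift_glift additive_subdivision_power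
      additive_chain_boundary)
    (rule glift_cong, auto simp: chain_boundary_subdivision_power)

text \<open>A single \<open>h\<close> serves all spaces on the given type of points, so it maps
  chains of a subspace to chains of the same subspace. This is what keeps corrections inside
  \<open>V\<close> and inside the overlap of the ends.\<close>

lemma gsd_homotopy:
  obtains h where
    "\<And>n X c. c \<in> gchains n X \<Longrightarrow> h n c \<in> gchains (Suc n) X"
    "\<And>n X c. c \<in> gchains n X \<Longrightarrow>
       gbd (Suc n) (h n c) + h (n - 1) (gbd n c) = gsd N n c - (c :: ('a, 'g::ab_group_add) gchain)"
proof -
  obtain h where h: "\<And>p. h p 0 = (0 :: 'a chain)"
    "\<And>p c1 c2. h p (c1 - c2) = h p c1 - h p c2"
    "\<And>p X c. singular_chain p X c \<Longrightarrow> singular_chain (Suc p) X (h p c)"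
    "\<And>p X c. singular_chain p X c \<Longrightarrow>
       chain_boundary (Suc p) (h p c) + h (p - Suc 0) (chain_boundary p c) = (singular_subdivision p ^^ N) c - c"
    using chain_homotopic_iterated_singular_subdivision[where n = N] by blast
  have h_add: "additive (h p)" for p
    using h(2)[of p _ "- _"] h(2)[of p 0] h(1) by (simp add: additive_def)
  show thesis
  proof (rule that[of "\<lambda>n. glift (h n)"])
    fix n X and c :: "('a, 'g) gchain"
    assume c: "c \<in> gchains n X"
    show "glift (h n) c \<in> gchains (Suc n) X"
      using h(3) by (rule glift_gchains[OF _ c])
    have "gbd (Suc n) (glift (h n) c) + glift (h (n - 1)) (gbd n c) =
        glift (\<lambda>a. chain_boundary (Suc n) (h n a) + h (n - 1) (chain_boundary n a)) c"
      using c by (simp add: gbd_eq_glift fsupp_glift gchains_fsupp glift_glift glift_add additive_chain_boundary h_add)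
    also have "\<dots> = glift (\<lambda>a. (singular_subdivision n ^^ N) a - a) c"
      using h(4) by (intro glift_cong[OF _ c]) simp
    also have "\<dots> = gsd N n c - c"
      using c by (simp add: glift_diff gsd_def glift_ident)
    finally show "gbd (Suc n) (glift (h n) c) + glift (h (n - 1)) (gbd n c) = gsd N n c - c" .
  qed
qed

lemma gchains_split:
  fixes c :: "('a, 'g::ab_group_add) gchain"
  assumes "c \<in> gchains n X"
    and "\<And>\<sigma>. c \<sigma> \<noteq> 0 \<Longrightarrow> \<sigma> ` standard_simplex n \<subseteq> U1 \<or> \<sigma> ` standard_simplex n \<subseteq> U2"
  obtains c1 c2 where "c = c1 + c2" "c1 \<in> gchains n (subtopology X U1)" "c2 \<in> gchains n (subtopology X U2)"
proof
  let ?P = "\<lambda>\<sigma>. \<sigma> ` standard_simplex n \<subseteq> U1"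
  let ?c1 = "\<lambda>\<sigma>. if ?P \<sigma> then c \<sigma> else 0" and ?c2 = "\<lambda>\<sigma>. if ?P \<sigma> then 0 else c \<sigma>"
  show "c = ?c1 + ?c2"
    by auto
  have "finite {\<sigma>. ?c1 \<sigma> \<noteq> 0}" "finite {\<sigma>. ?c2 \<sigma> \<noteq> 0}"
    by (rule finite_subset[of _ "{\<sigma>. c \<sigma> \<noteq> 0}"]; use assms(1) in \<open>auto simp: gchains_def\<close>)+
  then show "?c1 \<in> gchains n (subtopology X U1)" "?c2 \<in> gchains n (subtopology X U2)"
    using assms by (auto simp: gchains_def singular_simplex_subtopology)
qed

text \<open>Holding for all exponents from \<open>N\<close> on, it allows two different chains to be
  made small by the same subdivision.\<close>

lemma gsd_small:
  fixes c :: "('a, 'g::ab_group_add) gchain"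
  assumes U: "openin X U1" "openin X U2" "topspace X \<subseteq> U1 \<union> U2" and c: "c \<in> gchains n X"
  shows "\<exists>N. \<forall>M\<ge>N. \<exists>c1\<in>gchains n (subtopology X U1). \<exists>c2\<in>gchains n (subtopology X U2). gsd M n c = c1 + c2"
proof -
  have "\<exists>N. \<forall>M f. N \<le> M \<longrightarrow> f \<in> Poly_Mapping.keys ((singular_subdivision n ^^ M) (frag_of \<sigma>)) \<longrightarrow>
      f ` standard_simplex n \<subseteq> U1 \<or> f ` standard_simplex n \<subseteq> U2" if "c \<sigma> \<noteq> 0" for \<sigma>
  proof -
    have "singular_chain n X (frag_of \<sigma>)"
      using c that by (auto simp: gchains_def singular_chain_of)
    then obtain N where "\<And>M f. N \<le> M \<Longrightarrow> f \<in> Poly_Mapping.keys ((singular_subdivision n ^^ M) (frag_of \<sigma>)) \<Longrightarrow>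
        \<exists>V\<in>{U1, U2}. f \<in> standard_simplex n \<rightarrow> V"
      using sufficient_iterated_singular_subdivision_exists[of "{U1, U2}" X n "frag_of \<sigma>"] U by auto
    then show ?thesis
      by (intro exI[of _ N]) blast
  qed
  then obtain N where N: "\<And>\<sigma> M f. c \<sigma> \<noteq> 0 \<Longrightarrow> N \<sigma> \<le> M \<Longrightarrow>
      f \<in> Poly_Mapping.keys ((singular_subdivision n ^^ M) (frag_of \<sigma>)) \<Longrightarrow>
      f ` standard_simplex n \<subseteq> U1 \<or> f ` standard_simplex n \<subseteq> U2"
    by metis
  have fin: "finite {\<sigma>. c \<sigma> \<noteq> 0}"
    using c by (simp add: gchains_def)
  show ?thesis
  proof (intro exI allI impI)
    \<comment> \<open>The sum of the finitely many thresholds of the single simplices bounds each of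
      them.\<close>
    fix M assume M: "(\<Sum>\<sigma> | c \<sigma> \<noteq> 0. N \<sigma>) \<le> M"
    have le: "N \<sigma> \<le> M" if "c \<sigma> \<noteq> 0" for \<sigma>
      using member_le_sum[of \<sigma> "{\<sigma>. c \<sigma> \<noteq> 0}" N] fin that M by simp
    have "\<exists>\<sigma>. c \<sigma> \<noteq> 0 \<and> f \<in> Poly_Mapping.keys ((singular_subdivision n ^^ M) (frag_of \<sigma>))"
      if "gsd M n c f \<noteq> 0" for f
    proof -
      have "(\<Sum>\<sigma> | c \<sigma> \<noteq> 0. zmul (poly_mapping.lookup ((singular_subdivision n ^^ M) (frag_of \<sigma>)) f) (c \<sigma>)) \<noteq> 0"
        using that by (simp add: gsd_def glift_def gext_apply)
      then obtain \<sigma> where "c \<sigma> \<noteq> 0" "zmul (poly_mapping.lookup ((singular_subdivision n ^^ M) (frag_of \<sigma>)) f) (c \<sigma>) \<noteq> 0"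
        by (metis (mono_tags, lifting) mem_Collect_eq sum.neutral)
      then show ?thesis
        by (intro exI[of _ \<sigma>]) (auto simp: in_keys_iff)
    qed
    then have "f ` standard_simplex n \<subseteq> U1 \<or> f ` standard_simplex n \<subseteq> U2" if "gsd M n c f \<noteq> 0" for f
      using N le that by meson
    then obtain c1 c2 where "gsd M n c = c1 + c2" "c1 \<in> gchains n (subtopology X U1)" "c2 \<in> gchains n (subtopology X U2)"
      using gchains_split[OF gsd_gchains[OF c, of M]] by metis
    then show "\<exists>c1\<in>gchains n (subtopology X U1). \<exists>c2\<in>gchains n (subtopology X U2). gsd M n c = c1 + c2"
      by blast
  qed
qed

section \<open>The two topologies on the join\<close>

text \<open>A homotopy from the identity at \<open>s = 0\<close> to the reparametrisation by
  \<open>\<psi>\<close> at \<open>s = 1\<close>, moving points along the segments of the join.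
  Passing through \<open>jproj\<close> lets interior points reach the ends.\<close>

definition jmove :: "(real \<Rightarrow> real) \<Rightarrow> ('a, 'b) joinpt \<times> real \<Rightarrow> ('a, 'b) joinpt" where
  "jmove \<psi> = (\<lambda>(p, s). case p of JX x \<Rightarrow> JX x | JY y \<Rightarrow> JY y
     | JM x y t \<Rightarrow> jproj (x, y, (1 - s) * t + s * \<psi> t))"

text \<open>Fixing 0 and 1 makes the motion of interior points agree with the points
  \<open>JX\<close> and \<open>JY\<close>, which stay at rest.\<close>

definition reparam :: "(real \<Rightarrow> real) \<Rightarrow> bool" where
  "reparam \<psi> \<longleftrightarrow> continuous_on {0..1} \<psi> \<and> \<psi> ` {0..1} \<subseteq> {0..1} \<and> \<psi> 0 = 0 \<and> \<psi> 1 = 1"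

lemma reparam_range: "reparam \<psi> \<Longrightarrow> t \<in> {0..1} \<Longrightarrow> \<psi> t \<in> {0..1}"
  unfolding reparam_def by blast

text \<open>Continuity of \<open>jmove\<close> is part of the interface because its proof differs
  between the topologies: one rests on products of quotient maps with \<open>[0,1]\<close>, the
  other on a subbasis. As \<open>jx\<close> and \<open>jy\<close> carry no information at the
  opposite end, their continuity is expressed by open preimages away from that end.\<close>

locale join_topology =
  fixes X :: "'a topology" and Y :: "'b topology" and W :: "('a, 'b) joinpt topology"
  assumes nonempty: "topspace X \<noteq> {}" "topspace Y \<noteq> {}"
    and topspace_W: "topspace W = jset (topspace X) (topspace Y)"
    and jproj_cont: "continuous_map (prod_topology X (prod_topology Y (top_of_set {0..1}))) W jproj"
    and jt_cont: "continuous_map W (top_of_set {0..1}) jt"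
    and jx_open: "openin X U \<Longrightarrow> openin W {p \<in> topspace W. 0 < jt p \<and> jx p \<in> U}"
    and jy_open: "openin Y U' \<Longrightarrow> openin W {p \<in> topspace W. jt p < 1 \<and> jy p \<in> U'}"
    and jmove_cont: "reparam \<psi> \<Longrightarrow> continuous_map (prod_topology W (top_of_set {0..1})) W (jmove \<psi>)"

lemma jset_cases:
  assumes "p \<in> jset A B"
  obtains x where "p = JX x" "x \<in> A" | y where "p = JY y" "y \<in> B"
  | x y t where "p = JM x y t" "x \<in> A" "y \<in> B" "0 < t" "t < 1"
  using assms unfolding jset_def by blast

lemma jt_range: "p \<in> jset A B \<Longrightarrow> jt p \<in> {0..1}"
  by (auto elim: jset_cases)

lemma convex_01:
  fixes s t u :: real
  assumes "s \<in> {0..1}" "t \<in> {0..1}" "u \<in> {0..1}"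
  shows "(1 - s) * t + s * u \<in> {0..1}"
  using assms convex_bound_le[of t 1 u "1 - s" s] by simp

lemma jproj_in_jset: "x \<in> A \<Longrightarrow> y \<in> B \<Longrightarrow> t \<in> {0..1} \<Longrightarrow> jproj (x, y, t) \<in> jset A B"
  by (auto simp: jproj_def jset_def)

lemma jt_jproj: "jt (jproj (x, y, t)) = t"
  by (simp add: jproj_def)

lemma jmove_in_jset:
  assumes "reparam \<psi>" "p \<in> jset A B" "s \<in> {0..1}"
  shows "jmove \<psi> (p, s) \<in> jset A B"
  using assms(2)
proof (cases rule: jset_cases)
  case (3 x y t)
  then have "\<psi> t \<in> {0..1}"
    using reparam_range[OF assms(1), of t] by simp
  then show ?thesis
    using 3 assms(3) by (auto simp: jmove_def intro!: jproj_in_jset convex_01)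
qed (auto simp: jmove_def jset_def)

lemma jt_jmove:
  assumes "reparam \<psi>" "p \<in> jset A B"
  shows "jt (jmove \<psi> (p, s)) = (1 - s) * jt p + s * \<psi> (jt p)"
  using assms(2)
  by (cases rule: jset_cases) (use assms(1) in \<open>auto simp: jmove_def reparam_def jt_jproj\<close>)

lemma jx_jmove: "0 < jt (jmove \<psi> (p, s)) \<Longrightarrow> jx (jmove \<psi> (p, s)) = jx p"
  by (cases p) (auto simp: jmove_def jproj_def)

lemma jy_jmove: "jt (jmove \<psi> (p, s)) < 1 \<Longrightarrow> jy (jmove \<psi> (p, s)) = jy p"
  by (cases p) (auto simp: jmove_def jproj_def)

text \<open>A point at parameter 0 is at rest, so a point found at positive parameter started at
  one. This turns a condition on the moved point into a condition on \<open>p\<close>, where the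
  coordinate \<open>jx\<close> is controlled.\<close>

lemma jmove_pos:
  assumes "reparam \<psi>" "p \<in> jset A B" "0 < jt (jmove \<psi> (p, s))"
  shows "0 < jt p"
  using assms(2)
  by (cases rule: jset_cases) (use assms in \<open>auto simp: jt_jmove reparam_def\<close>)

lemma jmove_less_1:
  assumes "reparam \<psi>" "p \<in> jset A B" "jt (jmove \<psi> (p, s)) < 1"
  shows "jt p < 1"
  using assms(2)
  by (cases rule: jset_cases) (use assms in \<open>auto simp: jt_jmove reparam_def\<close>)

section \<open>The coarsest topology on the join\<close>

lemma topspace_hjoin: "topspace (hjoin X Y) = jset (topspace X) (topspace Y)"
  unfolding hjoin_def topology_generated_by_topspace
proof
  have "openin (top_of_set {0..1::real}) {0..1}"
    by simp
  moreover have "jset (topspace X) (topspace Y) = {p \<in> jset (topspace X) (topspace Y). jt p \<in> {0..1}}"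
    using jt_range by blast
  ultimately show "jset (topspace X) (topspace Y) \<subseteq> \<Union> ({{p \<in> jset (topspace X) (topspace Y). jt p \<in> V} | V. openin (top_of_set {0..1::real}) V}
    \<union> {{p \<in> jset (topspace X) (topspace Y). 0 < jt p \<and> jx p \<in> U} | U. openin X U}
    \<union> {{p \<in> jset (topspace X) (topspace Y). jt p < 1 \<and> jy p \<in> U} | U. openin Y U})"
    by blast
qed auto

lemma hjoin_open_t:
  "openin (top_of_set {0..1}) V \<Longrightarrow> openin (hjoin X Y) {p \<in> jset (topspace X) (topspace Y). jt p \<in> V}"
  unfolding hjoin_def by (rule topology_generated_by_Basis) blast

lemma hjoin_open_x:
  "openin X U \<Longrightarrow> openin (hjoin X Y) {p \<in> jset (topspace X) (topspace Y). 0 < jt p \<and> jx p \<in> U}"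
  unfolding hjoin_def by (rule topology_generated_by_Basis) blast

lemma hjoin_open_y:
  "openin Y U \<Longrightarrow> openin (hjoin X Y) {p \<in> jset (topspace X) (topspace Y). jt p < 1 \<and> jy p \<in> U}"
  unfolding hjoin_def by (rule topology_generated_by_Basis) blast

text \<open>The universal property of the coarsest topology, tested on its subbasis; each coordinate
  is tested only where it is defined.\<close>

lemma continuous_map_into_hjoin:
  assumes f: "\<And>z. z \<in> topspace T \<Longrightarrow> f z \<in> jset (topspace X) (topspace Y)"
    and t: "continuous_map T (top_of_set {0..1}) (\<lambda>z. jt (f z))"
    and x: "\<And>U. openin X U \<Longrightarrow> openin T {z \<in> topspace T. 0 < jt (f z) \<and> jx (f z) \<in> U}"
    and y: "\<And>U. openin Y U \<Longrightarrow> openin T {z \<in> topspace T. jt (f z) < 1 \<and> jy (f z) \<in> U}"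
  shows "continuous_map T (hjoin X Y) f"
  unfolding hjoin_def
proof (rule continuous_on_generated_topo)
  show "f ` topspace T \<subseteq> \<Union> ({{p \<in> jset (topspace X) (topspace Y). jt p \<in> V} | V. openin (top_of_set {0..1::real}) V}
    \<union> {{p \<in> jset (topspace X) (topspace Y). 0 < jt p \<and> jx p \<in> U} | U. openin X U}
    \<union> {{p \<in> jset (topspace X) (topspace Y). jt p < 1 \<and> jy p \<in> U} | U. openin Y U})"
    using f topspace_hjoin[of X Y, unfolded hjoin_def topology_generated_by_topspace] by blast
  fix S assume "S \<in> {{p \<in> jset (topspace X) (topspace Y). jt p \<in> V} | V. openin (top_of_set {0..1::real}) V}
    \<union> {{p \<in> jset (topspace X) (topspace Y). 0 < jt p \<and> jx p \<in> U} | U. openin X U}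
    \<union> {{p \<in> jset (topspace X) (topspace Y). jt p < 1 \<and> jy p \<in> U} | U. openin Y U}"
  then consider V where "openin (top_of_set {0..1::real}) V" "S = {p \<in> jset (topspace X) (topspace Y). jt p \<in> V}"
    | U where "openin X U" "S = {p \<in> jset (topspace X) (topspace Y). 0 < jt p \<and> jx p \<in> U}"
    | U where "openin Y U" "S = {p \<in> jset (topspace X) (topspace Y). jt p < 1 \<and> jy p \<in> U}"
    by blast
  then show "openin T (f -` S \<inter> topspace T)"
  proof cases
    case 1
    then have "f -` S \<inter> topspace T = {z \<in> topspace T. jt (f z) \<in> V}"
      using f by auto
    then show ?thesis
      using openin_continuous_map_preimage[OF t 1(1)] by simp
  next
    case 2
    then have "f -` S \<inter> topspace T = {z \<in> topspace T. 0 < jt (f z) \<and> jx (f z) \<in> U}"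
      using f by auto
    then show ?thesis
      using x[OF 2(1)] by simp
  next
    case 3
    then have "f -` S \<inter> topspace T = {z \<in> topspace T. jt (f z) < 1 \<and> jy (f z) \<in> U}"
      using f by auto
    then show ?thesis
      using y[OF 3(1)] by simp
  qed
qed

lemma hjoin_jt_cont: "continuous_map (hjoin X Y) (top_of_set {0..1}) jt"
  unfolding continuous_map topspace_hjoin
  using hjoin_open_t[of _ X Y] by (auto dest: jt_range)

lemma continuous_map_fst_in: "continuous_map T (prod_topology A B) f \<Longrightarrow> continuous_map T A (\<lambda>z. fst (f z))"
  and continuous_map_snd_in: "continuous_map T (prod_topology A B) f \<Longrightarrow> continuous_map T B (\<lambda>z. snd (f z))"
  by (simp_all add: continuous_map_pairwise comp_def)

lemma reparam_comp_cont:
  assumes "reparam \<psi>" "continuous_map T (top_of_set {0..1}) f"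
  shows "continuous_map T euclideanreal (\<lambda>z. \<psi> (f z))"
proof -
  have "continuous_map (top_of_set {0..1}) euclideanreal \<psi>"
    using assms(1) by (simp add: reparam_def)
  from continuous_map_compose[OF assms(2) this] show ?thesis
    by (simp add: comp_def)
qed

lemma reparam_homotopy_cont:
  assumes \<psi>: "reparam \<psi>" and f: "continuous_map T (top_of_set {0..1}) f"
    and g: "continuous_map T (top_of_set {0..1}) g"
  shows "continuous_map T (top_of_set {0..1}) (\<lambda>z. (1 - g z) * f z + g z * \<psi> (f z))"
proof -
  have fg: "f z \<in> {0..1}" "g z \<in> {0..1}" if "z \<in> topspace T" for z
    using f g that by (auto simp: continuous_map_def)
  then have "\<psi> (f z) \<in> {0..1}" if "z \<in> topspace T" for z
    using reparam_range[OF \<psi>] that by blast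
  moreover have "continuous_map T euclideanreal (\<lambda>z. (1 - g z) * f z + g z * \<psi> (f z))"
    using f g by (intro continuous_intros reparam_comp_cont[OF \<psi> f])
      (auto intro: continuous_map_into_fulltopology)
  ultimately show ?thesis
    using fg convex_01 unfolding continuous_map_in_subtopology by blast
qed

lemma openin_subset_Int_vimage:
  assumes "continuous_map T (top_of_set {0..1::real}) f"
  shows "openin T {z \<in> topspace T. a < f z}" "openin T {z \<in> topspace T. f z < a}"
proof -
  have "continuous_map T euclideanreal f"
    using assms by (rule continuous_map_into_fulltopology)
  from openin_continuous_map_preimage[OF this, of "{a<..}"] openin_continuous_map_preimage[OF this, of "{..<a}"]
  show "openin T {z \<in> topspace T. a < f z}" "openin T {z \<in> topspace T. f z < a}"
    by auto
qed

lemma join_topology_hjoin: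
  assumes "topspace X \<noteq> {}" "topspace Y \<noteq> {}"
  shows "join_topology X Y (hjoin X Y)"
proof
  let ?I = "top_of_set {0..1::real}"
  let ?W = "hjoin X Y"
  show "topspace X \<noteq> {}" "topspace Y \<noteq> {}" by fact+
  show top: "topspace ?W = jset (topspace X) (topspace Y)" by (rule topspace_hjoin)
  show "continuous_map ?W ?I jt" by (rule hjoin_jt_cont)
  show "openin ?W {p \<in> topspace ?W. 0 < jt p \<and> jx p \<in> U}" if "openin X U" for U
    using hjoin_open_x[OF that] by (simp add: top)
  show "openin ?W {p \<in> topspace ?W. jt p < 1 \<and> jy p \<in> U}" if "openin Y U" for U
    using hjoin_open_y[OF that] by (simp add: top)
  let ?P = "prod_topology X (prod_topology Y ?I)"
  have t_cont: "continuous_map ?P ?I (\<lambda>z. snd (snd z))"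
    by (intro continuous_map_snd_in[OF continuous_map_snd])
  show "continuous_map ?P ?W jproj"
  proof (rule continuous_map_into_hjoin)
    show "jproj z \<in> jset (topspace X) (topspace Y)" if "z \<in> topspace ?P" for z
      using that by (cases z) (auto intro!: jproj_in_jset)
    have "(\<lambda>z::'a \<times> 'b \<times> real. jt (jproj z)) = (\<lambda>z. snd (snd z))"
      by (auto simp: jt_jproj)
    then show "continuous_map ?P ?I (\<lambda>z. jt (jproj z))"
      using t_cont by simp
    show "openin ?P {z \<in> topspace ?P. 0 < jt (jproj z) \<and> jx (jproj z) \<in> U}" if "openin X U" for U
    proof -
      have "{z \<in> topspace ?P. 0 < jt (jproj z) \<and> jx (jproj z) \<in> U} =
          {z \<in> topspace ?P. 0 < snd (snd z)} \<inter> {z \<in> topspace ?P. fst z \<in> U}"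
        by (auto simp: jproj_def split: if_splits)
      then show ?thesis
        by (simp only:) (intro openin_Int openin_subset_Int_vimage(1)[OF t_cont]
          openin_continuous_map_preimage[OF continuous_map_fst that])
    qed
    show "openin ?P {z \<in> topspace ?P. jt (jproj z) < 1 \<and> jy (jproj z) \<in> U}" if "openin Y U" for U
    proof -
      have "{z \<in> topspace ?P. jt (jproj z) < 1 \<and> jy (jproj z) \<in> U} =
          {z \<in> topspace ?P. snd (snd z) < 1} \<inter> {z \<in> topspace ?P. fst (snd z) \<in> U}"
        by (auto simp: jproj_def split: if_splits)
      then show ?thesis
        by (simp only:) (intro openin_Int openin_subset_Int_vimage(2)[OF t_cont]
          openin_continuous_map_preimage[OF continuous_map_fst_in[OF continuous_map_snd] that])
    qed
  qed
  show "continuous_map (prod_topology ?W ?I) ?W (jmove \<psi>)" if \<psi>: "reparam \<psi>" for \<psi>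
  proof (rule continuous_map_into_hjoin)
    let ?T = "prod_topology ?W ?I"
    show "jmove \<psi> z \<in> jset (topspace X) (topspace Y)" if "z \<in> topspace ?T" for z
      using that jmove_in_jset[OF \<psi>] by (cases z) (auto simp: top)
    have "continuous_map ?T ?I (\<lambda>z. (1 - snd z) * jt (fst z) + snd z * \<psi> (jt (fst z)))"
      using continuous_map_compose[OF continuous_map_fst hjoin_jt_cont, unfolded comp_def] continuous_map_snd
      by (rule reparam_homotopy_cont[OF \<psi>])
    then show jt: "continuous_map ?T ?I (\<lambda>z. jt (jmove \<psi> z))"
      by (rule continuous_map_eq) (auto simp: top jt_jmove[OF \<psi>])
    show "openin ?T {z \<in> topspace ?T. 0 < jt (jmove \<psi> z) \<and> jx (jmove \<psi> z) \<in> U}" if "openin X U" for U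
    proof -
      have "{z \<in> topspace ?T. 0 < jt (jmove \<psi> z) \<and> jx (jmove \<psi> z) \<in> U} =
          {z \<in> topspace ?T. 0 < jt (jmove \<psi> z)} \<inter>
          {z \<in> topspace ?T. fst z \<in> {p \<in> jset (topspace X) (topspace Y). 0 < jt p \<and> jx p \<in> U}}"
        by (auto simp: top jx_jmove jmove_pos[OF \<psi>])
      then show ?thesis
        by (simp only:) (intro openin_Int openin_subset_Int_vimage(1)[OF jt]
          openin_continuous_map_preimage[OF continuous_map_fst hjoin_open_x[OF that]])
    qed
    show "openin ?T {z \<in> topspace ?T. jt (jmove \<psi> z) < 1 \<and> jy (jmove \<psi> z) \<in> U}" if "openin Y U" for U
    proof -
      have "{z \<in> topspace ?T. jt (jmove \<psi> z) < 1 \<and> jy (jmove \<psi> z) \<in> U} =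
          {z \<in> topspace ?T. jt (jmove \<psi> z) < 1} \<inter>
          {z \<in> topspace ?T. fst z \<in> {p \<in> jset (topspace X) (topspace Y). jt p < 1 \<and> jy p \<in> U}}"
        by (auto simp: top jy_jmove jmove_less_1[OF \<psi>])
      then show ?thesis
        by (simp only:) (intro openin_Int openin_subset_Int_vimage(2)[OF jt]
          openin_continuous_map_preimage[OF continuous_map_fst hjoin_open_y[OF that]])
    qed
  qed
qed

section \<open>The quotient topology on the join\<close>

lemma topspace_qjoin: "topspace (qjoin X Y) = jset (topspace X) (topspace Y)"
proof -
  let ?J = "jset (topspace X) (topspace Y)"
  have eq: "{x \<in> topspace X. JX x \<in> ?J} = topspace X" "{y \<in> topspace Y. JY y \<in> ?J} = topspace Y"
    by (auto simp: jset_def)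
  have eq': "{p \<in> topspace X \<times> topspace Y \<times> {0..1}. jproj p \<in> ?J} = topspace X \<times> topspace Y \<times> {0..1}"
    by (auto intro!: jproj_in_jset)
  have "openin (prod_topology X (prod_topology Y (top_of_set {0..1::real}))) (topspace X \<times> topspace Y \<times> {0..1})"
    using openin_topspace[of "prod_topology X (prod_topology Y (top_of_set {0..1::real}))"] by simp
  then have "?J \<in> {U. U \<subseteq> ?J
       \<and> openin X {x \<in> topspace X. JX x \<in> U}
       \<and> openin Y {y \<in> topspace Y. JY y \<in> U}
       \<and> openin (prod_topology X (prod_topology Y (top_of_set {0..1::real})))
           {p \<in> topspace X \<times> topspace Y \<times> {0..1}. jproj p \<in> U}}"
    by (simp add: eq eq')
  then show ?thesis
    unfolding qjoin_def topology_generated_by_topspace by blast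
qed

text \<open>For nonempty factors the cylinder alone surjects onto the join. The openness conditions
  on the two end summands follow by restricting to the slices \<open>(x, y0, 1)\<close> and
  \<open>(x0, y, 0)\<close>.\<close>

lemma quotient_map_qjoin:
  assumes ne: "topspace X \<noteq> {}" "topspace Y \<noteq> {}"
  shows "quotient_map (prod_topology X (prod_topology Y (top_of_set {0..1}))) (qjoin X Y) jproj"
    (is "quotient_map ?P ?W _")
proof -
  obtain x0 y0 where x0: "x0 \<in> topspace X" and y0: "y0 \<in> topspace Y"
    using ne by blast
  have im: "jproj ` topspace ?P = jset (topspace X) (topspace Y)"
  proof
    show "jproj ` topspace ?P \<subseteq> jset (topspace X) (topspace Y)"
      by (auto intro!: jproj_in_jset)
    show "jset (topspace X) (topspace Y) \<subseteq> jproj ` topspace ?P"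
    proof
      fix p assume "p \<in> jset (topspace X) (topspace Y)"
      then show "p \<in> jproj ` topspace ?P"
      proof (cases rule: jset_cases)
        case (1 x)
        then show ?thesis
          using y0 by (intro image_eqI[of _ _ "(x, y0, 1)"]) (auto simp: jproj_def)
      next
        case (2 y)
        then show ?thesis
          using x0 by (intro image_eqI[of _ _ "(x0, y, 0)"]) (auto simp: jproj_def)
      next
        case (3 x y t)
        then show ?thesis
          by (intro image_eqI[of _ _ "(x, y, t)"]) (auto simp: jproj_def)
      qed
    qed
  qed
  have "continuous_map ?P ?W jproj"
    unfolding qjoin_def
  proof (rule continuous_on_generated_topo)
    fix U assume "U \<in> {U. U \<subseteq> jset (topspace X) (topspace Y)
       \<and> openin X {x \<in> topspace X. JX x \<in> U}
       \<and> openin Y {y \<in> topspace Y. JY y \<in> U}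
       \<and> openin ?P {p \<in> topspace X \<times> topspace Y \<times> {0..1}. jproj p \<in> U}}"
    moreover have "jproj -` U \<inter> topspace ?P = {p \<in> topspace X \<times> topspace Y \<times> {0..1}. jproj p \<in> U}"
      by auto
    ultimately show "openin ?P (jproj -` U \<inter> topspace ?P)" by simp
  next
    show "jproj ` topspace ?P \<subseteq> \<Union> {U. U \<subseteq> jset (topspace X) (topspace Y)
       \<and> openin X {x \<in> topspace X. JX x \<in> U}
       \<and> openin Y {y \<in> topspace Y. JY y \<in> U}
       \<and> openin ?P {p \<in> topspace X \<times> topspace Y \<times> {0..1}. jproj p \<in> U}}"
      using im topspace_qjoin[of X Y, unfolded qjoin_def topology_generated_by_topspace] by blast
  qed
  moreover have "openin ?W U" if "U \<subseteq> topspace ?W" "openin ?P {z \<in> topspace ?P. jproj z \<in> U}" for U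
  proof -
    have slice: "continuous_map X ?P (\<lambda>x. (x, y0, 1))" "continuous_map Y ?P (\<lambda>y. (x0, y, 0))"
      using x0 y0 by (auto simp: continuous_map_pairwise comp_def)
    have "{x \<in> topspace X. JX x \<in> U} = {x \<in> topspace X. (x, y0, 1) \<in> {z \<in> topspace ?P. jproj z \<in> U}}"
      "{y \<in> topspace Y. JY y \<in> U} = {y \<in> topspace Y. (x0, y, 0) \<in> {z \<in> topspace ?P. jproj z \<in> U}}"
      using x0 y0 by (auto simp: jproj_def)
    then have "openin X {x \<in> topspace X. JX x \<in> U}" "openin Y {y \<in> topspace Y. JY y \<in> U}"
      using openin_continuous_map_preimage[OF slice(1) that(2)] openin_continuous_map_preimage[OF slice(2) that(2)]
      by simp_all
    moreover have "U \<subseteq> jset (topspace X) (topspace Y)"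
      using that(1) by (simp add: topspace_qjoin)
    moreover have "openin ?P {p \<in> topspace X \<times> topspace Y \<times> {0..1}. jproj p \<in> U}"
      using that(2) by simp
    ultimately show ?thesis
      unfolding qjoin_def by (intro topology_generated_by_Basis) blast
  qed
  ultimately show ?thesis
    unfolding quotient_map_def
    using im openin_continuous_map_preimage[of ?P ?W jproj] by (auto simp: topspace_qjoin)
qed

lemma join_topology_qjoin:
  assumes ne: "topspace X \<noteq> {}" "topspace Y \<noteq> {}"
  shows "join_topology X Y (qjoin X Y)"
proof
  let ?I = "top_of_set {0..1::real}"
  let ?W = "qjoin X Y"
  let ?P = "prod_topology X (prod_topology Y ?I)"
  note q = quotient_map_qjoin[OF ne]
  show "topspace X \<noteq> {}" "topspace Y \<noteq> {}" by fact+
  show top: "topspace ?W = jset (topspace X) (topspace Y)" by (rule topspace_qjoin)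
  show "continuous_map ?P ?W jproj"
    by (rule quotient_imp_continuous_map[OF q])
  have t_cont: "continuous_map ?P ?I (\<lambda>z. snd (snd z))"
    by (intro continuous_map_snd_in[OF continuous_map_snd])
  have "jt \<circ> (jproj :: 'a \<times> 'b \<times> real \<Rightarrow> _) = (\<lambda>z. snd (snd z))"
    by (auto simp: jt_jproj)
  then show "continuous_map ?W ?I jt"
    using continuous_compose_quotient_map[OF q, of ?I jt] t_cont by simp
  have qopen: "openin ?W U" if "U \<subseteq> topspace ?W" "openin ?P {z \<in> topspace ?P. jproj z \<in> U}" for U
    using q that unfolding quotient_map_def by blast
  show "openin ?W {p \<in> topspace ?W. 0 < jt p \<and> jx p \<in> U}" if "openin X U" for U
  proof (rule qopen)
    have "{z \<in> topspace ?P. jproj z \<in> {p \<in> topspace ?W. 0 < jt p \<and> jx p \<in> U}} =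
        {z \<in> topspace ?P. 0 < snd (snd z)} \<inter> {z \<in> topspace ?P. fst z \<in> U}"
      by (auto simp: top jproj_def jset_def split: if_splits)
    then show "openin ?P {z \<in> topspace ?P. jproj z \<in> {p \<in> topspace ?W. 0 < jt p \<and> jx p \<in> U}}"
      by (simp only:) (intro openin_Int openin_subset_Int_vimage(1)[OF t_cont]
          openin_continuous_map_preimage[OF continuous_map_fst that])
  qed auto
  show "openin ?W {p \<in> topspace ?W. jt p < 1 \<and> jy p \<in> U}" if "openin Y U" for U
  proof (rule qopen)
    have "{z \<in> topspace ?P. jproj z \<in> {p \<in> topspace ?W. jt p < 1 \<and> jy p \<in> U}} =
        {z \<in> topspace ?P. snd (snd z) < 1} \<inter> {z \<in> topspace ?P. fst (snd z) \<in> U}"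
      by (auto simp: top jproj_def jset_def split: if_splits)
    then show "openin ?P {z \<in> topspace ?P. jproj z \<in> {p \<in> topspace ?W. jt p < 1 \<and> jy p \<in> U}}"
      by (simp only:) (intro openin_Int openin_subset_Int_vimage(2)[OF t_cont]
          openin_continuous_map_preimage[OF continuous_map_fst_in[OF continuous_map_snd] that])
  qed auto
  show "continuous_map (prod_topology ?W ?I) ?W (jmove \<psi>)" if \<psi>: "reparam \<psi>" for \<psi>
  proof -
    let ?T = "prod_topology ?P ?I"
    \<comment> \<open>The product of a quotient map with a locally compact Hausdorff space is again
      a quotient map, so continuity on \<open>W \<times> [0,1]\<close> can be tested on the
      cylinder.\<close>
    have "compact_space ?I"
      by (simp add: compact_space_subtopology)
    then have "locally_compact_space ?I"
      by (intro compact_imp_locally_compact_space)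
    then have qq: "quotient_map ?T (prod_topology ?W ?I) (\<lambda>(z, s). (jproj z, s))"
      by (intro quotient_map_prod_left q) (auto simp: Hausdorff_space_subtopology)
    have "continuous_map ?T ?I (\<lambda>z. (1 - snd z) * snd (snd (fst z)) + snd z * \<psi> (snd (snd (fst z))))"
      by (intro reparam_homotopy_cont[OF \<psi>] continuous_map_snd continuous_map_snd_in[OF continuous_map_snd_in[OF continuous_map_fst]])
    then have "continuous_map ?T ?P (\<lambda>z. (fst (fst z), fst (snd (fst z)),
        (1 - snd z) * snd (snd (fst z)) + snd z * \<psi> (snd (snd (fst z)))))" (is "continuous_map _ _ ?m")
      unfolding continuous_map_pairwise comp_def fst_conv snd_conv
      by (intro conjI continuous_map_fst_in[OF continuous_map_fst]
          continuous_map_fst_in[OF continuous_map_snd_in[OF continuous_map_fst]])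
    from continuous_map_compose[OF this quotient_imp_continuous_map[OF q]]
    have "continuous_map ?T ?W (jproj \<circ> ?m)" .
    \<comment> \<open>At \<open>t = 0\<close> and \<open>t = 1\<close> this uses that
      \<open>\<psi>\<close> fixes the ends; so the motion of the cylinder covers
      \<open>jmove \<psi>\<close>.\<close>
    moreover have "jproj \<circ> ?m = jmove \<psi> \<circ> (\<lambda>(z, s). (jproj z, s))"
      using \<psi> by (auto simp: jmove_def jproj_def reparam_def)
    ultimately show ?thesis
      using continuous_compose_quotient_map[OF qq] by simp
  qed
qed

section \<open>Relative homology of products and joins\<close>

definition rcyc :: "nat \<Rightarrow> 'a topology \<Rightarrow> 'a set \<Rightarrow> ('a, 'g::ab_group_add) gchain set" where
  "rcyc n X S = {c \<in> gchains n X. gbd n c \<in> gchains (n - 1) (subtopology X S)}"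

definition rbd :: "nat \<Rightarrow> 'a topology \<Rightarrow> 'a set \<Rightarrow> ('a, 'g::ab_group_add) gchain set" where
  "rbd n X S = {gbd (Suc n) d + e | d e. d \<in> gchains (Suc n) X \<and> e \<in> gchains n (subtopology X S)}"

lemma rel_hom_nonneg: "q \<ge> 0 \<Longrightarrow> rel_hom sc q X S = quot_mod (gscale sc) (rcyc (nat q) X S) (rbd (nat q) X S)"
  by (simp add: rel_hom_def rcyc_def rbd_def Let_def)

lemma rcycD: "c \<in> rcyc n X S \<Longrightarrow> c \<in> gchains n X" "c \<in> rcyc n X S \<Longrightarrow> gbd n c \<in> gchains (n - 1) (subtopology X S)"
  by (auto simp: rcyc_def)

lemma gchains_sub: "c \<in> gchains n (subtopology X S) \<Longrightarrow> c \<in> gchains n X"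
  by (simp add: gchains_subtopology_iff)

lemma rbd_gbd: "d \<in> gchains (Suc n) X \<Longrightarrow> gbd (Suc n) d \<in> rbd n X S"
  unfolding rbd_def by (rule CollectI, rule exI[of _ d], rule exI[of _ 0]) simp

lemma rbd_sub: "e \<in> gchains n (subtopology X S) \<Longrightarrow> e \<in> rbd n X S"
  unfolding rbd_def by (rule CollectI, rule exI[of _ 0], rule exI[of _ e]) simp

lemma rbdE:
  assumes "c \<in> rbd n X S"
  obtains d e where "c = gbd (Suc n) d + e" "d \<in> gchains (Suc n) X" "e \<in> gchains n (subtopology X S)"
  using assms unfolding rbd_def by blast

lemma rbd_add: "a \<in> rbd n X S \<Longrightarrow> b \<in> rbd n X S \<Longrightarrow> a + b \<in> rbd n X S"
proof -
  assume "a \<in> rbd n X S" "b \<in> rbd n X S"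
  then obtain d e d' e' where "a = gbd (Suc n) d + e" "b = gbd (Suc n) d' + e'"
    and "d \<in> gchains (Suc n) X" "e \<in> gchains n (subtopology X S)"
    and "d' \<in> gchains (Suc n) X" "e' \<in> gchains n (subtopology X S)"
    by (elim rbdE)
  then show ?thesis
    unfolding rbd_def
    by (intro CollectI exI[of _ "d + d'"] exI[of _ "e + e'"])
      (simp add: gbd_add gchains_fsupp gchains_add algebra_simps)
qed

lemma rbd_minus: "a \<in> rbd n X S \<Longrightarrow> - a \<in> rbd n X S"
proof -
  assume "a \<in> rbd n X S"
  then obtain d e where "a = gbd (Suc n) d + e"
    and "d \<in> gchains (Suc n) X" "e \<in> gchains n (subtopology X S)"
    by (elim rbdE)
  then show ?thesis
    unfolding rbd_def
    by (intro CollectI exI[of _ "- d"] exI[of _ "- e"])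
      (simp add: gbd_minus gchains_fsupp)
qed

lemma rbd_diff: "a \<in> rbd n X S \<Longrightarrow> b \<in> rbd n X S \<Longrightarrow> a - b \<in> rbd n X S"
  using rbd_add[of a n X S "- b"] rbd_minus[of b n X S] by simp

lemma rcyc_add: "a \<in> rcyc n X S \<Longrightarrow> b \<in> rcyc n X S \<Longrightarrow> a + b \<in> rcyc n X S"
  unfolding rcyc_def by (auto simp: gbd_add gchains_fsupp intro: gchains_add)

lemma rcyc_minus: "a \<in> rcyc n X S \<Longrightarrow> - a \<in> rcyc n X S"
  unfolding rcyc_def by (auto simp: gbd_minus gchains_fsupp)

lemma rcyc_diff: "a \<in> rcyc n X S \<Longrightarrow> b \<in> rcyc n X S \<Longrightarrow> a - b \<in> rcyc n X S"
  using rcyc_add[of a n X S "- b"] rcyc_minus[of b n X S] by simp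

lemma rcyc_0 [simp]: "0 \<in> rcyc n X S" and rbd_0 [simp]: "0 \<in> rbd n X S"
  using rbd_sub[of 0 n X S] by (simp_all add: rcyc_def)

lemma module_additive: "Modules.module sc \<Longrightarrow> additive (sc r)"
  by (simp add: additive_def module.scale_right_distrib)

lemma quotient_data_rel:
  fixes sc :: "'r::comm_ring_1 \<Rightarrow> 'g::ab_group_add \<Rightarrow> 'g"
  assumes "Modules.module sc"
  shows "quotient_data (gscale sc) (rcyc n (X :: 'a topology) S) (rbd n X S)"
proof
  note add = module_additive[OF assms]
  show "gscale sc r (x + y) = gscale sc r x + gscale sc r y" for r and x y :: "('a, 'g) gchain"
    by (rule gscale_add[OF add])
  show "submod (gscale sc) (rcyc n X S)"
    unfolding submod_def
  proof (intro conjI ballI allI)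
    show "gscale sc r x \<in> rcyc n X S" if "x \<in> rcyc n X S" for r x
      using that unfolding rcyc_def by (auto simp: gscale_gbd[OF add] intro: gscale_gchains[OF add])
  qed (simp_all add: rcyc_add rcyc_minus)
  show "submod (gscale sc) (rbd n X S)"
    unfolding submod_def
  proof (intro conjI ballI allI)
    fix r and x :: "('a, 'g) gchain"
    assume "x \<in> rbd n X S"
    then obtain d e where "x = gbd (Suc n) d + e"
      and "d \<in> gchains (Suc n) X" "e \<in> gchains n (subtopology X S)"
      by (elim rbdE)
    then show "gscale sc r x \<in> rbd n X S"
      unfolding rbd_def
      by (intro CollectI exI[of _ "gscale sc r d"] exI[of _ "gscale sc r e"])
        (simp add: gscale_gbd[OF add] gscale_gchains[OF add] gscale_add[OF add])
  qed (simp_all add: rbd_add rbd_minus)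
qed

lemma zero_mod_trivial:
  fixes sc :: "'r::comm_ring_1 \<Rightarrow> 'g::ab_group_add \<Rightarrow> 'g"
  assumes "Modules.module sc"
  shows "mod_trivial (zero_mod sc :: ('r, ('c, 'g) gchain set) amod)"
proof -
  have "quotient_data (gscale sc) {0 :: ('c, 'g) gchain} {0}"
  proof
    show "gscale sc r (x + y) = gscale sc r x + gscale sc r y" for r and x y :: "('c, 'g) gchain"
      by (rule gscale_add[OF module_additive[OF assms]])
    show "submod (gscale sc) {0 :: ('c, 'g) gchain}"
      using additive.zero[OF module_additive[OF assms]]
      by (auto simp: submod_def gscale_def zero_fun_def)
  qed
  then show ?thesis
    unfolding zero_mod_def by (intro quotient_data.quot_trivial) auto
qed

lemma continuous_map_sub:
  assumes "continuous_map S T f" "\<And>x. x \<in> topspace S \<Longrightarrow> x \<in> A \<Longrightarrow> f x \<in> B"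
  shows "continuous_map (subtopology S A) (subtopology T B) f"
  using assms by (auto simp: continuous_map_in_subtopology continuous_map_from_subtopology)

lemma gmap_sub:
  assumes "continuous_map S T f" "\<And>x. x \<in> topspace S \<Longrightarrow> x \<in> A \<Longrightarrow> f x \<in> B"
    and "c \<in> gchains n (subtopology S A)"
  shows "gmap n f c \<in> gchains n (subtopology T B)"
  using gmap_gchains[OF continuous_map_sub] assms by metis

lemma gmap_add: "a \<in> fsupp \<Longrightarrow> b \<in> fsupp \<Longrightarrow> gmap n f (a + b) = gmap n f a + gmap n f b"
  and gmap_diff: "a \<in> fsupp \<Longrightarrow> b \<in> fsupp \<Longrightarrow> gmap n f (a - b) = gmap n f a - gmap n f b"
  and gmap_minus: "a \<in> fsupp \<Longrightarrow> gmap n f (- a) = - gmap n f a"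
  and gmap_0 [simp]: "gmap n f 0 = 0"
  and fsupp_gmap: "gmap n f a \<in> fsupp"
  by (simp_all add: gmap_def glift_arg_add glift_arg_diff glift_arg_minus fsupp_glift)

lemma gprism_add: "a \<in> fsupp \<Longrightarrow> b \<in> fsupp \<Longrightarrow> gprism n H (a + b) = gprism n H a + gprism n H b"
  and gprism_diff: "a \<in> fsupp \<Longrightarrow> b \<in> fsupp \<Longrightarrow> gprism n H (a - b) = gprism n H a - gprism n H b"
  and gprism_0 [simp]: "gprism n H 0 = 0"
  and fsupp_gprism: "gprism n H a \<in> fsupp"
  by (simp_all add: gprism_def glift_arg_add glift_arg_diff fsupp_glift)

lemma gsd_add: "a \<in> fsupp \<Longrightarrow> b \<in> fsupp \<Longrightarrow> gsd N n (a + b) = gsd N n a + gsd N n b"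
  and gsd_diff: "a \<in> fsupp \<Longrightarrow> b \<in> fsupp \<Longrightarrow> gsd N n (a - b) = gsd N n a - gsd N n b"
  and fsupp_gsd: "gsd N n a \<in> fsupp"
  by (simp_all add: gsd_def glift_arg_add glift_arg_diff fsupp_glift)

lemma gmap_scale: "additive (sc r) \<Longrightarrow> c \<in> fsupp \<Longrightarrow> gmap n f (gscale sc r c) = gscale sc r (gmap n f c)"
  and gprism_scale: "additive (sc r) \<Longrightarrow> c \<in> fsupp \<Longrightarrow> gprism n H (gscale sc r c) = gscale sc r (gprism n H c)"
  by (simp_all add: gmap_def gprism_def gscale_glift)

lemma gscale_0: "additive (sc r) \<Longrightarrow> gscale sc r 0 = 0"
  by (simp add: gscale_def fun_eq_iff additive.zero)

lemma gscale_diff: "additive (sc r) \<Longrightarrow> gscale sc r (c - d) = gscale sc r c - gscale sc r d"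
  by (simp add: gscale_def fun_eq_iff additive.diff)

text \<open>Each function is constant on the parameters of one piece of the cover:
  \<open>\<psi>X\<close> is 1 from 1/3 on, \<open>\<psi>Y\<close> is 0 up to 2/3, and
  \<open>\<psi>M\<close> is 1/2 between 1/3 and 2/3. At time 1 the corresponding
  \<open>jmove\<close> thus carries \<open>U1\<close> to the copy of \<open>X\<close>,
  \<open>U2\<close> to the copy of \<open>Y\<close> and their overlap to the middle level.\<close>

definition \<psi>X :: "real \<Rightarrow> real" where "\<psi>X t = min 1 (3 * t)"
definition \<psi>Y :: "real \<Rightarrow> real" where "\<psi>Y t = max 0 (3 * t - 2)"
definition \<psi>M :: "real \<Rightarrow> real" where "\<psi>M t = max (min (3 * t / 2) (1 / 2)) ((3 * t - 1) / 2)"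

lemma reparam_\<psi>: "reparam \<psi>X" "reparam \<psi>Y" "reparam \<psi>M"
proof -
  have "continuous_on {0..1} \<psi>X" "continuous_on {0..1} \<psi>Y" "continuous_on {0..1} \<psi>M"
    unfolding \<psi>X_def \<psi>Y_def \<psi>M_def by (intro continuous_intros; simp)+
  then show "reparam \<psi>X" "reparam \<psi>Y" "reparam \<psi>M"
    by (auto simp: reparam_def \<psi>X_def \<psi>Y_def \<psi>M_def min_def max_def)
qed

text \<open>\<open>V \<subseteq> W\<close> is the part of the join swept out by \<open>Q \<subseteq> A \<times> B\<close>.  The points \<open>x0\<close> and \<open>y0\<close> provide
  sections of the two projections of pairs \<open>(X \<times> Y, Q) \<rightarrow> (X, A)\<close> and \<open>(X \<times> Y, Q) \<rightarrow> (Y, B)\<close>.\<close>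
locale join_pair = join_topology X Y W
  for X :: "'a topology" and Y :: "'b topology" and W +
  fixes A B Q x0 y0
  assumes A_le: "A \<subseteq> topspace X" and B_le: "B \<subseteq> topspace Y" and Q_le: "Q \<subseteq> A \<times> B"
    and sectionX: "A = topspace X \<or> (y0 \<in> B \<and> A \<times> {y0} \<subseteq> Q)"
    and sectionY: "B = topspace Y \<or> (x0 \<in> A \<and> {x0} \<times> B \<subseteq> Q)"
begin

definition P where "P = prod_topology X Y"
definition V where "V = JX ` A \<union> JY ` B \<union> {JM x y t | x y t. (x, y) \<in> Q \<and> 0 < t \<and> t < 1}"
text \<open>The copy of \<open>X\<close> sits at parameter 1, so \<open>U1\<close> is the end around
  \<open>X\<close> and \<open>U2\<close> the end around \<open>Y\<close>.\<close>

definition U1 where "U1 = {p \<in> topspace W. 1 / 3 < jt p}"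
definition U2 where "U2 = {p \<in> topspace W. jt p < 2 / 3}"
definition M where "M = U1 \<inter> U2"
definition mid where "mid = (\<lambda>(x, y). JM x y (1 / 2) :: ('a, 'b) joinpt)"
definition rj where "rj p = (jx p, jy p)" for p :: "('a, 'b) joinpt"

lemma V_le: "V \<subseteq> topspace W"
proof -
  have "x \<in> topspace X \<and> y \<in> topspace Y" if "(x, y) \<in> Q" for x y
    using that A_le B_le Q_le by blast
  then show ?thesis
    unfolding V_def topspace_W jset_def using A_le B_le by blast
qed

lemma openU1: "openin W U1" and openU2: "openin W U2"
  unfolding U1_def U2_def by (rule openin_subset_Int_vimage[OF jt_cont])+

lemma U_le: "U1 \<subseteq> topspace W" "U2 \<subseteq> topspace W"
  by (auto simp: U1_def U2_def)

lemma U_cover: "topspace W \<subseteq> U1 \<union> U2"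
  by (auto simp: U1_def U2_def)

lemma jx_in: "p \<in> topspace W \<Longrightarrow> 0 < jt p \<Longrightarrow> jx p \<in> topspace X"
  and jy_in: "p \<in> topspace W \<Longrightarrow> jt p < 1 \<Longrightarrow> jy p \<in> topspace Y"
  unfolding topspace_W by (auto elim: jset_cases)

lemma jx_V: "p \<in> V \<Longrightarrow> 0 < jt p \<Longrightarrow> jx p \<in> A" and jy_V: "p \<in> V \<Longrightarrow> jt p < 1 \<Longrightarrow> jy p \<in> B"
  using Q_le by (auto simp: V_def)

lemma jx_cont: "continuous_map (subtopology W U1) X jx"
  unfolding continuous_map
proof (intro conjI allI impI)
  show "jx ` topspace (subtopology W U1) \<subseteq> topspace X" 
    using jx_in by (auto simp: U1_def)
  fix U assume "openin X U"
  have "{p \<in> topspace (subtopology W U1). jx p \<in> U} = {p \<in> topspace W. 0 < jt p \<and> jx p \<in> U} \<inter> U1"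
    by (auto simp: U1_def)
  then show "openin (subtopology W U1) {p \<in> topspace (subtopology W U1). jx p \<in> U}"
    using jx_open[OF \<open>openin X U\<close>] by (auto simp: openin_subtopology)
qed

lemma jy_cont: "continuous_map (subtopology W U2) Y jy"
  unfolding continuous_map
proof (intro conjI allI impI)
  show "jy ` topspace (subtopology W U2) \<subseteq> topspace Y" 
    using jy_in by (auto simp: U2_def)
  fix U assume "openin Y U"
  have "{p \<in> topspace (subtopology W U2). jy p \<in> U} = {p \<in> topspace W. jt p < 1 \<and> jy p \<in> U} \<inter> U2"
    by (auto simp: U2_def)
  then show "openin (subtopology W U2) {p \<in> topspace (subtopology W U2). jy p \<in> U}"
    using jy_open[OF \<open>openin Y U\<close>] by (auto simp: openin_subtopology)
qed

lemma JX_cont: "continuous_map X W JX"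
proof -
  obtain y where "y \<in> topspace Y"
    using nonempty(2) by blast
  then have "continuous_map X (prod_topology X (prod_topology Y (top_of_set {0..1::real}))) (\<lambda>x. (x, y, 1))"
    by (auto simp: continuous_map_pairwise comp_def)
  from continuous_map_compose[OF this jproj_cont] show ?thesis
    by (simp add: comp_def jproj_def)
qed

lemma JY_cont: "continuous_map Y W JY"
proof -
  obtain x where "x \<in> topspace X"
    using nonempty(1) by blast
  then have "continuous_map Y (prod_topology X (prod_topology Y (top_of_set {0..1::real}))) (\<lambda>y. (x, y, 0))"
    by (auto simp: continuous_map_pairwise comp_def)
  from continuous_map_compose[OF this jproj_cont] show ?thesis
    by (simp add: comp_def jproj_def)
qed

lemma mid_cont: "continuous_map P W mid"
proof -
  have "continuous_map P (prod_topology X (prod_topology Y (top_of_set {0..1::real}))) (\<lambda>z. (fst z, snd z, 1 / 2))"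
    unfolding P_def by (auto simp: continuous_map_pairwise comp_def continuous_map_fst continuous_map_snd)
  from continuous_map_compose[OF this jproj_cont] show ?thesis
    by (simp add: comp_def jproj_def mid_def case_prod_beta')
qed

lemma mid_M: "z \<in> topspace P \<Longrightarrow> mid z \<in> M"
proof -
  assume "z \<in> topspace P"
  then have "mid z \<in> topspace W"
    using mid_cont by (auto simp: continuous_map_def)
  then show ?thesis
    by (simp add: M_def U1_def U2_def) (simp add: mid_def case_prod_beta')
qed

lemma JM_V: "(x, y) \<in> Q \<Longrightarrow> 0 < t \<Longrightarrow> t < 1 \<Longrightarrow> JM x y t \<in> V"
  unfolding V_def by blast

lemma mid_V: "z \<in> Q \<Longrightarrow> mid z \<in> V"
  using JM_V[of "fst z" "snd z" "1 / 2"] by (simp add: mid_def case_prod_beta')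

lemma rj_cont: "continuous_map (subtopology W M) P rj"
proof -
  have "continuous_map (subtopology W M) X jx" "continuous_map (subtopology W M) Y jy"
    using continuous_map_from_subtopology_mono[OF jx_cont, of M]
      continuous_map_from_subtopology_mono[OF jy_cont, of M] by (auto simp: M_def)
  then show ?thesis
    unfolding P_def rj_def by (simp add: continuous_map_pairwise comp_def)
qed

lemma rj_V: "p \<in> V \<Longrightarrow> p \<in> M \<Longrightarrow> rj p \<in> Q"
  by (auto simp: rj_def V_def M_def U1_def U2_def)

lemma in_M_cases:
  assumes "p \<in> M"
  obtains x y t where "p = JM x y t" "x \<in> topspace X" "y \<in> topspace Y" "1 / 3 < t" "t < 2 / 3"
  using assms unfolding M_def U1_def U2_def topspace_W by (auto elim!: jset_cases)

text \<open>An interior point of \<open>V\<close> may be carried to an end; it then lands in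
  \<open>JX\<close> A\<open>or\<close>JY \<open>B\<close> because \<open>Q\<close> lies in
  \<open>A \<times> B\<close>.\<close>

lemma jmove_V:
  assumes "reparam \<psi>" "p \<in> V" "s \<in> {0..1}"
  shows "jmove \<psi> (p, s) \<in> V"
proof -
  consider x where "p = JX x" "x \<in> A" | y where "p = JY y" "y \<in> B"
    | x y t where "p = JM x y t" "(x, y) \<in> Q" "0 < t" "t < 1"
    using assms(2) unfolding V_def by blast
  then show ?thesis
  proof cases
    case (3 x y t)
    have "(1 - s) * t + s * \<psi> t \<in> {0..1}"
      using 3 assms(3) reparam_range[OF assms(1), of t] by (intro convex_01) auto
    then show ?thesis
      using 3 Q_le by (auto simp: jmove_def jproj_def V_def)
  qed (auto simp: jmove_def V_def)
qed

lemma jt_jmove': "reparam \<psi> \<Longrightarrow> p \<in> topspace W \<Longrightarrow> jt (jmove \<psi> (p, s)) = (1 - s) * jt p + s * \<psi> (jt p)"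
  unfolding topspace_W by (rule jt_jmove)

lemma jmove_in_W: "reparam \<psi> \<Longrightarrow> p \<in> topspace W \<Longrightarrow> s \<in> {0..1} \<Longrightarrow> jmove \<psi> (p, s) \<in> topspace W"
  unfolding topspace_W by (rule jmove_in_jset)

text \<open>On \<open>[0,1]\<close> the function \<open>\<psi>X\<close> never lowers the parameter,
  so the motion stays above 1/3. Symmetrically, \<open>\<psi>Y\<close> never raises it.\<close>

lemma jmove_\<psi>X_U1:
  assumes "p \<in> U1" "s \<in> {0..1}"
  shows "jmove \<psi>X (p, s) \<in> U1"
proof -
  have p: "p \<in> topspace W" "1 / 3 < jt p" "jt p \<le> 1"
    using assms(1) jt_range[of p "topspace X" "topspace Y"] by (auto simp: U1_def topspace_W)
  have "s * jt p \<le> s * \<psi>X (jt p)"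
    using assms(2) p by (intro mult_left_mono) (auto simp: \<psi>X_def)
  then have "1 / 3 < (1 - s) * jt p + s * \<psi>X (jt p)"
    using p by (simp add: algebra_simps)
  then show ?thesis
    using p assms(2) by (simp add: U1_def jt_jmove'[OF reparam_\<psi>(1)] jmove_in_W[OF reparam_\<psi>(1)])
qed

lemma jmove_\<psi>Y_U2:
  assumes "p \<in> U2" "s \<in> {0..1}"
  shows "jmove \<psi>Y (p, s) \<in> U2"
proof -
  have p: "p \<in> topspace W" "jt p < 2 / 3" "0 \<le> jt p"
    using assms(1) jt_range[of p "topspace X" "topspace Y"] by (auto simp: U2_def topspace_W)
  have "s * \<psi>Y (jt p) \<le> s * jt p"
    using assms(2) p by (intro mult_left_mono) (auto simp: \<psi>Y_def)
  then have "(1 - s) * jt p + s * \<psi>Y (jt p) < 2 / 3"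
    using p by (simp add: algebra_simps)
  then show ?thesis
    using p assms(2) by (simp add: U2_def jt_jmove'[OF reparam_\<psi>(2)] jmove_in_W[OF reparam_\<psi>(2)])
qed

lemma jmove_\<psi>M_M:
  assumes "p \<in> M" "s \<in> {0..1}"
  shows "jmove \<psi>M (p, s) \<in> M"
proof -
  have p: "p \<in> topspace W" "1 / 3 < jt p" "jt p < 2 / 3"
    using assms(1) by (auto simp: M_def U1_def U2_def)
  have half: "\<psi>M (jt p) = 1 / 2"
    using p by (auto simp: \<psi>M_def min_def max_def field_simps)
  have "1 / 3 < (1 - s) * jt p + s * (1 / 2)"
  \<comment> \<open>At \<open>s = 1\<close> the weight of \<open>jt p\<close> is 0 and strict
    monotonicity is lost, but the value is then exactly 1/2.\<close>
  proof (cases "s = 1")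
    case False
    then have "(1 - s) * (1 / 3) < (1 - s) * jt p"
      using assms(2) p by (intro mult_strict_left_mono) auto
    then show ?thesis
      using assms(2) unfolding left_diff_distrib atLeastAtMost_iff by linarith
  qed auto
  moreover have "(1 - s) * jt p + s * (1 / 2) < 2 / 3"
  proof (cases "s = 1")
    case False
    then have "(1 - s) * jt p < (1 - s) * (2 / 3)"
      using assms(2) p by (intro mult_strict_left_mono) auto
    then show ?thesis
      using assms(2) unfolding left_diff_distrib atLeastAtMost_iff by linarith
  qed auto
  ultimately show ?thesis
    using p assms(2)
    by (simp add: M_def U1_def U2_def jt_jmove'[OF reparam_\<psi>(3)] half jmove_in_W[OF reparam_\<psi>(3)])
qed

lemma jmove_\<psi>X_1: "p \<in> U1 \<Longrightarrow> jmove \<psi>X (p, 1) = JX (jx p)"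
  and jmove_\<psi>Y_1: "p \<in> U2 \<Longrightarrow> jmove \<psi>Y (p, 1) = JY (jy p)"
  unfolding U1_def U2_def topspace_W
  by (auto elim!: jset_cases simp: jmove_def jproj_def \<psi>X_def \<psi>Y_def)

lemma jmove_\<psi>M_1: "p \<in> M \<Longrightarrow> jmove \<psi>M (p, 1) = mid (rj p)"
proof (elim in_M_cases)
  fix x y t assume "p = JM x y t" "1 / 3 < t" "t < 2 / 3"
  moreover from this have "\<psi>M t = 1 / 2"
    by (auto simp: \<psi>M_def min_def max_def field_simps)
  ultimately show "jmove \<psi>M (p, 1) = mid (rj p)"
    by (simp add: jmove_def jproj_def mid_def rj_def)
qed

lemma jmove_0: "p \<in> topspace W \<Longrightarrow> jmove \<psi> (p, 0) = p"
  unfolding topspace_W by (auto elim!: jset_cases simp: jmove_def jproj_def)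

section \<open>Homotopies of the join acting on chains\<close>

abbreviation E where "E \<psi> n \<equiv> gprism n (jmove \<psi>)"

lemma E_in_sub:
  assumes \<psi>: "reparam \<psi>" and S: "\<And>p s. p \<in> S \<Longrightarrow> p \<in> topspace W \<Longrightarrow> s \<in> {0..1} \<Longrightarrow> jmove \<psi> (p, s) \<in> S'"
    and c: "c \<in> gchains n (subtopology W S)"
  shows "E \<psi> n c \<in> gchains (Suc n) (subtopology W S')"
proof (rule gprism_gchains[OF _ c])
  have "continuous_map (prod_topology (subtopology W S) (top_of_set {0..1::real})) (prod_topology W (top_of_set {0..1})) id"
    by (auto simp: continuous_map_pairwise comp_def continuous_map_snd
        intro: continuous_map_into_fulltopology[OF continuous_map_fst])
  from continuous_map_compose[OF this jmove_cont[OF \<psi>]] show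
    "continuous_map (prod_topology (subtopology W S) (top_of_set {0..1})) (subtopology W S') (jmove \<psi>)"
    using S by (auto simp: continuous_map_in_subtopology)
qed

lemma E_in_W: "reparam \<psi> \<Longrightarrow> c \<in> gchains n W \<Longrightarrow> E \<psi> n c \<in> gchains (Suc n) W"
  by (rule gprism_gchains[OF jmove_cont])

lemma gbd_E:
  assumes "c \<in> gchains n W"
  shows "gbd (Suc n) (E \<psi> n c) = gmap n (\<lambda>p. jmove \<psi> (p, 1)) c - c - E \<psi> (n - 1) (gbd n c)"
  using gbd_gprism[OF assms, of "jmove \<psi>"] gmap_ident[OF assms, of "\<lambda>p. jmove \<psi> (p, 0)"]
  by (simp add: jmove_0)

text \<open>Degree 0 is separated because \<open>Suc (n - 1)\<close> is then 1 instead of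
  \<open>n\<close>; the boundary, and with it its prism, is 0 there.\<close>

lemma E_gbd_in:
  assumes "reparam \<psi>" "\<And>p s. p \<in> S \<Longrightarrow> p \<in> topspace W \<Longrightarrow> s \<in> {0..1} \<Longrightarrow> jmove \<psi> (p, s) \<in> S'"
    and "gbd n c \<in> gchains (n - 1) (subtopology W S)"
  shows "E \<psi> (n - 1) (gbd n c) \<in> gchains n (subtopology W S')"
  using E_in_sub[OF assms(1,2,3)] by (cases n) auto

lemma gmap_\<psi>X_1: "c \<in> gchains n (subtopology W U1) \<Longrightarrow>
    gmap n (\<lambda>p. jmove \<psi>X (p, 1)) c = gmap n JX (gmap n jx c)"
  and gmap_\<psi>Y_1: "c \<in> gchains n (subtopology W U2) \<Longrightarrow>
    gmap n (\<lambda>p. jmove \<psi>Y (p, 1)) c = gmap n JY (gmap n jy c)"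
  and gmap_\<psi>M_1: "c \<in> gchains n (subtopology W M) \<Longrightarrow>
    gmap n (\<lambda>p. jmove \<psi>M (p, 1)) c = gmap n mid (gmap n rj c)"
  unfolding gmap_gmap
  by (erule gmap_cong; simp add: jmove_\<psi>X_1 jmove_\<psi>Y_1 jmove_\<psi>M_1)+

lemma gmap_mid:
  assumes "z \<in> gchains n P"
  shows "gmap n mid z \<in> gchains n (subtopology W M)"
    and "gmap n jx (gmap n mid z) = gmap n fst z" "gmap n jy (gmap n mid z) = gmap n snd z"
    and "gmap n rj (gmap n mid z) = z"
proof -
  show "gmap n mid z \<in> gchains n (subtopology W M)"
    using gmap_gchains[of P "subtopology W M" mid z] mid_cont mid_M assms
    by (auto simp: continuous_map_in_subtopology)
  show "gmap n jx (gmap n mid z) = gmap n fst z" "gmap n jy (gmap n mid z) = gmap n snd z"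
    unfolding gmap_gmap by (rule gmap_cong[OF assms]; auto simp: mid_def)+
  show "gmap n rj (gmap n mid z) = z"
    unfolding gmap_gmap by (rule gmap_ident[OF assms]) (auto simp: mid_def rj_def)
qed

lemma gmap_mid_Q: "z \<in> gchains n (subtopology P Q) \<Longrightarrow> gmap n mid z \<in> gchains n (subtopology W (V \<inter> M))"
  using mid_M mid_V by (intro gmap_sub[OF mid_cont]) auto

lemma gmap_rj: "c \<in> gchains n (subtopology W M) \<Longrightarrow> gmap n rj c \<in> gchains n P"
  by (rule gmap_gchains[OF rj_cont])

lemma gmap_rj_V: "c \<in> gchains n (subtopology W (V \<inter> M)) \<Longrightarrow> gmap n rj c \<in> gchains n (subtopology P Q)"
  using gmap_sub[OF rj_cont, of V Q c n] rj_V by (simp add: subtopology_subtopology Int_commute)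

lemma gmap_jx: "c \<in> gchains n (subtopology W U1) \<Longrightarrow> gmap n jx c \<in> gchains n X"
  and gmap_jy: "c \<in> gchains n (subtopology W U2) \<Longrightarrow> gmap n jy c \<in> gchains n Y"
  by (auto intro: gmap_gchains jx_cont jy_cont)

lemma gmap_jx_V: "c \<in> gchains n (subtopology W (V \<inter> U1)) \<Longrightarrow> gmap n jx c \<in> gchains n (subtopology X A)"
  using gmap_sub[OF jx_cont, of V A c n] jx_V
  by (simp add: subtopology_subtopology Int_commute U1_def)

lemma gmap_jy_V: "c \<in> gchains n (subtopology W (V \<inter> U2)) \<Longrightarrow> gmap n jy c \<in> gchains n (subtopology Y B)"
  using gmap_sub[OF jy_cont, of V B c n] jy_V
  by (simp add: subtopology_subtopology Int_commute U2_def)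

lemma gmap_JX_A: "c \<in> gchains n (subtopology X A) \<Longrightarrow> gmap n JX c \<in> gchains n (subtopology W (V \<inter> U1))"
  using A_le by (intro gmap_sub[OF JX_cont]) (auto simp: V_def U1_def topspace_W jset_def)

lemma gmap_JY_B: "c \<in> gchains n (subtopology Y B) \<Longrightarrow> gmap n JY c \<in> gchains n (subtopology W (V \<inter> U2))"
  using B_le by (intro gmap_sub[OF JY_cont]) (auto simp: V_def U2_def topspace_W jset_def)

lemma gmap_JX_V: "c \<in> gchains n (subtopology X A) \<Longrightarrow> gmap n JX c \<in> gchains n (subtopology W V)"
  and gmap_JY_V: "c' \<in> gchains n (subtopology Y B) \<Longrightarrow> gmap n JY c' \<in> gchains n (subtopology W V)"
  using gmap_JX_A gmap_JY_B gchains_subtopology_mono by blast+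

lemma gmap_fst: "c \<in> gchains n P \<Longrightarrow> gmap n fst c \<in> gchains n X"
  and gmap_snd: "c \<in> gchains n P \<Longrightarrow> gmap n snd c \<in> gchains n Y"
  unfolding P_def by (auto intro: gmap_gchains continuous_map_fst continuous_map_snd)

lemma gmap_fst_Q: "c \<in> gchains n (subtopology P Q) \<Longrightarrow> gmap n fst c \<in> gchains n (subtopology X A)"
  and gmap_snd_Q: "c \<in> gchains n (subtopology P Q) \<Longrightarrow> gmap n snd c \<in> gchains n (subtopology Y B)"
  unfolding P_def using Q_le
  by (auto intro!: gmap_sub[where A = Q] continuous_map_fst continuous_map_snd)

text \<open>If \<open>A\<close> is the whole space, every chain of \<open>X\<close> is negligible
  relative to \<open>A\<close>, so the zero map is a section modulo \<open>A\<close>. When both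
  \<open>A\<close> and \<open>B\<close> are whole, \<open>T\<close> is 0 and nothing is split
  off.\<close>

definition secX where "secX n c = (if A = topspace X then 0 else gmap n (\<lambda>x. (x, y0)) c)"
definition secY where "secY n c = (if B = topspace Y then 0 else gmap n (\<lambda>y. (x0, y)) c)"
definition T where "T n a b = secX n a + secY n b"

lemma secX_cont: "A \<noteq> topspace X \<Longrightarrow> continuous_map X P (\<lambda>x. (x, y0))"
  and secY_cont: "B \<noteq> topspace Y \<Longrightarrow> continuous_map Y P (\<lambda>y. (x0, y))"
  unfolding P_def using sectionX sectionY A_le B_le by (auto simp: continuous_map_pairwise comp_def)

lemma T_in: "a \<in> gchains n X \<Longrightarrow> b \<in> gchains n Y \<Longrightarrow> T n a b \<in> gchains n P"
  unfolding T_def secX_def secY_def by (auto intro!: gchains_add gmap_gchains secX_cont secY_cont)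

lemma T_in_Q:
  assumes "a \<in> gchains n (subtopology X A)" "b \<in> gchains n (subtopology Y B)"
  shows "T n a b \<in> gchains n (subtopology P Q)"
proof -
  have "secX n a \<in> gchains n (subtopology P Q)"
    unfolding secX_def using assms(1) sectionX
    by (cases "A = topspace X") (auto intro!: gmap_sub[OF secX_cont, where A = A])
  moreover have "secY n b \<in> gchains n (subtopology P Q)"
    unfolding secY_def using assms(2) sectionY
    by (cases "B = topspace Y") (auto intro!: gmap_sub[OF secY_cont, where A = B])
  ultimately show ?thesis
    unfolding T_def by (rule gchains_add)
qed

lemma T_diff: "a \<in> fsupp \<Longrightarrow> b \<in> fsupp \<Longrightarrow> a' \<in> fsupp \<Longrightarrow> b' \<in> fsupp \<Longrightarrow>
    T n (a - a') (b - b') = T n a b - T n a' b'"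
  unfolding T_def secX_def secY_def by (simp add: gmap_diff algebra_simps)

lemma T_add: "a \<in> fsupp \<Longrightarrow> b \<in> fsupp \<Longrightarrow> a' \<in> fsupp \<Longrightarrow> b' \<in> fsupp \<Longrightarrow>
    T n (a + a') (b + b') = T n a b + T n a' b'"
  unfolding T_def secX_def secY_def by (simp add: gmap_add algebra_simps)

lemma T_scale: "additive (sc r) \<Longrightarrow> a \<in> fsupp \<Longrightarrow> b \<in> fsupp \<Longrightarrow>
    T n (gscale sc r a) (gscale sc r b) = gscale sc r (T n a b)"
  unfolding T_def secX_def secY_def
  by (simp add: gmap_scale gscale_add) (simp add: gscale_def fun_eq_iff additive.zero)

lemma gbd_T:
  assumes "a \<in> gchains n X" "b \<in> gchains n Y"
  shows "gbd n (T n a b) = T (n - 1) (gbd n a) (gbd n b)"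
proof -
  have "secX n a \<in> fsupp" "secY n b \<in> fsupp"
    by (auto simp: secX_def secY_def fsupp_gmap)
  then show ?thesis
    unfolding T_def by (simp add: gbd_add) (simp add: secX_def secY_def gbd_gmap[OF assms(1)] gbd_gmap[OF assms(2)])
qed

text \<open>Under the first projection the \<open>X\<close>-section returns \<open>a\<close>, while
  the \<open>Y\<close>-section becomes constant at \<open>x0\<close>, a point of \<open>A\<close>.
  So \<open>T\<close> is a common section of both projections up to chains of \<open>A\<close> and
  \<open>B\<close>.\<close>

lemma gmap_fst_T:
  assumes a: "a \<in> gchains n X" and b: "b \<in> gchains n Y"
  shows "gmap n fst (T n a b) - a \<in> gchains n (subtopology X A)"
proof (cases "A = topspace X")
  case True
  then show ?thesis
    using gmap_fst[OF T_in[OF a b]] a by (simp add: gchains_diff)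
next
  case False
  have "gmap n fst (secX n a) = a"
    unfolding secX_def gmap_gmap using False by (simp add: gmap_gmap) (rule gmap_ident[OF a], simp)
  moreover have "gmap n fst (secY n b) \<in> gchains n (subtopology X A)"
  proof (cases "B = topspace Y")
    case False
    then have "x0 \<in> A" using sectionY by blast
    then have "continuous_map Y (subtopology X A) (\<lambda>_. x0)"
      using A_le by (auto simp: continuous_map_in_subtopology)
    from gmap_gchains[OF this b] show ?thesis
      using False by (simp add: secY_def gmap_gmap)
  next
    case True
    then have "secY n b = 0"
      unfolding secY_def by (rule if_P)
    then show ?thesis by simp
  qed
  ultimately show ?thesis
    unfolding T_def by (simp add: gmap_add secX_def secY_def fsupp_gmap)
qed

lemma gmap_snd_T:
  assumes a: "a \<in> gchains n X" and b: "b \<in> gchains n Y"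
  shows "gmap n snd (T n a b) - b \<in> gchains n (subtopology Y B)"
proof (cases "B = topspace Y")
  case True
  then show ?thesis
    using gmap_snd[OF T_in[OF a b]] b by (simp add: gchains_diff)
next
  case False
  have "gmap n snd (secY n b) = b"
    unfolding secY_def gmap_gmap using False by (simp add: gmap_gmap) (rule gmap_ident[OF b], simp)
  moreover have "gmap n snd (secX n a) \<in> gchains n (subtopology Y B)"
  proof (cases "A = topspace X")
    case False
    then have "y0 \<in> B" using sectionX by blast
    then have "continuous_map X (subtopology Y B) (\<lambda>_. y0)"
      using B_le by (auto simp: continuous_map_in_subtopology)
    from gmap_gchains[OF this a] show ?thesis
      using False by (simp add: secX_def gmap_gmap)
  next
    case True
    then have "secX n a = 0"
      unfolding secX_def by (rule if_P)
    then show ?thesis by simp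
  qed
  ultimately show ?thesis
    unfolding T_def by (simp add: gmap_add secX_def secY_def fsupp_gmap)
qed

end

lemma combine_end_chains:
  "a = u - e1 \<Longrightarrow> b = v - e2 \<Longrightarrow> k = x - y \<Longrightarrow> x = x' + u \<Longrightarrow> y = y' - v \<Longrightarrow>
    a + b = k - x' + y' - e1 - e2" for a :: "'m::ab_group_add"
  by (simp add: algebra_simps)

lemma cancel_middle: "u = a - b - c - v \<Longrightarrow> b + u = a - c - v" for a :: "'m::ab_group_add"
  by simp

section \<open>The spanning chain and the Mayer--Vietoris argument\<close>

context join_pair begin

text \<open>The prism swept by \<open>z\<close> from the \<open>Y\<close> end to the
  \<open>X\<close> end of the join, built from the two halves that start at the middle level. It
  inverts the connecting map of the Mayer--Vietoris sequence.\<close>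

definition K where "K n z = E \<psi>X n (gmap n mid z) - E \<psi>Y n (gmap n mid z)"
text \<open>Removes from \<open>z\<close> the part seen by the two projections: those of
  \<open>S n z\<close> lie in \<open>A\<close> and \<open>B\<close> already as chains.\<close>

definition S where "S n z = z - T n (gmap n fst z) (gmap n snd z)"

lemma K_in: "z \<in> gchains n P \<Longrightarrow> K n z \<in> gchains (Suc n) W"
  unfolding K_def using gchains_sub[OF gmap_mid(1)] by (intro gchains_diff E_in_W reparam_\<psi>)

lemma K_in_V: "z \<in> gchains n (subtopology P Q) \<Longrightarrow> K n z \<in> gchains (Suc n) (subtopology W V)"
  unfolding K_def
  using gmap_mid_Q jmove_V reparam_\<psi>
  by (intro gchains_diff E_in_sub[where S = "V \<inter> M"]) auto

lemma K_0 [simp]: "K n 0 = 0"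
  by (simp add: K_def)

lemma K_diff: "a \<in> fsupp \<Longrightarrow> b \<in> fsupp \<Longrightarrow> K n (a - b) = K n a - K n b"
  by (simp add: K_def gmap_diff gprism_diff fsupp_gmap algebra_simps)

lemma K_add: "a \<in> fsupp \<Longrightarrow> b \<in> fsupp \<Longrightarrow> K n (a + b) = K n a + K n b"
  by (simp add: K_def gmap_add gprism_add fsupp_gmap algebra_simps)

lemma K_scale: "additive (sc r) \<Longrightarrow> c \<in> fsupp \<Longrightarrow> K n (gscale sc r c) = gscale sc r (K n c)"
  by (simp add: K_def gmap_scale gprism_scale fsupp_gmap gscale_diff)

text \<open>Each half contributes its end minus the middle level; the middle levels cancel in the
  difference.\<close>

lemma gbd_K:
  assumes z: "z \<in> gchains n P"
  shows "gbd (Suc n) (K n z) = gmap n JX (gmap n fst z) - gmap n JY (gmap n snd z) - K (n - 1) (gbd n z)"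
proof -
  let ?m = "gmap n mid z"
  note m = gmap_mid[OF z]
  have W: "?m \<in> gchains n W" and m1: "?m \<in> gchains n (subtopology W U1)" and m2: "?m \<in> gchains n (subtopology W U2)"
    using gchains_sub[OF m(1)] gchains_subtopology_mono[OF m(1)] by (auto simp: M_def)
  have "gbd (Suc n) (K n z) = gbd (Suc n) (E \<psi>X n ?m) - gbd (Suc n) (E \<psi>Y n ?m)"
    unfolding K_def by (rule gbd_diff; rule fsupp_gprism)
  also have "\<dots> = gmap n JX (gmap n fst z) - gmap n JY (gmap n snd z)
      - (E \<psi>X (n - 1) (gbd n ?m) - E \<psi>Y (n - 1) (gbd n ?m))"
    unfolding gbd_E[OF W] gmap_\<psi>X_1[OF m1] gmap_\<psi>Y_1[OF m2] m by (simp add: algebra_simps)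
  finally show ?thesis
    unfolding K_def gbd_gmap[OF z] .
qed

text \<open>The ends are open in \<open>W\<close>, so their traces are open in any subspace. This
  allows chains of \<open>V\<close> to be cut as well, with both pieces remaining in
  \<open>V\<close>.\<close>

lemma gsd_small_sub:
  assumes c: "c \<in> gchains n (subtopology W R)" and R: "R \<subseteq> topspace W"
  shows "\<exists>N. \<forall>k\<ge>N. \<exists>c1\<in>gchains n (subtopology W (R \<inter> U1)). \<exists>c2\<in>gchains n (subtopology W (R \<inter> U2)).
    gsd k n c = c1 + c2"
proof -
  let ?R = "subtopology W R"
  have "openin ?R (R \<inter> U1)" "openin ?R (R \<inter> U2)"
    using openU1 openU2 by (auto intro: openin_subtopology_Int2)
  moreover have "topspace ?R \<subseteq> (R \<inter> U1) \<union> (R \<inter> U2)"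
    using U_cover R by auto
  ultimately have "\<exists>N. \<forall>k\<ge>N. \<exists>c1\<in>gchains n (subtopology ?R (R \<inter> U1)). \<exists>c2\<in>gchains n (subtopology ?R (R \<inter> U2)).
      gsd k n c = c1 + c2"
    by (rule gsd_small[OF _ _ _ c])
  then show ?thesis
    by (simp add: subtopology_subtopology Int_left_absorb)
qed

lemma gsd_small_W:
  assumes c: "c \<in> gchains n W"
  shows "\<exists>N. \<forall>k\<ge>N. \<exists>c1\<in>gchains n (subtopology W U1). \<exists>c2\<in>gchains n (subtopology W U2).
    gsd k n c = c1 + c2"
  using gsd_small_sub[of c n "topspace W"] c U_le by (simp add: Int_absorb1)

lemma gchains_U_V_M:
  assumes "c \<in> gchains n (subtopology W (V \<inter> U1))" "c \<in> gchains n (subtopology W (V \<inter> U2))"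
  shows "c \<in> gchains n (subtopology W (V \<inter> M))"
  using gchains_subtopology_Int[OF assms] by (rule gchains_subtopology_mono) (auto simp: M_def)

text \<open>Injectivity by a Mayer--Vietoris argument: after subdivision the two halves of a null-homology of
  \<open>K n z\<close> differ over \<open>M\<close> by a null-homology of \<open>z\<close>.\<close>
lemma K_null_imp_null:
  fixes z :: "('a \<times> 'b, 'g::ab_group_add) gchain"
  assumes z: "z \<in> rcyc n P Q" and zX: "gmap n fst z \<in> gchains n (subtopology X A)" and Kz: "K n z \<in> rbd (Suc n) W V"
  shows "z \<in> rbd n P Q"
proof -
  obtain w v where Kw: "K n z = gbd (Suc (Suc n)) w + v" and w: "w \<in> gchains (Suc (Suc n)) W"
    and v: "v \<in> gchains (Suc n) (subtopology W V)"
    using Kz by (elim rbdE)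
  note zP = rcycD(1)[OF z]
  define \<mu> where "\<mu> = gmap n mid z"
  have \<mu>: "\<mu> \<in> gchains n (subtopology W M)" and rj\<mu>: "gmap n rj \<mu> = z"
    and jx\<mu>: "gmap n jx \<mu> = gmap n fst z"
    unfolding \<mu>_def using gmap_mid[OF zP] by auto
  have \<mu>1: "\<mu> \<in> gchains n (subtopology W U1)" and \<mu>2: "\<mu> \<in> gchains n (subtopology W U2)"
    using gchains_subtopology_mono[OF \<mu>] by (auto simp: M_def)
  have bd\<mu>: "gbd n \<mu> \<in> gchains (n - 1) (subtopology W (V \<inter> M))"
    unfolding \<mu>_def gbd_gmap[OF zP] by (rule gmap_mid_Q[OF rcycD(2)[OF z]])
  obtain N1 where N1: "\<And>k. N1 \<le> k \<Longrightarrow> \<exists>c1\<in>gchains (Suc (Suc n)) (subtopology W U1).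
      \<exists>c2\<in>gchains (Suc (Suc n)) (subtopology W U2). gsd k (Suc (Suc n)) w = c1 + c2"
    using gsd_small_W[OF w] by metis
  obtain N2 where N2: "\<And>k. N2 \<le> k \<Longrightarrow> \<exists>c1\<in>gchains (Suc n) (subtopology W (V \<inter> U1)).
      \<exists>c2\<in>gchains (Suc n) (subtopology W (V \<inter> U2)). gsd k (Suc n) v = c1 + c2"
    using gsd_small_sub[OF v V_le] by metis
  \<comment> \<open>One exponent for both chains, because the equation \<open>Kw\<close> is
    subdivided as a whole.\<close>
  define N where "N = max N1 N2"
  obtain w1 w2 where w1: "w1 \<in> gchains (Suc (Suc n)) (subtopology W U1)"
    and w2: "w2 \<in> gchains (Suc (Suc n)) (subtopology W U2)" and w12: "gsd N (Suc (Suc n)) w = w1 + w2"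
    using N1[of N] by (auto simp: N_def)
  obtain v1 v2 where v1: "v1 \<in> gchains (Suc n) (subtopology W (V \<inter> U1))"
    and v2: "v2 \<in> gchains (Suc n) (subtopology W (V \<inter> U2))" and v12: "gsd N (Suc n) v = v1 + v2"
    using N2[of N] by (auto simp: N_def)
  obtain h where h: "\<And>n R (c :: (('a, 'b) joinpt, 'g) gchain). c \<in> gchains n R \<Longrightarrow> h n c \<in> gchains (Suc n) R"
    "\<And>n R c. c \<in> gchains n R \<Longrightarrow> gbd (Suc n) (h n c) + h (n - 1) (gbd n c) = gsd N n c - c"
    using gsd_homotopy[where N = N] by metis
  let ?EX = "E \<psi>X n \<mu>" and ?EY = "E \<psi>Y n \<mu>"
  have EX: "?EX \<in> gchains (Suc n) (subtopology W U1)"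
    by (rule E_in_sub[OF reparam_\<psi>(1) jmove_\<psi>X_U1 \<mu>1])
  have EY: "?EY \<in> gchains (Suc n) (subtopology W U2)"
    by (rule E_in_sub[OF reparam_\<psi>(2) jmove_\<psi>Y_U2 \<mu>2])
  \<comment> \<open>The subdivided equation \<open>Kw\<close> with the terms supported in the
    \<open>X\<close> end collected on one side. By \<open>u'\<close> the same chain is written with
    terms of the \<open>Y\<close> end, so it lives in the overlap \<open>M\<close>.\<close>
  define u where "u = gsd N (Suc n) ?EX - gbd (Suc (Suc n)) w1 - v1"
  have "gsd N (Suc n) ?EX - gsd N (Suc n) ?EY = gsd N (Suc n) (K n z)"
    unfolding K_def \<mu>_def by (simp only: gsd_diff fsupp_gprism)
  also have "\<dots> = gbd (Suc (Suc n)) (gsd N (Suc (Suc n)) w) + gsd N (Suc n) v"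
    unfolding Kw gbd_gsd[OF w] using w v by (simp add: gsd_add fsupp_gbd gchains_fsupp)
  also have "\<dots> = gbd (Suc (Suc n)) w1 + gbd (Suc (Suc n)) w2 + (v1 + v2)"
    unfolding w12 v12 using w1 w2 by (simp add: gbd_add gchains_fsupp)
  finally have u': "u = gsd N (Suc n) ?EY + gbd (Suc (Suc n)) w2 + v2"
    unfolding u_def by (simp add: algebra_simps)
  have v1': "v1 \<in> gchains (Suc n) (subtopology W U1)" and v2': "v2 \<in> gchains (Suc n) (subtopology W U2)"
    using gchains_subtopology_mono[OF v1] gchains_subtopology_mono[OF v2] by auto
  have "u \<in> gchains (Suc n) (subtopology W U1)"
    unfolding u_def by (intro gchains_diff gsd_gchains EX gbd_gchains_Suc w1 v1')
  moreover have "u \<in> gchains (Suc n) (subtopology W U2)"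
    unfolding u' by (intro gchains_add gsd_gchains EY gbd_gchains_Suc w2 v2')
  ultimately have u: "u \<in> gchains (Suc n) (subtopology W M)"
    unfolding M_def by (rule gchains_subtopology_Int)
  \<comment> \<open>Adding the boundary of \<open>u\<close> to the subdivided cycle leaves, by
    \<open>t'\<close>, only terms in \<open>V\<close>: here \<open>zX\<close> enters. As
    \<open>t\<close> also lives over \<open>M\<close>, it is a chain of \<open>V \<inter> M\<close>,
    so the subdivision of \<open>\<mu>\<close> is null-homologous relative to \<open>V\<close>
    within \<open>M\<close>.\<close>
  define t where "t = gsd N n \<mu> + gbd (Suc n) u"
  have bdEX: "gbd (Suc n) ?EX = gmap n JX (gmap n fst z) - \<mu> - E \<psi>X (n - 1) (gbd n \<mu>)"
    unfolding gbd_E[OF gchains_sub[OF \<mu>]] gmap_\<psi>X_1[OF \<mu>1] jx\<mu> ..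
  have "gbd (Suc n) u = gsd N n (gbd (Suc n) ?EX) - gbd (Suc n) v1"
    unfolding u_def using gbd_gbd[OF w1] gbd_gsd[OF EX, of N] w1 v1 EX
    by (simp add: gbd_diff gchains_fsupp fsupp_gbd fsupp_gsd fsupp_diff)
  also have "gsd N n (gbd (Suc n) ?EX) =
      gsd N n (gmap n JX (gmap n fst z)) - gsd N n \<mu> - gsd N n (E \<psi>X (n - 1) (gbd n \<mu>))"
    unfolding bdEX using \<mu> by (simp add: gsd_diff fsupp_diff fsupp_gmap fsupp_gprism gchains_fsupp)
  finally have t': "t = gsd N n (gmap n JX (gmap n fst z)) - gsd N n (E \<psi>X (n - 1) (gbd n \<mu>)) - gbd (Suc n) v1"
    unfolding t_def by (rule cancel_middle)
  have "E \<psi>X (n - 1) (gbd n \<mu>) \<in> gchains n (subtopology W (V \<inter> U1))"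
    using bd\<mu> jmove_V[OF reparam_\<psi>(1)] jmove_\<psi>X_U1
    by (intro E_gbd_in[OF reparam_\<psi>(1), where S = "V \<inter> M"]) (auto simp: M_def)
  then have "t \<in> gchains n (subtopology W (V \<inter> U1))"
    unfolding t' by (intro gchains_diff gsd_gchains gmap_JX_A zX gbd_gchains_Suc v1)
  moreover have "t \<in> gchains n (subtopology W M)"
    unfolding t_def by (intro gchains_add gsd_gchains \<mu> gbd_gchains_Suc u)
  ultimately have "t \<in> gchains n (subtopology W ((V \<inter> U1) \<inter> M))"
    by (rule gchains_subtopology_Int)
  then have t: "t \<in> gchains n (subtopology W (V \<inter> M))"
    by (rule gchains_subtopology_mono) auto
  have h\<mu>: "h n \<mu> \<in> gchains (Suc n) (subtopology W M)"
    by (rule h(1)[OF \<mu>])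
  define g where "g = t - h (n - 1) (gbd n \<mu>)"
  have hbd: "h (n - 1) (gbd n \<mu>) \<in> gchains n (subtopology W (V \<inter> M))"
  proof (cases n)
    case 0
    \<comment> \<open>Additivity of \<open>h\<close> is not among the properties obtained.
      Naturality for the empty subspace, which has no simplices, still forces the value at 0 to
      vanish.\<close>
    have "h 0 0 \<in> gchains (Suc 0) (subtopology W {})"
      by (rule h(1)) simp
    then have "h 0 0 = 0"
      unfolding gchains_subtopology_iff using nonempty_standard_simplex by (auto simp: fun_eq_iff)
    then show ?thesis using 0 by simp
  next
    case (Suc m)
    then show ?thesis using h(1)[OF bd\<mu>] by simp
  qed
  \<comment> \<open>The homotopy \<open>h\<close> undoes the subdivision without leaving
    \<open>M\<close>; then \<open>rj\<close> carries the equation from the overlap back to the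
    product.\<close>
  have "\<mu> = g - gbd (Suc n) (u + h n \<mu>)"
    using h(2)[OF \<mu>] u h\<mu> unfolding g_def t_def by (simp add: gbd_add gchains_fsupp algebra_simps)
  then have "gmap n rj \<mu> = gmap n rj g - gmap n rj (gbd (Suc n) (u + h n \<mu>))"
    using t hbd by (metis fsupp_diff fsupp_gbd gmap_diff gchains_fsupp g_def gchains_add[OF u h\<mu>])
  also have "gmap n rj (gbd (Suc n) (u + h n \<mu>)) = gbd (Suc n) (gmap (Suc n) rj (u + h n \<mu>))"
    using gbd_gmap[OF gchains_add[OF u h\<mu>], of rj] by simp
  finally have "z = gmap n rj g - gbd (Suc n) (gmap (Suc n) rj (u + h n \<mu>))"
    unfolding rj\<mu> .
  moreover have "gmap n rj g \<in> rbd n P Q"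
    unfolding g_def by (intro rbd_sub gmap_rj_V gchains_diff t hbd)
  moreover have "gbd (Suc n) (gmap (Suc n) rj (u + h n \<mu>)) \<in> rbd n P Q"
    by (intro rbd_gbd gmap_rj gchains_add u h\<mu>)
  ultimately show ?thesis
    using rbd_diff by metis
qed

text \<open>Cutting \<open>w\<close> into its two ends exposes a seam in the overlap, and
  \<open>z\<close> is the seam seen in the product. The projections of \<open>z\<close> bound only
  modulo \<open>A\<close> and \<open>B\<close>, by the chains \<open>a\<close> and \<open>b\<close>
  obtained from the two halves; hence the correction terms in the last claim.\<close>

lemma K_hits:
  fixes w :: "(('a, 'b) joinpt, 'g::ab_group_add) gchain"
  assumes w: "w \<in> rcyc (Suc n) W V"
  obtains z a b where "z \<in> rcyc n P Q" "a \<in> gchains (Suc n) X" "b \<in> gchains (Suc n) Y"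
    "gmap n fst z - gbd (Suc n) a \<in> gchains n (subtopology X A)"
    "gmap n snd z - gbd (Suc n) b \<in> gchains n (subtopology Y B)"
    "K n z - gmap (Suc n) JX a + gmap (Suc n) JY b - w \<in> rbd (Suc n) W V"
proof -
  note wW = rcycD(1)[OF w]
  have bdw: "gbd (Suc n) w \<in> gchains n (subtopology W V)"
    using rcycD(2)[OF w] by simp
  obtain N1 where N1: "\<And>k. N1 \<le> k \<Longrightarrow> \<exists>c1\<in>gchains (Suc n) (subtopology W U1).
      \<exists>c2\<in>gchains (Suc n) (subtopology W U2). gsd k (Suc n) w = c1 + c2"
    using gsd_small_W[OF wW] by metis
  obtain N2 where N2: "\<And>k. N2 \<le> k \<Longrightarrow> \<exists>c1\<in>gchains n (subtopology W (V \<inter> U1)).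
      \<exists>c2\<in>gchains n (subtopology W (V \<inter> U2)). gsd k n (gbd (Suc n) w) = c1 + c2"
    using gsd_small_sub[OF bdw V_le] by metis
  define N where "N = max N1 N2"
  obtain w1 w2 where w1: "w1 \<in> gchains (Suc n) (subtopology W U1)"
    and w2: "w2 \<in> gchains (Suc n) (subtopology W U2)" and w12: "gsd N (Suc n) w = w1 + w2"
    using N1[of N] by (auto simp: N_def)
  obtain v1 v2 where v1: "v1 \<in> gchains n (subtopology W (V \<inter> U1))"
    and v2: "v2 \<in> gchains n (subtopology W (V \<inter> U2))" and v12: "gsd N n (gbd (Suc n) w) = v1 + v2"
    using N2[of N] by (auto simp: N_def)
  obtain h where h: "\<And>n R (c :: (('a, 'b) joinpt, 'g) gchain). c \<in> gchains n R \<Longrightarrow> h n c \<in> gchains (Suc n) R"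
    "\<And>n R c. c \<in> gchains n R \<Longrightarrow> gbd (Suc n) (h n c) + h (n - 1) (gbd n c) = gsd N n c - c"
    using gsd_homotopy[where N = N] by metis
  have fw: "w1 \<in> fsupp" "w2 \<in> fsupp" and fv: "v1 \<in> fsupp" "v2 \<in> fsupp"
    using w1 w2 v1 v2 by (auto intro: gchains_fsupp)
  have "gbd (Suc n) w1 + gbd (Suc n) w2 = gbd (Suc n) (gsd N (Suc n) w)"
    unfolding w12 by (simp add: gbd_add fw)
  also have "\<dots> = v1 + v2"
    using gbd_gsd[OF wW, of N] v12 by simp
  finally have sum: "gbd (Suc n) w1 + gbd (Suc n) w2 = v1 + v2" .
  \<comment> \<open>The common boundary of the two halves, after removing the pieces of the boundary
    of \<open>w\<close> in \<open>V\<close>. Its two expressions place it in both ends.\<close>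
  define y where "y = v1 - gbd (Suc n) w1"
  have y': "y = gbd (Suc n) w2 - v2"
    using sum by (simp add: y_def algebra_simps)
  have "y \<in> gchains n (subtopology W U1)"
    unfolding y_def using gchains_subtopology_mono[OF v1, of U1]
    by (intro gchains_diff gbd_gchains_Suc w1) auto
  moreover have "y \<in> gchains n (subtopology W U2)"
    unfolding y' using gchains_subtopology_mono[OF v2, of U2]
    by (intro gchains_diff gbd_gchains_Suc w2) auto
  ultimately have y: "y \<in> gchains n (subtopology W M)"
    unfolding M_def by (rule gchains_subtopology_Int)
  have fy: "y \<in> fsupp"
    using y by (rule gchains_fsupp)
  have "gbd n y = gbd n v1"
    unfolding y_def using gbd_gbd[OF w1] by (simp add: gbd_diff fsupp_gbd fw fv)
  moreover have "gbd n y = - gbd n v2"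
    unfolding y' using gbd_gbd[OF w2] by (simp add: gbd_diff fsupp_gbd fw fv)
  ultimately have bdy: "gbd n y \<in> gchains (n - 1) (subtopology W (V \<inter> M))"
    using gbd_gchains[OF v1] gbd_gchains[OF v2] by (metis gchains_U_V_M gchains_minus)
  text \<open>Push the intersection \<open>y\<close> of the two halves to the middle level by a homotopy inside \<open>M\<close>.\<close>
  define F where "F = E \<psi>M n y"
  define F' where "F' = E \<psi>M (n - 1) (gbd n y)"
  have F: "F \<in> gchains (Suc n) (subtopology W M)"
    unfolding F_def by (rule E_in_sub[OF reparam_\<psi>(3) jmove_\<psi>M_M y])
  have F': "F' \<in> gchains n (subtopology W (V \<inter> M))"
    unfolding F'_def using bdy jmove_V[OF reparam_\<psi>(3)] jmove_\<psi>M_M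
    by (intro E_gbd_in[OF reparam_\<psi>(3), where S = "V \<inter> M"]) auto
  have fF: "F \<in> fsupp" "F' \<in> fsupp"
    using F F' by (auto intro: gchains_fsupp)
  define z where "z = gmap n rj y"
  define m where "m = gmap n mid z"
  have bdF: "gbd (Suc n) F = m - y - F'"
    unfolding F_def F'_def m_def z_def gbd_E[OF gchains_sub[OF y]] gmap_\<psi>M_1[OF y] ..
  have zP: "z \<in> gchains n P"
    unfolding z_def by (rule gmap_rj[OF y])
  have "gbd n z \<in> gchains (n - 1) (subtopology P Q)"
    unfolding z_def gbd_gmap[OF y] by (rule gmap_rj_V[OF bdy])
  with zP have z: "z \<in> rcyc n P Q"
    by (simp add: rcyc_def)
  have fm: "m \<in> fsupp"
    unfolding m_def by (rule fsupp_gmap)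
  \<comment> \<open>Shifting \<open>F\<close> from one half to the other leaves their sum unchanged
    but replaces the seam \<open>y\<close> by \<open>m\<close>, which lies on the middle level where
    \<open>K\<close> starts.\<close>
  define w1' where "w1' = w1 - F"
  define w2' where "w2' = w2 + F"
  define v1' where "v1' = v1 + F'"
  define v2' where "v2' = v2 - F'"
  have w1': "w1' \<in> gchains (Suc n) (subtopology W U1)" and w2': "w2' \<in> gchains (Suc n) (subtopology W U2)"
    unfolding w1'_def w2'_def
    using gchains_subtopology_mono[OF F, of U1] gchains_subtopology_mono[OF F, of U2]
    by (auto intro!: gchains_diff gchains_add w1 w2 simp: M_def)
  have v1': "v1' \<in> gchains n (subtopology W (V \<inter> U1))" and v2': "v2' \<in> gchains n (subtopology W (V \<inter> U2))"
    unfolding v1'_def v2'_def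
    using gchains_subtopology_mono[OF F', of "V \<inter> U1"] gchains_subtopology_mono[OF F', of "V \<inter> U2"]
    by (auto intro!: gchains_diff gchains_add v1 v2 simp: M_def)
  have fv': "v1' \<in> fsupp" "v2' \<in> fsupp"
    using v1' v2' by (auto intro: gchains_fsupp)
  have bdw1: "gbd (Suc n) w1' = v1' - m"
    unfolding w1'_def v1'_def using bdF y_def by (simp add: gbd_diff fw fF algebra_simps)
  have bdw2: "gbd (Suc n) w2' = v2' + m"
    unfolding w2'_def v2'_def using bdF y' by (simp add: gbd_add fw fF algebra_simps)
  have w12': "w1' + w2' = gsd N (Suc n) w"
    by (simp add: w1'_def w2'_def w12)
  \<comment> \<open>The sign compensates that \<open>m\<close> occurs negatively in the boundary of
    \<open>w1'\<close> and positively in that of \<open>w2'\<close>.\<close>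
  define a where "a = - gmap (Suc n) jx w1'"
  define b where "b = gmap (Suc n) jy w2'"
  have a: "a \<in> gchains (Suc n) X" and b: "b \<in> gchains (Suc n) Y"
    unfolding a_def b_def using gmap_jx[OF w1'] gmap_jy[OF w2'] by (simp_all only: gchains_minus_iff)
  have "gbd (Suc n) a = - gmap n jx (gbd (Suc n) w1')"
    unfolding a_def using gbd_gmap[OF w1', of jx] by (simp add: gbd_minus fsupp_gmap)
  also have "\<dots> = gmap n fst z - gmap n jx v1'"
    unfolding bdw1 using gmap_mid(2)[OF zP] by (simp add: gmap_diff fv' fm m_def[symmetric])
  finally have za: "gmap n fst z - gbd (Suc n) a = gmap n jx v1'"
    by simp
  have "gbd (Suc n) b = gmap n jy (gbd (Suc n) w2')"
    unfolding b_def using gbd_gmap[OF w2', of jy] by simp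
  also have "\<dots> = gmap n jy v2' + gmap n snd z"
    unfolding bdw2 using gmap_mid(3)[OF zP] by (simp add: gmap_add fv' fm m_def[symmetric])
  finally have zb: "gmap n snd z - gbd (Suc n) b = - gmap n jy v2'"
    by simp
  \<comment> \<open>Deform each half onto its end. The prisms over the seam \<open>m\<close> that
    remain are the two halves of \<open>K n z\<close>.\<close>
  have EX: "gbd (Suc (Suc n)) (E \<psi>X (Suc n) w1') = gmap (Suc n) JX (- a) - w1' - (E \<psi>X n v1' - E \<psi>X n m)"
    unfolding gbd_E[OF gchains_sub[OF w1']] gmap_\<psi>X_1[OF w1'] using bdw1
    by (simp add: gprism_diff fv' fm a_def)
  have EY: "gbd (Suc (Suc n)) (E \<psi>Y (Suc n) w2') = gmap (Suc n) JY b - w2' - (E \<psi>Y n v2' + E \<psi>Y n m)"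
    unfolding gbd_E[OF gchains_sub[OF w2']] gmap_\<psi>Y_1[OF w2'] using bdw2
    by (simp add: gprism_add fv' fm b_def)
  have JXa: "gmap (Suc n) JX (- a) = - gmap (Suc n) JX a"
    using a by (intro gmap_minus gchains_fsupp)
  have Kz: "K n z = E \<psi>X n m - E \<psi>Y n m"
    by (simp add: K_def m_def)
  have split: "gsd N (Suc n) w - w = gbd (Suc (Suc n)) (h (Suc n) w) + h n (gbd (Suc n) w)"
    using h(2)[OF wW] by simp
  have "K n z - gmap (Suc n) JX a + gmap (Suc n) JY b - w =
      gbd (Suc (Suc n)) (E \<psi>X (Suc n) w1') + gbd (Suc (Suc n)) (E \<psi>Y (Suc n) w2') + E \<psi>X n v1' + E \<psi>Y n v2'
      + (gmap (Suc n) JX (- a) - gmap (Suc n) JX (- a)) + (w1' + w2' - w)"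
    unfolding Kz EX EY JXa by (simp add: algebra_simps)
  then have eq: "K n z - gmap (Suc n) JX a + gmap (Suc n) JY b - w =
      gbd (Suc (Suc n)) (E \<psi>X (Suc n) w1') + gbd (Suc (Suc n)) (E \<psi>Y (Suc n) w2') + E \<psi>X n v1' + E \<psi>Y n v2'
      + (gbd (Suc (Suc n)) (h (Suc n) w) + h n (gbd (Suc n) w))"
    unfolding w12' split by simp
  have "E \<psi>X n v1' \<in> gchains (Suc n) (subtopology W V)" "E \<psi>Y n v2' \<in> gchains (Suc n) (subtopology W V)"
    using v1' v2' jmove_V[OF reparam_\<psi>(1)] jmove_V[OF reparam_\<psi>(2)]
    by (auto intro: E_in_sub[OF reparam_\<psi>(1), where S = "V \<inter> U1"] E_in_sub[OF reparam_\<psi>(2), where S = "V \<inter> U2"])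
  then have "K n z - gmap (Suc n) JX a + gmap (Suc n) JY b - w \<in> rbd (Suc n) W V"
    unfolding eq
    by (intro rbd_add rbd_gbd E_in_W reparam_\<psi> gchains_sub[OF w1'] gchains_sub[OF w2'] h(1)[OF wW])
      (auto intro!: rbd_sub h(1)[OF bdw])
  then show thesis
    using that[OF z a b] za zb gmap_jx_V[OF v1'] gmap_jy_V[OF v2'] by simp
qed

section \<open>Splitting off the two projections\<close>

lemma S_in: "z \<in> gchains n P \<Longrightarrow> S n z \<in> gchains n P"
  unfolding S_def by (intro gchains_diff T_in gmap_fst gmap_snd)

lemma S_in_Q: "z \<in> gchains n (subtopology P Q) \<Longrightarrow> S n z \<in> gchains n (subtopology P Q)"
  unfolding S_def by (intro gchains_diff T_in_Q gmap_fst_Q gmap_snd_Q)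

lemma S_add: "a \<in> fsupp \<Longrightarrow> b \<in> fsupp \<Longrightarrow> S n (a + b) = S n a + S n b"
  unfolding S_def by (simp add: gmap_add T_add fsupp_gmap algebra_simps)

lemma S_scale: "additive (sc r) \<Longrightarrow> c \<in> fsupp \<Longrightarrow> S n (gscale sc r c) = gscale sc r (S n c)"
  unfolding S_def by (simp add: gmap_scale T_scale fsupp_gmap gscale_diff)

lemma fsupp_S: "z \<in> gchains n P \<Longrightarrow> S n z \<in> fsupp"
  by (rule gchains_fsupp[OF S_in])

lemma gbd_S:
  assumes "z \<in> gchains n P"
  shows "gbd n (S n z) = S (n - 1) (gbd n z)"
  unfolding S_def using assms T_in[OF gmap_fst[OF assms] gmap_snd[OF assms]]
  by (simp add: gbd_diff gchains_fsupp gbd_T[OF gmap_fst[OF assms] gmap_snd[OF assms]]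
      gbd_gmap[OF assms[unfolded P_def]] gbd_gmap[OF assms])

lemma S_rcyc: "z \<in> rcyc n P Q \<Longrightarrow> S n z \<in> rcyc n P Q"
  unfolding rcyc_def using S_in S_in_Q by (auto simp: gbd_S)

lemma S_proj:
  assumes "z \<in> gchains n P"
  shows "gmap n fst (S n z) \<in> gchains n (subtopology X A)" "gmap n snd (S n z) \<in> gchains n (subtopology Y B)"
proof -
  note ab = gmap_fst[OF assms] gmap_snd[OF assms]
  have f: "z \<in> fsupp" "T n (gmap n fst z) (gmap n snd z) \<in> fsupp"
    using assms T_in[OF ab] by (auto intro: gchains_fsupp)
  have "gmap n fst (S n z) = - (gmap n fst (T n (gmap n fst z) (gmap n snd z)) - gmap n fst z)"
    "gmap n snd (S n z) = - (gmap n snd (T n (gmap n fst z) (gmap n snd z)) - gmap n snd z)"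
    unfolding S_def by (simp_all add: gmap_diff f)
  then show "gmap n fst (S n z) \<in> gchains n (subtopology X A)" "gmap n snd (S n z) \<in> gchains n (subtopology Y B)"
    using gmap_fst_T[OF ab] gmap_snd_T[OF ab] by (simp_all only: gchains_minus_iff)
qed

text \<open>What \<open>S\<close> removes is \<open>T\<close> of the projections of
  \<open>z\<close>. As \<open>T\<close> commutes with boundaries, null-homologies of the projections
  yield a null-homology of the removed part.\<close>

lemma S_homologous:
  assumes z: "z \<in> gchains n P" and a: "a \<in> gchains (Suc n) X" and b: "b \<in> gchains (Suc n) Y"
    and za: "gmap n fst z - gbd (Suc n) a \<in> gchains n (subtopology X A)"
    and zb: "gmap n snd z - gbd (Suc n) b \<in> gchains n (subtopology Y B)"
  shows "z - S n z - gbd (Suc n) (T (Suc n) a b) \<in> gchains n (subtopology P Q)"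
proof -
  have f: "gbd (Suc n) a \<in> fsupp" "gbd (Suc n) b \<in> fsupp"
    using a b by (auto intro: fsupp_gbd gchains_fsupp)
  have "z - S n z - gbd (Suc n) (T (Suc n) a b) =
      T n (gmap n fst z - gbd (Suc n) a) (gmap n snd z - gbd (Suc n) b)"
    unfolding S_def gbd_T[OF a b] using f by (simp add: T_diff fsupp_gmap)
  then show ?thesis
    using T_in_Q[OF za zb] by simp
qed

text \<open>By \<open>gbd_K\<close>, the operator \<open>K\<close> sends a boundary to the two
  projections at the ends, up to a boundary; and the projections of \<open>T\<close> are
  \<open>a\<close> and \<open>b\<close> modulo \<open>A\<close> and \<open>B\<close>.\<close>

lemma K_gbd_T:
  assumes a: "a \<in> gchains (Suc n) X" and b: "b \<in> gchains (Suc n) Y"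
  shows "K n (gbd (Suc n) (T (Suc n) a b)) - (gmap (Suc n) JX a - gmap (Suc n) JY b) \<in> rbd (Suc n) W V"
proof -
  let ?f = "T (Suc n) a b"
  note f = T_in[OF a b]
  have fs: "gmap (Suc n) fst ?f \<in> fsupp" "gmap (Suc n) snd ?f \<in> fsupp" "a \<in> fsupp" "b \<in> fsupp"
    using a b by (auto intro: gchains_fsupp fsupp_gmap)
  have "K n (gbd (Suc n) ?f) = gmap (Suc n) JX (gmap (Suc n) fst ?f) - gmap (Suc n) JY (gmap (Suc n) snd ?f)
      - gbd (Suc (Suc n)) (K (Suc n) ?f)"
    using gbd_K[OF f] by (simp add: algebra_simps)
  then have "K n (gbd (Suc n) ?f) - (gmap (Suc n) JX a - gmap (Suc n) JY b) =
      gmap (Suc n) JX (gmap (Suc n) fst ?f - a) - gmap (Suc n) JY (gmap (Suc n) snd ?f - b)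
      - gbd (Suc (Suc n)) (K (Suc n) ?f)"
    by (simp add: gmap_diff fs algebra_simps)
  then show ?thesis
    using rbd_sub[OF gmap_JX_V[OF gmap_fst_T[OF a b]]] rbd_sub[OF gmap_JY_V[OF gmap_snd_T[OF a b]]]
      rbd_gbd[OF K_in[OF f]] rbd_diff by metis
qed

text \<open>Turns the corrected chain produced by \<open>K_hits\<close> into a value of
  \<open>K\<close> after \<open>S\<close>, so that surjectivity is obtained for a map defined
  without choosing \<open>a\<close> and \<open>b\<close>.\<close>

lemma K_S:
  assumes z: "z \<in> gchains n P" and a: "a \<in> gchains (Suc n) X" and b: "b \<in> gchains (Suc n) Y"
    and za: "gmap n fst z - gbd (Suc n) a \<in> gchains n (subtopology X A)"
    and zb: "gmap n snd z - gbd (Suc n) b \<in> gchains n (subtopology Y B)"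
  shows "K n (S n z) - (K n z - gmap (Suc n) JX a + gmap (Suc n) JY b) \<in> rbd (Suc n) W V"
proof -
  let ?b = "gbd (Suc n) (T (Suc n) a b)"
  define g where "g = z - S n z - ?b"
  have g: "g \<in> gchains n (subtopology P Q)"
    unfolding g_def by (rule S_homologous[OF assms])
  have fs: "z \<in> fsupp" "S n z \<in> fsupp" "?b \<in> fsupp"
    using z S_in[OF z] T_in[OF a b] by (auto intro: gchains_fsupp fsupp_gbd)
  have Kg: "K n g = K n z - K n (S n z) - K n ?b"
    unfolding g_def by (simp add: K_diff fs fsupp_diff)
  have "K n (S n z) - (K n z - gmap (Suc n) JX a + gmap (Suc n) JY b) =
      - K n g - (K n ?b - (gmap (Suc n) JX a - gmap (Suc n) JY b))"
    unfolding Kg by (simp add: algebra_simps)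
  then show ?thesis
    using rbd_diff[OF rbd_minus[OF rbd_sub[OF K_in_V[OF g]]] K_gbd_T[OF a b]] by (simp only:)
qed

lemma K_S_boundary:
  assumes "x \<in> rbd n P Q"
  shows "K n (S n x) \<in> rbd (Suc n) W V" "gmap n fst x \<in> rbd n X A" "gmap n snd x \<in> rbd n Y B"
proof -
  obtain d e where x: "x = gbd (Suc n) d + e" and d: "d \<in> gchains (Suc n) P" and e: "e \<in> gchains n (subtopology P Q)"
    using assms by (elim rbdE)
  have fs: "gbd (Suc n) d \<in> fsupp" "e \<in> fsupp"
    using d e by (auto intro: gchains_fsupp fsupp_gbd)
  have "gmap n fst x = gbd (Suc n) (gmap (Suc n) fst d) + gmap n fst e"
    "gmap n snd x = gbd (Suc n) (gmap (Suc n) snd d) + gmap n snd e"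
    using gbd_gmap[OF d, of fst] gbd_gmap[OF d, of snd] by (simp_all add: x gmap_add fs)
  then show "gmap n fst x \<in> rbd n X A" "gmap n snd x \<in> rbd n Y B"
    by (simp_all only:) (intro rbd_add rbd_gbd gmap_fst gmap_snd d rbd_sub[OF gmap_fst_Q] rbd_sub[OF gmap_snd_Q] e)+
  note Sd = S_in[OF d]
  have "S n x = gbd (Suc n) (S (Suc n) d) + S n e"
    using gbd_S[OF d] by (simp add: x S_add fs)
  moreover have "gbd (Suc n) (S (Suc n) d) \<in> fsupp" "S n e \<in> fsupp"
    using Sd S_in_Q[OF e] by (auto intro: gchains_fsupp fsupp_gbd)
  ultimately have "K n (S n x) = K n (gbd (Suc n) (S (Suc n) d)) + K n (S n e)"
    by (simp add: K_add)
  also have "K n (gbd (Suc n) (S (Suc n) d)) = gmap (Suc n) JX (gmap (Suc n) fst (S (Suc n) d))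
      - gmap (Suc n) JY (gmap (Suc n) snd (S (Suc n) d)) - gbd (Suc (Suc n)) (K (Suc n) (S (Suc n) d))"
    using gbd_K[OF Sd] by (simp add: algebra_simps)
  finally have "K n (S n x) = gmap (Suc n) JX (gmap (Suc n) fst (S (Suc n) d))
      - gmap (Suc n) JY (gmap (Suc n) snd (S (Suc n) d)) - gbd (Suc (Suc n)) (K (Suc n) (S (Suc n) d))
      + K n (S n e)" .
  then show "K n (S n x) \<in> rbd (Suc n) W V"
    by (simp only:) (intro rbd_add rbd_diff rbd_gbd K_in Sd rbd_sub gmap_JX_V gmap_JY_V S_proj[OF d] K_in_V S_in_Q e)
qed

text \<open>Here \<open>S\<close> pays off: the end terms in \<open>gbd_K\<close> are the
  projections of \<open>S n z\<close>, which lie in \<open>A\<close> and \<open>B\<close>, so the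
  whole boundary lies in \<open>V\<close>.\<close>

lemma K_S_rcyc:
  assumes "z \<in> rcyc n P Q"
  shows "K n (S n z) \<in> rcyc (Suc n) W V" "gmap n fst z \<in> rcyc n X A" "gmap n snd z \<in> rcyc n Y B"
proof -
  note z = rcycD[OF assms]
  note Sz = S_in[OF z(1)]
  have "K (n - 1) (gbd n (S n z)) \<in> gchains n (subtopology W V)"
    using K_in_V[OF rcycD(2)[OF S_rcyc[OF assms]]] by (cases n) auto
  then have "gbd (Suc n) (K n (S n z)) \<in> gchains n (subtopology W V)"
    unfolding gbd_K[OF Sz] by (intro gchains_diff gmap_JX_V gmap_JY_V S_proj[OF z(1)])
  then show "K n (S n z) \<in> rcyc (Suc n) W V"
    by (simp add: rcyc_def K_in[OF Sz])
  show "gmap n fst z \<in> rcyc n X A" "gmap n snd z \<in> rcyc n Y B"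
    using z gmap_fst[OF z(1)] gmap_snd[OF z(1)] gmap_fst_Q[OF z(2)] gmap_snd_Q[OF z(2)]
    by (auto simp: rcyc_def gbd_gmap[OF z(1)])
qed

lemma projections_null_imp:
  assumes z: "z \<in> rcyc n P Q" and K: "K n (S n z) \<in> rbd (Suc n) W V"
    and "gmap n fst z \<in> rbd n X A" "gmap n snd z \<in> rbd n Y B"
  shows "z \<in> rbd n P Q"
proof -
  obtain a a' where a: "gmap n fst z = gbd (Suc n) a + a'" "a \<in> gchains (Suc n) X" "a' \<in> gchains n (subtopology X A)"
    using assms(3) by (elim rbdE)
  obtain b b' where b: "gmap n snd z = gbd (Suc n) b + b'" "b \<in> gchains (Suc n) Y" "b' \<in> gchains n (subtopology Y B)"
    using assms(4) by (elim rbdE)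
  note zP = rcycD(1)[OF z]
  have "z - S n z - gbd (Suc n) (T (Suc n) a b) \<in> gchains n (subtopology P Q)"
    using a b by (intro S_homologous zP) simp_all
  moreover have "S n z \<in> rbd n P Q"
    by (rule K_null_imp_null[OF S_rcyc[OF z] S_proj(1)[OF zP] K])
  ultimately have "(z - S n z - gbd (Suc n) (T (Suc n) a b)) + S n z + gbd (Suc n) (T (Suc n) a b) \<in> rbd n P Q"
    by (intro rbd_add rbd_gbd T_in a(2) b(2)) (auto intro: rbd_sub)
  then show ?thesis
    by simp
qed

text \<open>\<open>T n a b\<close> realises the two projections, and \<open>K_hits\<close> supplies
  the missing join class. The cycle added for the latter has null-homologous projections, so it does
  not disturb the former.\<close>

lemma projections_surj:
  assumes w: "w \<in> rcyc (Suc n) W V" and a: "a \<in> rcyc n X A" and b: "b \<in> rcyc n Y B"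
  shows "\<exists>x\<in>rcyc n P Q. K n (S n x) - w \<in> rbd (Suc n) W V \<and>
    gmap n fst x - a \<in> rbd n X A \<and> gmap n snd x - b \<in> rbd n Y B"
proof -
  note a' = rcycD[OF a] and b' = rcycD[OF b]
  define f where "f = T n a b"
  have fP: "f \<in> gchains n P"
    unfolding f_def by (rule T_in[OF a'(1) b'(1)])
  then have f: "f \<in> rcyc n P Q"
    using gbd_T[OF a'(1) b'(1)] T_in_Q[OF a'(2) b'(2)] by (simp add: rcyc_def f_def)
  define w' where "w' = w - K n (S n f)"
  have "w' \<in> rcyc (Suc n) W V"
    unfolding w'_def by (intro rcyc_diff w K_S_rcyc(1) f)
  then obtain z c d where z: "z \<in> rcyc n P Q" and c: "c \<in> gchains (Suc n) X" and d: "d \<in> gchains (Suc n) Y"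
    and zc: "gmap n fst z - gbd (Suc n) c \<in> gchains n (subtopology X A)"
    and zd: "gmap n snd z - gbd (Suc n) d \<in> gchains n (subtopology Y B)"
    and Kz: "K n z - gmap (Suc n) JX c + gmap (Suc n) JY d - w' \<in> rbd (Suc n) W V"
    by (rule K_hits)
  note zP = rcycD(1)[OF z]
  have fs: "f \<in> fsupp" "z \<in> fsupp" "S n f \<in> fsupp" "S n z \<in> fsupp"
    using fP zP S_in by (auto intro: gchains_fsupp)
  have "K n (S n (f + z)) - w =
      (K n (S n z) - (K n z - gmap (Suc n) JX c + gmap (Suc n) JY d))
      + (K n z - gmap (Suc n) JX c + gmap (Suc n) JY d - w')"
    by (simp add: S_add K_add fs w'_def algebra_simps)
  then have "K n (S n (f + z)) - w \<in> rbd (Suc n) W V"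
    using rbd_add[OF K_S[OF zP c d zc zd] Kz] by simp
  moreover have "gmap n fst (f + z) - a = (gmap n fst f - a) + (gmap n fst z - gbd (Suc n) c) + gbd (Suc n) c"
    "gmap n snd (f + z) - b = (gmap n snd f - b) + (gmap n snd z - gbd (Suc n) d) + gbd (Suc n) d"
    by (simp_all add: gmap_add fs algebra_simps)
  moreover have "(gmap n fst f - a) + (gmap n fst z - gbd (Suc n) c) + gbd (Suc n) c \<in> rbd n X A"
    "(gmap n snd f - b) + (gmap n snd z - gbd (Suc n) d) + gbd (Suc n) d \<in> rbd n Y B"
    unfolding f_def
    by (intro rbd_add rbd_sub rbd_gbd gmap_fst_T gmap_snd_T zc zd c d a'(1) b'(1))+
  ultimately show ?thesis
    using rcyc_add[OF f z] by (intro bexI[of _ "f + z"] conjI) (simp_all only:)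
qed

text \<open>Vanishing of the degree 0 homology of \<open>(W, V)\<close>: slide a point to its end;
  if it is not in \<open>V\<close> there, a segment of the join over a section leads to a point of
  \<open>V\<close> at the other end. No subdivision is required, as a 0-simplex lies in one of the
  ends anyway.\<close>

lemma rel_hom_0_trivial: "(w :: (('a, 'b) joinpt, 'g::ab_group_add) gchain) \<in> gchains 0 W \<Longrightarrow> w \<in> rbd 0 W V"
proof -
  assume w: "w \<in> gchains 0 W"
  have small: "\<sigma> ` standard_simplex 0 \<subseteq> U1 \<or> \<sigma> ` standard_simplex 0 \<subseteq> U2" if "w \<sigma> \<noteq> 0" for \<sigma>
  proof -
    have "\<sigma> ` standard_simplex 0 \<subseteq> topspace W"
      using w that by (auto simp: gchains_def singular_simplex_def continuous_map_def)
    then show ?thesis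
      using U_cover by (auto simp: standard_simplex_0)
  qed
  obtain w1 w2 where w12: "w = w1 + w2" and w1: "w1 \<in> gchains 0 (subtopology W U1)" and w2: "w2 \<in> gchains 0 (subtopology W U2)"
    using gchains_split[OF w small] by metis
  let ?a = "gmap 0 jx w1" and ?b = "gmap 0 jy w2"
  note a = gmap_jx[OF w1] and b = gmap_jy[OF w2]
  have mb: "- ?b \<in> gchains 0 Y"
    using b by (simp only: gchains_minus_iff)
  \<comment> \<open>The sign of \<open>?b\<close> matches the minus sign of the \<open>Y\<close> end
    in \<open>gbd_K\<close>.\<close>
  let ?f = "T 0 ?a (- ?b)"
  note f = T_in[OF a mb]
  have fs: "gmap 0 fst ?f \<in> fsupp" "gmap 0 snd ?f \<in> fsupp" "?a \<in> fsupp" "?b \<in> fsupp" "- ?b \<in> fsupp"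
    by (auto intro: fsupp_gmap fsupp_minus)
  have "w1 = gmap 0 JX ?a - gbd 1 (E \<psi>X 0 w1)"
    using gbd_E[OF gchains_sub[OF w1], of \<psi>X] gmap_\<psi>X_1[OF w1] by simp
  moreover have "w2 = gmap 0 JY ?b - gbd 1 (E \<psi>Y 0 w2)"
    using gbd_E[OF gchains_sub[OF w2], of \<psi>Y] gmap_\<psi>Y_1[OF w2] by simp
  moreover have "gbd 1 (K 0 ?f) = gmap 0 JX (gmap 0 fst ?f) - gmap 0 JY (gmap 0 snd ?f)"
    using gbd_K[OF f] by simp
  moreover have "gmap 0 JX (gmap 0 fst ?f) = gmap 0 JX (gmap 0 fst ?f - ?a) + gmap 0 JX ?a"
    by (simp add: gmap_diff fs)
  moreover have "gmap 0 JY (gmap 0 snd ?f) = gmap 0 JY (gmap 0 snd ?f - (- ?b)) - gmap 0 JY ?b"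
    by (simp only: gmap_diff gmap_minus fs) simp
  ultimately have "w = gbd 1 (K 0 ?f) - gmap 0 JX (gmap 0 fst ?f - ?a) + gmap 0 JY (gmap 0 snd ?f - (- ?b))
      - gbd 1 (E \<psi>X 0 w1) - gbd 1 (E \<psi>Y 0 w2)"
    unfolding w12 by (rule combine_end_chains)
  moreover have "\<dots> \<in> rbd 0 W V"
    unfolding One_nat_def
    by (intro rbd_diff rbd_add rbd_gbd rbd_sub K_in f gmap_JX_V gmap_JY_V gmap_fst_T gmap_snd_T a mb
        E_in_W reparam_\<psi> gchains_sub[OF w1] gchains_sub[OF w2])
  ultimately show ?thesis
    by (simp only:)
qed

theorem rel_hom_product_join:
  fixes sc :: "'r::comm_ring_1 \<Rightarrow> 'g::ab_group_add \<Rightarrow> 'g"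
  assumes sc: "Modules.module sc"
  shows "mod_iso (rel_hom sc q P Q) (dsum (dsum (rel_hom sc (q + 1) W V) (rel_hom sc q X A)) (rel_hom sc q Y B))"
proof -
  note add = module_additive[OF sc]
  consider "q \<ge> 0" | "q = - 1" | "q < - 1" by linarith
  then show ?thesis
  proof cases
    case 1
    define n where "n = nat q"
    have q1: "nat (q + 1) = Suc n" "q + 1 \<ge> 0"
      using 1 by (auto simp: n_def)
    show ?thesis
      unfolding rel_hom_nonneg[OF 1] rel_hom_nonneg[OF q1(2)] q1(1) n_def[symmetric]
    proof (rule quot_iso_dsum3[where ?f1.0 = "\<lambda>z. K n (S n z)" and ?f2.0 = "gmap n fst" and ?f3.0 = "gmap n snd"])
      show "\<exists>x\<in>rcyc n P Q. K n (S n x) - w \<in> rbd (Suc n) W V \<and> gmap n fst x - a \<in> rbd n X A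
          \<and> gmap n snd x - b \<in> rbd n Y B"
        if "w \<in> rcyc (Suc n) W V" "a \<in> rcyc n X A" "b \<in> rcyc n Y B" for w a b
        using projections_surj[OF that] .
      show "K n (S n (x + y)) = K n (S n x) + K n (S n y)" if "x \<in> rcyc n P Q" "y \<in> rcyc n P Q" for x y
        using rcycD(1)[OF that(1)] rcycD(1)[OF that(2)] by (simp add: S_add K_add gchains_fsupp fsupp_S)
      show "K n (S n (gscale sc r x)) = gscale sc r (K n (S n x))" if "x \<in> rcyc n P Q" for r x
        using rcycD(1)[OF that] by (simp add: S_scale[OF add] K_scale[OF add] gchains_fsupp fsupp_S)
      show "gmap n fst (x + y) = gmap n fst x + gmap n fst y" "gmap n snd (x + y) = gmap n snd x + gmap n snd y"
        if "x \<in> rcyc n P Q" "y \<in> rcyc n P Q" for x y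
        using rcycD(1)[OF that(1)] rcycD(1)[OF that(2)] by (simp_all add: gmap_add gchains_fsupp)
      show "gmap n fst (gscale sc r x) = gscale sc r (gmap n fst x)"
        "gmap n snd (gscale sc r x) = gscale sc r (gmap n snd x)" if "x \<in> rcyc n P Q" for r x
        using rcycD(1)[OF that] by (simp_all add: gmap_scale[OF add] gchains_fsupp)
      show "K n (S n x) \<in> rcyc (Suc n) W V" "gmap n fst x \<in> rcyc n X A" "gmap n snd x \<in> rcyc n Y B"
        if "x \<in> rcyc n P Q" for x
        using K_S_rcyc[OF that] by auto
      show "K n (S n x) \<in> rbd (Suc n) W V \<and> gmap n fst x \<in> rbd n X A \<and> gmap n snd x \<in> rbd n Y B"
        if "x \<in> rbd n P Q" for x
        using K_S_boundary[OF that] by auto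
      show "x \<in> rbd n P Q" if "x \<in> rcyc n P Q" "K n (S n x) \<in> rbd (Suc n) W V"
        "gmap n fst x \<in> rbd n X A" "gmap n snd x \<in> rbd n Y B" for x
        using projections_null_imp[OF that] .
    qed (rule quotient_data_rel[OF sc])+
  next
    case 2
    \<comment> \<open>For \<open>q = -1\<close> the degree shift leaves the join as the only term in
      a nonnegative degree.\<close>
    have "mod_trivial (rel_hom sc (q + 1) W V)"
      using 2 quotient_data.quot_trivial[OF quotient_data_rel[OF sc, of 0 W V]] rel_hom_0_trivial
      by (auto simp: rel_hom_nonneg rcyc_def)
    then show ?thesis
      using 2 by (intro mod_iso_trivial mod_trivial_dsum) (auto simp: rel_hom_def zero_mod_trivial[OF sc])
  next
    case 3
    then show ?thesis
      by (intro mod_iso_trivial mod_trivial_dsum) (auto simp: rel_hom_def zero_mod_trivial[OF sc])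
  qed
qed

end

section \<open>Augmented homology and the main theorem\<close>

text \<open>Relative chains modulo the empty subspace are absolute chains; this turns the
  \<open>rel_hom\<close> branch of \<open>aug_hom\<close> into cycles modulo boundaries.\<close>

lemma gchains_trivial: "gchains n trivial_topology = {0}"
  unfolding gchains_def
  by (auto simp: singular_simplex_empty fun_eq_iff)

text \<open>The augmentation is induced by the map to a single generator, so linearity and scaling
  come from \<open>gext\<close>.\<close>

lemma gaug_eq_gext: "gaug c = gext (\<lambda>_. frag_of ()) c ()"
  by (simp add: gext_const gaug_def gtensor_frag_of)

lemma gaug_diff: "a \<in> fsupp \<Longrightarrow> b \<in> fsupp \<Longrightarrow> gaug (a - b) = gaug a - gaug b"
  by (simp add: gaug_eq_gext gext_diff)

lemma gaug_0 [simp]: "gaug 0 = 0"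
  by (simp add: gaug_def)

lemma gaug_scale: "additive (sc r) \<Longrightarrow> a \<in> fsupp \<Longrightarrow> gaug (gscale sc r a) = sc r (gaug a)"
  by (simp add: gaug_eq_gext gscale_def gext_scale)

lemma gaug_single: "gaug (gtensor (frag_of \<sigma>) g) = g"
  unfolding gaug_eq_gext gext_single by (simp add: gtensor_frag_of)

lemma gaug_gbd:
  assumes "d \<in> gchains 1 X"
  shows "gaug (gbd 1 d) = 0"
proof -
  have "frag_extend (\<lambda>_. frag_of ()) (chain_boundary 1 (frag_of \<sigma>)) = 0" for \<sigma> :: "(nat \<Rightarrow> real) \<Rightarrow> 'a"
    by (simp add: chain_boundary_of frag_extend_diff frag_extend_minus)
  then show ?thesis
    using assms by (simp add: gaug_eq_gext gbd_eq_glift gchains_fsupp glift_def gext_gext) (simp add: gext_def)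
qed

lemma gbd_gtensor: "gbd n (gtensor a g) = gtensor (chain_boundary n a) g"
  by (simp add: gbd_eq_glift fsupp_gtensor glift_def gext_gtensor additive_frag_extend additive_chain_boundary)

section \<open>Constant simplices and augmented cycles\<close>

definition const_simplex :: "nat \<Rightarrow> 'a \<Rightarrow> (nat \<Rightarrow> real) \<Rightarrow> 'a" where
  "const_simplex n s = restrict (\<lambda>_. s) (standard_simplex n)"

lemma const_simplex_chain:
  "s \<in> topspace X \<Longrightarrow> gtensor (frag_of (const_simplex n s)) g \<in> gchains n X"
  by (intro gchains_gtensor)
    (simp add: singular_chain_of singular_simplex_def const_simplex_def)

text \<open>All \<open>n + 2\<close> faces coincide and their signs alternate, so one survives
  exactly when \<open>n\<close> is odd.\<close>

lemma gbd_const_simplex: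
  "gbd (Suc n) (gtensor (frag_of (const_simplex (Suc n) s)) g) =
    (if odd n then gtensor (frag_of (const_simplex n s)) g else 0)"
proof -
  have "singular_chain (Suc n) (discrete_topology {s}) (frag_of (const_simplex (Suc n) s))"
    by (simp add: singular_chain_of singular_simplex_singleton const_simplex_def)
  from chain_boundary_of_singleton[OF _ this] show ?thesis
    by (simp add: gbd_gtensor const_simplex_def)
qed

lemma gmap_const: "gmap n (\<lambda>_. s) z = gtensor (frag_of (const_simplex n s)) (gaug z)"
  by (simp add: gmap_def glift_def chain_map_of simplex_map_def const_simplex_def gext_const gaug_def comp_def)

text \<open>In degree 0 the function \<open>gbd\<close> is identically 0, so the augmentation takes
  its place.\<close>

definition acyc :: "nat \<Rightarrow> 'a topology \<Rightarrow> ('a, 'g::ab_group_add) gchain set" where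
  "acyc n X = {c \<in> gchains n X. if n = 0 then gaug c = 0 else gbd n c = 0}"

definition abd :: "nat \<Rightarrow> 'a topology \<Rightarrow> ('a, 'g::ab_group_add) gchain set" where
  "abd n X = {gbd (Suc n) d | d. d \<in> gchains (Suc n) X}"

lemma abdE:
  assumes "c \<in> abd n X"
  obtains d where "c = gbd (Suc n) d" "d \<in> gchains (Suc n) X"
  using assms unfolding abd_def by blast

lemma aug_hom_nonneg:
  assumes "q \<ge> 0"
  shows "aug_hom sc q X = quot_mod (gscale sc) (acyc (nat q) X) (abd (nat q) X)"
proof (cases "q = 0")
  case True
  then show ?thesis
    by (simp add: aug_hom_def acyc_def abd_def)
next
  case False
  then have "nat q \<noteq> 0"
    using assms by simp
  then show ?thesis
    using assms False by (simp add: aug_hom_def acyc_def abd_def rel_hom_def gchains_trivial Let_def)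
qed

lemma abd_le_acyc: "abd n X \<subseteq> acyc n X"
proof
  fix c :: "('a, 'g::ab_group_add) gchain"
  assume "c \<in> abd n X"
  then obtain d where "c = gbd (Suc n) d" "d \<in> gchains (Suc n) X"
    unfolding abd_def by blast
  then show "c \<in> acyc n X"
    using gaug_gbd[of d X] by (cases n) (auto simp: acyc_def gbd_gchains_Suc gbd_gbd)
qed

lemma acyc_diff: "a \<in> acyc n X \<Longrightarrow> b \<in> acyc n X \<Longrightarrow> a - b \<in> acyc n X"
  unfolding acyc_def by (cases "n = 0") (auto simp: gbd_diff gaug_diff gchains_fsupp intro: gchains_diff)

lemma quotient_data_aug:
  fixes sc :: "'r::comm_ring_1 \<Rightarrow> 'g::ab_group_add \<Rightarrow> 'g"
  assumes "Modules.module sc"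
  shows "quotient_data (gscale sc) (acyc n (X :: 'a topology)) (abd n X)"
proof
  note add = module_additive[OF assms]
  show "gscale sc r (x + y) = gscale sc r x + gscale sc r y" for r and x y :: "('a, 'g) gchain"
    by (rule gscale_add[OF add])
  show "submod (gscale sc) (acyc n X)"
    unfolding submod_def
  proof (intro conjI ballI allI)
    show zero: "0 \<in> acyc n X"
      by (simp add: acyc_def)
    show minus: "- x \<in> acyc n X" if "x \<in> acyc n X" for x
      using acyc_diff[OF zero that] by simp
    show "x + y \<in> acyc n X" if "x \<in> acyc n X" "y \<in> acyc n X" for x y
      using acyc_diff[OF that(1) minus[OF that(2)]] by simp
    show "gscale sc r x \<in> acyc n X" if "x \<in> acyc n X" for r x
    proof -
      have x: "x \<in> gchains n X" "if n = 0 then gaug x = 0 else gbd n x = 0"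
        using that by (simp_all add: acyc_def)
      note scale = gscale_gchains[where sc = sc and r = r, OF add x(1)]
      show ?thesis
      proof (cases "n = 0")
        case True
        have "gaug (gscale sc r x) = sc r (gaug x)"
          by (rule gaug_scale[where sc = sc and r = r, OF add gchains_fsupp[OF x(1)]])
        also have "\<dots> = 0"
          using x(2) True additive.zero[OF add, of r] by simp
        finally show ?thesis
          using scale True by (simp add: acyc_def)
      next
        case False
        have "gbd n (gscale sc r x) = gscale sc r (gbd n x)"
          by (rule gscale_gbd[where sc = sc and r = r, OF add x(1)])
        also have "\<dots> = 0"
          using x(2) False gscale_0[where sc = sc and r = r, OF add] by simp
        finally show ?thesis
          using scale False by (simp add: acyc_def)
      qed
    qed
  qed
  show "submod (gscale sc) (abd n X)"
    unfolding submod_def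
  proof (intro conjI ballI allI)
    show "0 \<in> abd n X"
      unfolding abd_def by (intro CollectI exI[of _ 0]) simp
    show "x + y \<in> abd n X" if x: "x \<in> abd n X" "y \<in> abd n X" for x y
    proof -
      obtain d e where "x = gbd (Suc n) d" "d \<in> gchains (Suc n) X" "y = gbd (Suc n) e" "e \<in> gchains (Suc n) X"
        using x by (elim abdE)
      then show ?thesis
        unfolding abd_def
        by (intro CollectI exI[of _ "d + e"]) (simp add: gbd_add gchains_fsupp gchains_add)
    qed
    show "- x \<in> abd n X" if x: "x \<in> abd n X" for x
    proof -
      obtain d where "x = gbd (Suc n) d" "d \<in> gchains (Suc n) X"
        using x by (elim abdE)
      then show ?thesis
        unfolding abd_def by (intro CollectI exI[of _ "- d"]) (simp add: gbd_minus gchains_fsupp)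
    qed
    show "gscale sc r x \<in> abd n X" if x: "x \<in> abd n X" for r x
    proof -
      obtain d where "x = gbd (Suc n) d" "d \<in> gchains (Suc n) X"
        using x by (elim abdE)
      then show ?thesis
        unfolding abd_def
        by (intro CollectI exI[of _ "gscale sc r d"]) (simp add: gscale_gbd[OF add] gscale_gchains[OF add])
    qed
  qed
qed

text \<open>The contraction runs inside \<open>S\<close>, so prisms over chains of \<open>S\<close>
  are again chains of \<open>S\<close>.\<close>

locale contracted_subspace =
  fixes X :: "'a topology" and S s0 H
  assumes S_le: "S \<subseteq> topspace X" and s0: "s0 \<in> S"
    and H_cont: "continuous_map (prod_topology (subtopology X S) (top_of_set {0..1})) (subtopology X S) H"
    and H_0: "\<And>x. x \<in> S \<Longrightarrow> H (x, 0) = x" and H_1: "\<And>x. x \<in> S \<Longrightarrow> H (x, 1::real) = s0"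
begin

lemma S_chain: "gtensor (frag_of (const_simplex n s0)) g \<in> gchains n (subtopology X S)"
  using s0 S_le by (intro const_simplex_chain) auto

text \<open>The contraction makes \<open>z\<close> homologous to a multiple of the constant simplex,
  with the coefficient sum \<open>gaug z\<close> as factor. For odd \<open>n\<close> that simplex is
  a boundary; for even \<open>n\<close> the cycle condition forces the factor to be 0.\<close>

lemma acyc_imp_abd:
  assumes z: "z \<in> acyc n (subtopology X S)"
  shows "z \<in> abd n (subtopology X S)"
proof -
  have zS: "z \<in> gchains n (subtopology X S)"
    using z by (simp add: acyc_def)
  have "gmap n (\<lambda>x. H (x, 1)) z = gmap n (\<lambda>_. s0) z" "gmap n (\<lambda>x. H (x, 0)) z = z"
    using H_1 H_0 by (auto intro!: gmap_cong[OF zS] gmap_ident[OF zS])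
  moreover have "gprism (n - 1) H (gbd n z) = 0"
    using z by (cases "n = 0") (auto simp: acyc_def)
  ultimately have D: "gbd (Suc n) (gprism n H z) = gmap n (\<lambda>_. s0) z - z"
    using gbd_gprism[OF zS, of H] by simp
  have "\<exists>f\<in>gchains (Suc n) (subtopology X S). gbd (Suc n) f = gmap n (\<lambda>_. s0) z"
  proof (cases "odd n")
    case True
    then show ?thesis
      using S_chain[of "Suc n"] gbd_const_simplex[of n s0 "gaug z"] by (metis gmap_const)
  next
    case False
    have "gaug z = 0"
    proof (cases n)
      case 0
      then show ?thesis
        using z by (simp add: acyc_def)
    next
      case (Suc m)
      then have "odd m" using False by simp
      have "gbd n (gmap n (\<lambda>_. s0) z) = 0"
        using gbd_gmap[OF zS] z Suc by (simp add: acyc_def)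
      then have "gtensor (frag_of (const_simplex m s0)) (gaug z) = 0"
        using gbd_const_simplex[of m s0 "gaug z"] \<open>odd m\<close> by (simp add: gmap_const Suc)
      then show ?thesis
        by (metis gaug_0 gaug_single)
    qed
    then show ?thesis
      by (intro bexI[of _ 0]) (simp_all add: gmap_const)
  qed
  then obtain f where f: "f \<in> gchains (Suc n) (subtopology X S)" "gbd (Suc n) f = gmap n (\<lambda>_. s0) z"
    by blast
  have DS: "gprism n H z \<in> gchains (Suc n) (subtopology X S)"
    by (rule gprism_gchains[OF H_cont zS])
  have "z = gbd (Suc n) (f - gprism n H z)"
    using f DS D by (simp add: gbd_diff gchains_fsupp)
  then show ?thesis
    unfolding abd_def using gchains_diff[OF f(1) DS] by blast
qed

text \<open>The point \<open>s0\<close> makes the augmentation surjective.\<close>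

lemma aug_hom_minus_one:
  fixes sc :: "'r::comm_ring_1 \<Rightarrow> 'g::ab_group_add \<Rightarrow> 'g"
  assumes sc: "Modules.module sc"
  shows "mod_trivial (aug_hom sc (- 1) X)"
proof -
  note add = module_additive[OF sc]
  let ?Z = "range (\<lambda>g \<sigma>. g) :: ('a, 'g) gchain set"
  have "(\<lambda>\<sigma>. g) \<in> {(\<lambda>\<sigma>. gaug c) | c. c \<in> gchains 0 X}" for g :: 'g
    using gaug_single[of "const_simplex 0 s0" g] gchains_sub[OF S_chain[of 0 g]] by force
  then have eq: "{(\<lambda>\<sigma>. gaug c) | c. c \<in> gchains 0 X} = ?Z"
    by auto
  have "quotient_data (gscale sc) ?Z ?Z"
  proof
    show "gscale sc r (x + y) = gscale sc r x + gscale sc r y" for r and x y :: "('a, 'g) gchain"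
      by (rule gscale_add[OF add])
    show "submod (gscale sc) ?Z"
      unfolding submod_def by (auto simp: gscale_def plus_fun_def fun_Compl_def zero_fun_def)
  qed
  then have "mod_trivial (quot_mod (gscale sc) ?Z ?Z)"
    by (rule quotient_data.quot_trivial) simp
  then show ?thesis
    by (simp add: aug_hom_def eq)
qed

lemma aug_hom_closed:
  fixes sc :: "'r::comm_ring_1 \<Rightarrow> 'g::ab_group_add \<Rightarrow> 'g"
  assumes sc: "Modules.module sc"
  shows "mod_closed (aug_hom sc q X :: ('r, ('a, 'g) gchain set) amod)"
proof -
  consider "q \<ge> 0" | "q = - 1" | "q < - 1" by linarith
  then show ?thesis
  proof cases
    case 1
    then show ?thesis
      using quotient_data.quot_closed[OF quotient_data_aug[OF sc]] by (simp add: aug_hom_nonneg)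
  next
    case 2
    then show ?thesis
      using aug_hom_minus_one[OF sc] by (simp add: mod_trivial_def)
  next
    case 3
    then show ?thesis
      using zero_mod_trivial[OF sc, where 'c = 'a] by (simp add: aug_hom_def mod_trivial_def)
  qed
qed

text \<open>The map is the identity on chains. Bijectivity is the vanishing of the augmented
  homology of \<open>S\<close>, used once in degree \<open>n\<close> for injectivity and once in
  degree \<open>n - 1\<close> for surjectivity.\<close>

lemma aug_hom_iso_rel_hom:
  fixes sc :: "'r::comm_ring_1 \<Rightarrow> 'g::ab_group_add \<Rightarrow> 'g"
  assumes sc: "Modules.module sc"
  shows "mod_iso (aug_hom sc q X) (rel_hom sc q X S)"
proof -
  note add = module_additive[OF sc]
  consider "q \<ge> 0" | "q = - 1" | "q < - 1" by linarith
  then show ?thesis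
  proof cases
    case 1
    define n where "n = nat q"
    show ?thesis
      unfolding aug_hom_nonneg[OF 1] rel_hom_nonneg[OF 1] n_def[symmetric]
    proof (rule quot_iso_quot[where f = "\<lambda>x. x"])
      show "x \<in> rcyc n X S" if "x \<in> acyc n X" for x
        using that by (cases "n = 0") (auto simp: acyc_def rcyc_def)
      show "x \<in> rbd n X S \<longleftrightarrow> x \<in> abd n X" if x: "x \<in> acyc n X" for x
      proof
        assume "x \<in> rbd n X S"
        then obtain d e where xde: "x = gbd (Suc n) d + e" and d: "d \<in> gchains (Suc n) X"
          and e: "e \<in> gchains n (subtopology X S)"
          by (elim rbdE)
        have "gbd (Suc n) d \<in> abd n X"
          unfolding abd_def using d by blast
        then have "x - gbd (Suc n) d \<in> acyc n X"
          using x abd_le_acyc by (intro acyc_diff) auto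
        then have "e \<in> acyc n (subtopology X S)"
          using e by (simp add: xde acyc_def)
        then obtain f where f: "f \<in> gchains (Suc n) (subtopology X S)" "e = gbd (Suc n) f"
          using acyc_imp_abd unfolding abd_def by blast
        then have "x = gbd (Suc n) (d + f)"
          using d by (simp add: xde gbd_add gchains_fsupp)
        then show "x \<in> abd n X"
          unfolding abd_def using gchains_add[OF d gchains_sub[OF f(1)]] by blast
      next
        assume "x \<in> abd n X"
        then show "x \<in> rbd n X S"
          unfolding abd_def using rbd_gbd by blast
      qed
      show "\<exists>x\<in>acyc n X. x - y \<in> rbd n X S" if y: "y \<in> rcyc n X S" for y
      proof -
        note y' = rcycD[OF y]
        obtain f where f: "f \<in> gchains n (subtopology X S)" "y - f \<in> acyc n X"
        proof (cases n)
          case 0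
          \<comment> \<open>In degree 0 the degree \<open>-1\<close> correction is a multiple of the
            point \<open>s0\<close> with the same augmentation as \<open>y\<close>.\<close>
          let ?f = "gtensor (frag_of (const_simplex 0 s0)) (gaug y)"
          have "y - ?f \<in> acyc n X"
            using y' 0 gchains_diff[OF y'(1), of ?f] S_chain[of 0 "gaug y"] gchains_sub[of ?f 0 X S]
            by (simp add: acyc_def gaug_diff gchains_fsupp fsupp_gtensor gaug_single)
          then show thesis
            using that[of ?f] S_chain[of 0 "gaug y"] 0 by simp
        next
          case (Suc m)
          \<comment> \<open>The boundary of a relative cycle is an augmented cycle lying in
            \<open>S\<close>, so it also bounds a chain \<open>f\<close> of \<open>S\<close>, and
            \<open>y - f\<close> is an absolute cycle.\<close>
          have "gbd n y \<in> abd m X"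
            unfolding abd_def using y'(1) Suc by blast
          then have "gbd n y \<in> acyc m X"
            using abd_le_acyc by blast
          then have "gbd n y \<in> acyc m (subtopology X S)"
            using y'(2) Suc by (cases "m = 0") (auto simp: acyc_def)
          then obtain f where f: "f \<in> gchains n (subtopology X S)" "gbd n y = gbd n f"
            using acyc_imp_abd Suc unfolding abd_def by blast
          have "y - f \<in> acyc n X"
            using f y' gchains_sub[OF f(1)] Suc
            by (simp add: acyc_def gbd_diff gchains_fsupp gchains_diff)
          then show thesis
            using that f by blast
        qed
        moreover have "y - f - y \<in> rbd n X S"
          using rbd_minus[OF rbd_sub[OF f(1)]] by simp
        ultimately show ?thesis
          by blast
      qed
    qed (auto intro: quotient_data_aug[OF sc] quotient_data_rel[OF sc])
  next
    case 2
    then show ?thesis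
      using aug_hom_minus_one[OF sc]
      by (intro mod_iso_trivial) (simp_all add: rel_hom_def zero_mod_trivial[OF sc])
  next
    case 3
    then show ?thesis
      by (intro mod_iso_trivial) (simp_all add: aug_hom_def rel_hom_def zero_mod_trivial[OF sc])
  qed
qed

end

lemma contracted_singleton: "x0 \<in> topspace X \<Longrightarrow> contracted_subspace X {x0} x0 (\<lambda>_. x0)"
  by unfold_locales auto

lemma rel_hom_trivial:
  fixes sc :: "'r::comm_ring_1 \<Rightarrow> 'g::ab_group_add \<Rightarrow> 'g"
  assumes sc: "Modules.module sc" and S: "topspace X \<subseteq> S"
  shows "mod_trivial (rel_hom sc q X S :: ('r, ('a, 'g) gchain set) amod)"
proof (cases "q < 0")
  case True
  then show ?thesis
    by (simp add: rel_hom_def zero_mod_trivial[OF sc])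
next
  case False
  have "subtopology X S = X"
    using S by (metis inf.absorb_iff2 inf_commute subtopology_topspace subtopology_subtopology)
  then have "rcyc (nat q) X S \<subseteq> rbd (nat q) X S"
    using rbd_sub[of _ "nat q" X S] by (auto simp: rcyc_def)
  then show ?thesis
    using False quotient_data.quot_trivial[OF quotient_data_rel[OF sc]] by (simp add: rel_hom_nonneg)
qed

lemma (in join_pair) V_eq_jset: "Q = A \<times> B \<Longrightarrow> V = jset A B"
  unfolding V_def jset_def by auto

lemma product_join_absolute:
  fixes sc :: "'r::comm_ring_1 \<Rightarrow> 'g::ab_group_add \<Rightarrow> 'g"
  assumes sc: "Modules.module sc" and W: "join_topology X Y W"
  shows "mod_iso (aug_hom sc q (prod_topology X Y))
    (dsum (dsum (aug_hom sc (q + 1) W) (aug_hom sc q X)) (aug_hom sc q Y))"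
proof -
  interpret join_topology X Y W by fact
  obtain x0 y0 where x0: "x0 \<in> topspace X" and y0: "y0 \<in> topspace Y"
    using nonempty by blast
  interpret join_pair X Y W "{x0}" "{y0}" "{(x0, y0)}" x0 y0
    by unfold_locales (use x0 y0 in auto)
  have V: "V = jset {x0} {y0}"
    by (rule V_eq_jset) simp
  have jproj_V: "jproj (x0, y0, t) \<in> V" if "t \<in> {0..1}" for t
    unfolding V using that by (intro jproj_in_jset) auto
  have p_eq: "jproj (x0, y0, jt p) = p" if "p \<in> V" for p
    using that unfolding V by (auto elim!: jset_cases simp: jproj_def)
  \<comment> \<open>Slides the segment from \<open>JY y0\<close> to \<open>JX x0\<close> towards
    parameter 1.\<close>
  define H :: "('a, 'b) joinpt \<times> real \<Rightarrow> ('a, 'b) joinpt" where "H = (\<lambda>(p, s). jproj (x0, y0, (1 - s) * jt p + s * 1))"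
  interpret V: contracted_subspace W V "JX x0" H
  proof
    show "V \<subseteq> topspace W" by (rule V_le)
    show "JX x0 \<in> V" by (auto simp: V_def)
    show "H (x, 0) = x" if "x \<in> V" for x
      using p_eq[OF that] by (simp add: H_def)
    show "H (x, 1) = JX x0" for x
      by (simp add: H_def jproj_def)
    let ?T = "prod_topology (subtopology W V) (top_of_set {0..1::real})"
    have t: "continuous_map ?T (top_of_set {0..1}) (\<lambda>z. jt (fst z))"
      using continuous_map_compose[OF continuous_map_fst continuous_map_from_subtopology[OF jt_cont]]
      by (simp add: comp_def)
    have range: "(1 - snd z) * jt (fst z) + snd z * 1 \<in> {0..1}" if "z \<in> topspace ?T" for z
      using that jt_range[of "fst z" "{x0}" "{y0}"] by (intro convex_01) (auto simp: V)
    have "continuous_map ?T euclideanreal (\<lambda>z. (1 - snd z) * jt (fst z) + snd z * 1)"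
      by (intro continuous_intros continuous_map_into_fulltopology[OF t]
          continuous_map_into_fulltopology[OF continuous_map_snd])
    then have "continuous_map ?T (top_of_set {0..1}) (\<lambda>z. (1 - snd z) * jt (fst z) + snd z * 1)"
      using range unfolding continuous_map_in_subtopology by blast
    then have "continuous_map ?T (prod_topology X (prod_topology Y (top_of_set {0..1})))
        (\<lambda>z. (x0, y0, (1 - snd z) * jt (fst z) + snd z * 1))"
      using x0 y0 by (simp add: continuous_map_pairwise comp_def)
    from continuous_map_compose[OF this jproj_cont] have "continuous_map ?T W H"
      by (simp add: comp_def H_def case_prod_beta')
    moreover have "H z \<in> V" if "z \<in> topspace ?T" for z
      using jproj_V[OF range[OF that]] by (simp add: H_def case_prod_beta')
    ultimately show "continuous_map ?T (subtopology W V) H"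
      unfolding continuous_map_in_subtopology by blast
  qed
  interpret PP: contracted_subspace P "{(x0, y0)}" "(x0, y0)" "\<lambda>_. (x0, y0)"
    by (rule contracted_singleton) (simp add: P_def x0 y0)
  interpret XX: contracted_subspace X "{x0}" x0 "\<lambda>_. x0"
    by (rule contracted_singleton[OF x0])
  interpret YY: contracted_subspace Y "{y0}" y0 "\<lambda>_. y0"
    by (rule contracted_singleton[OF y0])
  \<comment> \<open>The passage between reduced and relative homology is proved in one direction; on
    the join side the opposite one is needed, which is why closedness is invoked.\<close>
  have "mod_iso (dsum (dsum (aug_hom sc (q + 1) W) (aug_hom sc q X)) (aug_hom sc q Y))
      (dsum (dsum (rel_hom sc (q + 1) W V) (rel_hom sc q X {x0})) (rel_hom sc q Y {y0}))"
    by (intro dsum_cong V.aug_hom_iso_rel_hom XX.aug_hom_iso_rel_hom YY.aug_hom_iso_rel_hom sc)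
  then have "mod_iso (dsum (dsum (rel_hom sc (q + 1) W V) (rel_hom sc q X {x0})) (rel_hom sc q Y {y0}))
      (dsum (dsum (aug_hom sc (q + 1) W) (aug_hom sc q X)) (aug_hom sc q Y))"
    by (rule mod_iso_sym)
      (intro mod_closed_dsum V.aug_hom_closed XX.aug_hom_closed YY.aug_hom_closed sc)
  then show ?thesis
    using mod_iso_trans[OF PP.aug_hom_iso_rel_hom[OF sc] mod_iso_trans[OF rel_hom_product_join[OF sc]]]
    unfolding P_def by blast
qed

theorem theorem2:
  fixes sc :: "'r::comm_ring_1 \<Rightarrow> 'g::ab_group_add \<Rightarrow> 'g"
    and X1 :: "'a topology option" and X2 :: "'a set option"
    and Y1 :: "'b topology option" and Y2 :: "'b set option"
    and J :: "'a topology \<Rightarrow> 'b topology \<Rightarrow> ('a, 'b) joinpt topology"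
    and q :: int
  assumes "Modules.module sc"
    and "pair_ok X1 X2" and "pair_ok Y1 Y2"
    and "\<not> is_wp_empty X1 X2" and "\<not> is_wp_empty Y1 Y2"
    and "J = qjoin \<or> J = hjoin"
  shows
   "(prod_nontriv X1 Y1 \<and> X2 = None \<and> Y2 = None \<longrightarrow>
      mod_iso (aH sc q (oprod_top X1 Y1) (prod_pair_snd X1 X2 Y1 Y2))
        (dsum (dsum (aH sc (q + 1) (ojoin_top J X1 Y1) None) (aH sc q X1 None)) (aH sc q Y1 None)))
  \<and> (prod_nontriv X1 Y1 \<and> X2 = None \<and> Y2 \<noteq> None \<longrightarrow>
      mod_iso (aH sc q (oprod_top X1 Y1) (prod_pair_snd X1 X2 Y1 Y2))
        (dsum (aH sc (q + 1) (ojoin_top J X1 Y1) (join_pair_snd X1 None Y1 Y2)) (aH sc q Y1 Y2)))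
  \<and> (prod_nontriv X1 Y1 \<and> X2 \<noteq> None \<and> Y2 = None \<longrightarrow>
      mod_iso (aH sc q (oprod_top X1 Y1) (prod_pair_snd X1 X2 Y1 Y2))
        (dsum (aH sc (q + 1) (ojoin_top J X1 Y1) (join_pair_snd X1 X2 Y1 None)) (aH sc q X1 X2)))
  \<and> (\<not> prod_nontriv X1 Y1 \<or> (X2 \<noteq> None \<and> Y2 \<noteq> None) \<longrightarrow>
      mod_iso (aH sc q (oprod_top X1 Y1) (prod_pair_snd X1 X2 Y1 Y2))
        (aH sc (q + 1) (ojoin_top J X1 Y1) (join_pair_snd X1 X2 Y1 Y2)))"
proof (cases "X1 = None \<or> Y1 = None")
  case True
  then have "aH sc q (oprod_top X1 Y1) (prod_pair_snd X1 X2 Y1 Y2) = zero_mod sc"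
    "aH sc (q + 1) (ojoin_top J X1 Y1) (join_pair_snd X1 X2 Y1 Y2) = zero_mod sc" "\<not> prod_nontriv X1 Y1"
    by (auto simp: aH_def oprod_top_def ojoin_top_def prod_nontriv_def split: option.splits)
  then show ?thesis
    using mod_iso_trivial[OF zero_mod_trivial zero_mod_trivial] assms(1) by simp
next
  case False
  then obtain X Y where X1: "X1 = Some X" and Y1: "Y1 = Some Y"
    by auto
  let ?W = "J X Y" and ?P = "prod_topology X Y"
  note sc = assms(1)
  have topW: "topspace ?W = jset (topspace X) (topspace Y)"
    using assms(6) topspace_qjoin topspace_hjoin by blast
  note aH_simps = X1 Y1 aH_def oprod_top_def ojoin_top_def prod_pair_snd_def join_pair_snd_def
    oprod_set_def ojset_def ounion_def
  show ?thesis
  proof (cases "topspace X = {} \<or> topspace Y = {}")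
    case True
    then have nontriv: "\<not> prod_nontriv X1 Y1"
      by (auto simp: prod_nontriv_def oprod_top_def X1 Y1)
    \<comment> \<open>With \<open>is_wp_empty\<close> excluded, an empty factor must have second
      entry \<open>Some {}\<close>. The second entries of the product and of the join then are the
      whole spaces, and both homologies vanish.\<close>
    have XY: "topspace X = {} \<Longrightarrow> X2 = Some {}" "topspace Y = {} \<Longrightarrow> Y2 = Some {}"
      using assms(2-5) by (cases X2; cases Y2; auto simp: X1 Y1 pair_ok_def is_wp_empty_def)+
    obtain R where R: "prod_pair_snd X1 X2 Y1 Y2 = Some R" "topspace ?P \<subseteq> R"
      using True XY by (cases X2; cases Y2) (auto simp: aH_simps)
    obtain R' where R': "join_pair_snd X1 X2 Y1 Y2 = Some R'" "topspace ?W \<subseteq> R'"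
      using True XY by (cases X2; cases Y2) (auto simp: aH_simps topW)
    have "mod_iso (rel_hom sc q ?P R) (rel_hom sc (q + 1) ?W R')"
      by (intro mod_iso_trivial rel_hom_trivial sc R(2) R'(2))
    then show ?thesis
      using nontriv R(1) R'(1) by (simp add: X1 Y1 aH_def oprod_top_def ojoin_top_def)
  next
    case False
    then have ne: "topspace X \<noteq> {}" "topspace Y \<noteq> {}" by auto
    then have nontriv: "prod_nontriv X1 Y1"
      by (auto simp: prod_nontriv_def oprod_top_def X1 Y1)
    interpret join_topology X Y ?W
      using assms(6) join_topology_qjoin[OF ne] join_topology_hjoin[OF ne] by auto
    obtain x0 y0 where x0: "x0 \<in> topspace X" and y0: "y0 \<in> topspace Y"
      using ne by blast
    have relX: "mod_trivial (rel_hom sc q X (topspace X))" and relY: "mod_trivial (rel_hom sc q Y (topspace Y))"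
      by (auto intro: rel_hom_trivial[OF sc])
    show ?thesis
    proof (cases X2)
      case X2: None
      show ?thesis
      proof (cases Y2)
        case None
        then show ?thesis
          using product_join_absolute[OF sc join_topology_axioms] nontriv X2 by (simp add: aH_simps)
      next
        case Y2: (Some B)
        then have "B \<subseteq> topspace Y"
          using assms(3) by (simp add: pair_ok_def Y1)
        \<comment> \<open>Taking the whole of \<open>X\<close> for \<open>A\<close> makes the
          summand of \<open>(X, A)\<close> trivial, while \<open>V\<close> becomes the join of
          \<open>X\<close> with \<open>B\<close>.\<close>
        then interpret join_pair X Y ?W "topspace X" B "topspace X \<times> B" x0 y0
          by unfold_locales (use x0 in auto)
        have "mod_iso (rel_hom sc q ?P (topspace X \<times> B))
            (dsum (rel_hom sc (q + 1) ?W (jset (topspace X) B)) (rel_hom sc q Y B))"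
          using mod_iso_trans[OF rel_hom_product_join[OF sc] dsum_cong[OF dsum_trivial_right[OF relX] mod_iso_refl]]
          by (simp add: P_def V_eq_jset)
        then show ?thesis
          using nontriv X2 Y2 by (simp add: aH_simps)
      qed
    next
      case X2: (Some A)
      then have A: "A \<subseteq> topspace X"
        using assms(2) by (simp add: pair_ok_def X1)
      show ?thesis
      proof (cases Y2)
        case None
        interpret join_pair X Y ?W A "topspace Y" "A \<times> topspace Y" x0 y0
          by unfold_locales (use y0 A in auto)
        have "mod_iso (rel_hom sc q ?P (A \<times> topspace Y))
            (dsum (rel_hom sc (q + 1) ?W (jset A (topspace Y))) (rel_hom sc q X A))"
          using mod_iso_trans[OF rel_hom_product_join[OF sc] dsum_trivial_right[OF relY]]
          by (simp add: P_def V_eq_jset)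
        then show ?thesis
          using nontriv X2 None by (simp add: aH_simps)
      next
        case Y2: (Some B)
        then have B: "B \<subseteq> topspace Y"
          using assms(3) by (simp add: pair_ok_def Y1)
        let ?Q = "topspace X \<times> B \<union> A \<times> topspace Y"
        \<comment> \<open>Both end summands vanish now. As \<open>V\<close> contains both ends, it
          is the union of the joins of \<open>X\<close> with \<open>B\<close> and of
          \<open>A\<close> with \<open>Y\<close>, even if \<open>A\<close> or \<open>B\<close> is
          empty.\<close>
        interpret join_pair X Y ?W "topspace X" "topspace Y" ?Q x0 y0
          by unfold_locales (use A B in auto)
        have "V = jset (topspace X) B \<union> jset A (topspace Y)"
          using A B unfolding V_def jset_def by auto
        then have "mod_iso (rel_hom sc q ?P ?Q)
            (rel_hom sc (q + 1) ?W (jset (topspace X) B \<union> jset A (topspace Y)))"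
          using mod_iso_trans[OF mod_iso_trans[OF rel_hom_product_join[OF sc] dsum_trivial_right[OF relY]]
            dsum_trivial_right[OF relX]]
          by (simp add: P_def)
        then show ?thesis
          using nontriv X2 Y2 by (simp add: aH_simps)
      qed
    qed
  qed
qed

end
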